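(* Assume that $A(t,\omega)$ is self-adjoint and that 1. $f\in L^\alpha(\Omega;L^2((0,T);V^* ))$, 2. $u_0\in L^\beta(\Omega;H)$, 3. $A_{\min}^{-1}\in L^\gamma(\Omega;\mathbb R)$, for some exponents $\alpha,\beta,\gamma\ge1$ such that $$p:=\min\Big\{\frac{\alpha\gamma}{\alpha+\gamma},\ \frac{2\beta\gamma}{\beta+2\gamma}\Big\}\ge1 .$$ Then both the solution $u$ and the spatially semidiscrete solution $u_h$ belong to $L^p(\Omega;\mathcal Y)$. The same holds for the fully discrete solution $U$ (for which $A$ is in addition time-independent) if there is a constant $\rho_{\max}$ such that $$\rho_{\max}:=\sup_{\omega\in\Omega}|\rho(\omega)|<\infty .$$
   Context: Let $T\in(0,\infty)$ and let $(\Omega,\Sigma,\mathbb P)$ be a complete probability space with normal filtration $(\Sigma_t)_{t\in[0,T]}$. Let $V\subset H\subset V^*$ be a Gelfand triple of real separable Hilbert spaces, $V$ continuously and densely embedded in $H$, with dual pairing ${}_{V^*}\langle\cdot,\cdot\rangle_V$ extending the inner product $\langle\cdot,\cdot\rangle_H$. Let $A\colon[0,T]\times\Omega\to\mathcal L(V,V^* )$ be progressively measurable, $a(t,\omega;u,v):={}_{V^*}\langle A(t,\omega)u,v\rangle_V$, and assume there are random variables $A_{\min},A_{\max}$, positive and finite $\mathbb P$-a.s., such that for all $t\in[0,T]$, $u,v\in V$: $|a(t,\omega;u,v)|\le A_{\max}(\omega)\|u\|_V\|v\|_V$ and $a(t,\omega;v,v)\ge A_{\min}(\omega)\|v\|_V^2$.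 Put $\rho:=A_{\max}/A_{\min}$. Let $f$ be a progressively measurable $V^*$-valued process with $f(\cdot,\omega)\in L^2((0,T);V^* )$ and $u_0$ measurable with $u_0(\omega)\in H$. Infinite exponents are allowed, with formulas for $p$ understood as limits. Let $\mathcal Y:=L^2((0,T);V)$ and $\mathcal X_{0,\{T\}}:=\{x\in L^2((0,T);V)\cap H^1((0,T);V^* ):x(T)=0\}$. Define $$\mathcal B^*_\omega(y,x):=\int_0^T\big({}_V\langle y(t),-\dot x(t)\rangle_{V^*}+a(t,\omega;y(t),x(t))\big)dt,\qquad \mathcal F_\omega(x):=\int_0^T{}_{V^*}\langle f(t,\omega),x(t)\rangle_V\,dt+\langle u_0(\omega),x(0)\rangle_H .$$ For a.e. $\omega$: (i) $u=u(\cdot,\omega)\in\mathcal Y$ is the unique solution of $\mathcal B^*_\omega(u,x)=\mathcal F_\omega(x)$ for all $x\in\mathcal X_{0,\{T\}}$. (ii) $u_h=u_h(\cdot,\omega)\in\mathcal Y^h:=L^2((0,T);V_h)$ is the unique solution of $\mathcal B^*_\omega(u_h,x_h)=\mathcal F_\omega(x_h)$ for all $x_h\in L^2((0,T);V_h)\cap H^1((0,T);V_h^* )$ with $x_h(T)=0$, where $V_h\subset V$ is a nonzero finite-dimensional subspace. (iii) For the full discretization, $A$ is also time-independent. Let $0=t_0<\dots<t_N=T$ be a partition, $k=\max_i(t_{i+1}-t_i)$, $q\ge0$ an integer. $Q_{k,q}$ is the space of piecewise polynomials (on the partition) of degree at most $q$, $S_{k,q+1}$ that of continuous piecewise polynomials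 of degree at most $q+1$. $U=U(\cdot,\omega)\in\mathcal Y^{h,k,q}:=Q_{k,q}\otimes V_h$ is the unique solution of $\mathcal B^*_\omega(U,X)=\mathcal F_\omega(X)$ for all $X\in S_{k,q+1}\otimes V_h$ with $X(T)=0$. Standing assumptions on the discretizations: the $H$-orthogonal projection onto $V_h$ is stable in the $V$-norm, uniformly in $h$; and, for the full discretization, the CFL condition holds: $c_S:=k\sup_{0\ne v\in V_h}\frac{\|v\|_V}{\|v\|_{V^*}}$ is bounded for all $h$ and $k$. *)

theory Defs
  imports "HOL-Probability.Probability" "HOL-Computational_Algebra.Polynomial"
begin

section \<open>Gelfand triple\<close>

text \<open>The spaces \<open>V\<close> and \<open>H\<close> are types, \<open>V\<^sup>*\<close> is \<open>'v \<Rightarrow>\<^sub>L real\<close> with the operator norm, and the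
  inclusion of \<open>V\<close> in \<open>H\<close> is an explicit map \<open>emb\<close>. The inclusion of \<open>H\<close> in \<open>V\<^sup>*\<close> sends \<open>x\<close> to
  \<open>\<lambda>v. x \<bullet> emb v\<close>, so the dual pairing (application of a functional) extends the inner product
  of \<open>H\<close>.\<close>

definition gelfand_triple :: "('v::real_inner \<Rightarrow>\<^sub>L 'h::real_inner) \<Rightarrow> bool" where
  "gelfand_triple emb \<longleftrightarrow> inj (blinfun_apply emb) \<and> closure (range (blinfun_apply emb)) = UNIV"

definition to_dual :: "('v::real_inner \<Rightarrow>\<^sub>L 'h::real_inner) \<Rightarrow> 'v \<Rightarrow> ('v \<Rightarrow>\<^sub>L real)" where
  "to_dual emb v = blinfun_inner_right (emb v) o\<^sub>L emb"

section \<open>Filtrations and progressive measurability\<close>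

definition normal_filtration :: "'w measure \<Rightarrow> real \<Rightarrow> (real \<Rightarrow> 'w measure) \<Rightarrow> bool" where
  "normal_filtration M T F \<longleftrightarrow>
     (\<forall>t\<in>{0..T}. subalgebra M (F t)) \<and>
     (\<forall>s\<in>{0..T}. \<forall>t\<in>{0..T}. s \<le> t \<longrightarrow> sets (F s) \<subseteq> sets (F t)) \<and>
     null_sets M \<subseteq> sets (F 0) \<and>
     (\<forall>t\<in>{0..<T}. sets (F t) = (\<Inter>s\<in>{t<..T}. sets (F s)))"

definition progressively_measurable ::
    "real \<Rightarrow> (real \<Rightarrow> 'w measure) \<Rightarrow> (real \<Rightarrow> 'w \<Rightarrow> 'b::topological_space) \<Rightarrow> bool" where
  "progressively_measurable T F X \<longleftrightarrow>
     (\<forall>t\<in>{0..T}. (\<lambda>(s, \<omega>). X s \<omega>) \<in>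
        borel_measurable (restrict_space borel {0..t} \<Otimes>\<^sub>M F t))"

text \<open>For operator-valued processes measurability is meant in the strong operator sense. This is
  implied by Borel measurability with respect to the operator norm.\<close>

definition progressively_measurable_op ::
    "real \<Rightarrow> (real \<Rightarrow> 'w measure) \<Rightarrow>
     (real \<Rightarrow> 'w \<Rightarrow> 'v::real_normed_vector \<Rightarrow>\<^sub>L 'b::real_normed_vector) \<Rightarrow> bool" where
  "progressively_measurable_op T F A \<longleftrightarrow>
     (\<forall>v. progressively_measurable T F (\<lambda>t \<omega>. blinfun_apply (A t \<omega>) v))"

lemma progressively_measurable_imp_op:
  assumes "progressively_measurable T F A"
  shows "progressively_measurable_op T F A"
proof -
  have "(\<lambda>B. blinfun_apply B v) \<in> borel_measurable borel" for v
    by (intro borel_measurable_continuous_onI continuous_intros)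
  from measurable_compose[OF _ this] assms show ?thesis
    unfolding progressively_measurable_op_def progressively_measurable_def split_def by auto
qed

section \<open>Bochner spaces\<close>

text \<open>Elements of \<open>L\<^sup>2((0,T);W)\<close> are handled through representatives; \<open>W\<close> is a subspace of the
  value type.\<close>

abbreviation time_measure :: "real \<Rightarrow> real measure" where
  "time_measure T \<equiv> lebesgue_on {0<..<T}"

definition L2 :: "real \<Rightarrow> 'b::real_normed_vector set \<Rightarrow> (real \<Rightarrow> 'b) set" where
  "L2 T W = {y. y \<in> borel_measurable (time_measure T) \<and>
               integrable (time_measure T) (\<lambda>t. (norm (y t))\<^sup>2) \<and>
               (AE t in time_measure T. y t \<in> W)}"

definition L2_norm :: "real \<Rightarrow> (real \<Rightarrow> 'b::real_normed_vector) \<Rightarrow> real" where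
  "L2_norm T y = sqrt (LINT t|time_measure T. (norm (y t))\<^sup>2)"

text \<open>Membership of \<open>g\<close> in \<open>L\<^sup>p(M;S)\<close>, where \<open>S\<close> carries the (semi)norm \<open>nrm\<close>: strong
  measurability, that is, almost everywhere approximation in \<open>nrm\<close> by simple functions, and a
  finite \<open>p\<close>-norm. The seminorm is a parameter because \<open>S\<close> may consist of representatives of
  \<open>L\<^sup>2\<close>-classes.\<close>

definition in_Lp ::
    "'w measure \<Rightarrow> ennreal \<Rightarrow> 'b::minus set \<Rightarrow> ('b \<Rightarrow> real) \<Rightarrow> ('w \<Rightarrow> 'b) \<Rightarrow> bool" where
  "in_Lp M p S nrm g \<longleftrightarrow>
     (\<exists>s. (\<forall>n::nat. simple_function M (s n) \<and> s n ` space M \<subseteq> S) \<and>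
          (AE \<omega> in M. g \<omega> \<in> S \<and> (\<lambda>n. nrm (g \<omega> - s n \<omega>)) \<longlonglongrightarrow> 0)) \<and>
     (if p = \<infinity> then \<exists>C. AE \<omega> in M. nrm (g \<omega>) \<le> C
      else (\<integral>\<^sup>+\<omega>. ennreal (nrm (g \<omega>) powr enn2real p) \<partial>M) < \<infinity>)"

text \<open>The expression \<open>a b / (a + b)\<close>, extended to infinite arguments by its limits.\<close>

definition harmonic_exponent :: "ennreal \<Rightarrow> ennreal \<Rightarrow> ennreal" where
  "harmonic_exponent a b =
     (if a = \<infinity> then b else if b = \<infinity> then a else a * b / (a + b))"

section \<open>Weak derivatives and test spaces\<close>

definition test_function :: "real \<Rightarrow> (real \<Rightarrow> real) \<Rightarrow> bool" where
  "test_function T \<phi> \<longleftrightarrow>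
     (\<forall>n t. (deriv ^^ n) \<phi> differentiable (at t)) \<and>
     (\<exists>a b. 0 < a \<and> b < T \<and> (\<forall>t. t \<notin> {a..b} \<longrightarrow> \<phi> t = 0))"

text \<open>Let \<open>W\<close> be a closed subspace of \<open>V\<close>. A function with values in \<open>W\<^sup>*\<close> is represented by a
  function \<open>g\<close> with values in \<open>V\<^sup>*\<close>, of which only the restrictions to \<open>W\<close> matter: composing
  with the orthogonal projection of \<open>V\<close> onto \<open>W\<close> embeds \<open>W\<^sup>*\<close> isometrically in \<open>V\<^sup>*\<close>. The identity of
  Bochner integrals in \<open>W\<^sup>*\<close> that defines the distributional derivative is evaluated at each
  \<open>w \<in> W\<close>.\<close>

definition weak_derivative ::
    "('v::real_inner \<Rightarrow>\<^sub>L 'h::real_inner) \<Rightarrow> real \<Rightarrow> 'v set \<Rightarrow>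
     (real \<Rightarrow> 'v) \<Rightarrow> (real \<Rightarrow> 'v \<Rightarrow>\<^sub>L real) \<Rightarrow> bool" where
  "weak_derivative emb T W x g \<longleftrightarrow>
     (\<forall>\<phi>. test_function T \<phi> \<longrightarrow> (\<forall>w\<in>W.
        (LINT t|time_measure T. deriv \<phi> t * to_dual emb (x t) w) =
        - (LINT t|time_measure T. \<phi> t * g t w)))"

text \<open>The space of \<open>x \<in> L\<^sup>2((0,T);W) \<inter> H\<^sup>1((0,T);W\<^sup>*)\<close> with \<open>x(T) = 0\<close>. An element \<open>x\<close> is listed
  together with its derivative \<open>g\<close> and its representative \<open>xH \<in> C([0,T];H)\<close>, which defines
  the point values \<open>x(0)\<close> and \<open>x(T)\<close>. Both are determined by \<open>x\<close>: \<open>g\<close> as a \<open>W\<^sup>*\<close>-valued function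
  up to null sets, \<open>xH\<close> on \<open>[0,T]\<close>. Taking \<open>W = UNIV\<close> gives the
  space for \<open>V\<close> itself.\<close>

definition test_space ::
    "('v::real_inner \<Rightarrow>\<^sub>L 'h::real_inner) \<Rightarrow> real \<Rightarrow> 'v set \<Rightarrow>
     ((real \<Rightarrow> 'v) \<times> (real \<Rightarrow> 'v \<Rightarrow>\<^sub>L real) \<times> (real \<Rightarrow> 'h)) set" where
  "test_space emb T W =
     {(x, g, xH). x \<in> L2 T W \<and> g \<in> L2 T UNIV \<and> weak_derivative emb T W x g \<and>
        continuous_on {0..T} xH \<and> (AE t in time_measure T. xH t = emb (x t)) \<and> xH T = 0}"

section \<open>The variational problems\<close>

text \<open>In the next two definitions \<open>A\<close>, \<open>f\<close> and \<open>u0\<close> are the data for one fixed \<open>\<omega>\<close>.\<close>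

definition B_star ::
    "real \<Rightarrow> (real \<Rightarrow> 'v::real_normed_vector \<Rightarrow>\<^sub>L 'v \<Rightarrow>\<^sub>L real) \<Rightarrow>
     (real \<Rightarrow> 'v) \<Rightarrow> (real \<Rightarrow> 'v) \<Rightarrow> (real \<Rightarrow> 'v \<Rightarrow>\<^sub>L real) \<Rightarrow> real" where
  "B_star T A y x g = (LINT t|time_measure T. - g t (y t) + A t (y t) (x t))"

definition F_load ::
    "real \<Rightarrow> (real \<Rightarrow> 'v::real_normed_vector \<Rightarrow>\<^sub>L real) \<Rightarrow> 'h::real_inner \<Rightarrow>
     (real \<Rightarrow> 'v) \<Rightarrow> (real \<Rightarrow> 'h) \<Rightarrow> real" where
  "F_load T f u0 x xH = (LINT t|time_measure T. f t (x t)) + u0 \<bullet> xH 0"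

definition unique_solution ::
    "real \<Rightarrow> (real \<Rightarrow> 'v::real_normed_vector \<Rightarrow>\<^sub>L 'v \<Rightarrow>\<^sub>L real) \<Rightarrow>
     (real \<Rightarrow> 'v \<Rightarrow>\<^sub>L real) \<Rightarrow> 'h::real_inner \<Rightarrow> (real \<Rightarrow> 'v) set \<Rightarrow>
     ((real \<Rightarrow> 'v) \<times> (real \<Rightarrow> 'v \<Rightarrow>\<^sub>L real) \<times> (real \<Rightarrow> 'h)) set \<Rightarrow> (real \<Rightarrow> 'v) \<Rightarrow> bool" where
  "unique_solution T A f u0 Trial Test y \<longleftrightarrow>
     (let sol = (\<lambda>z. z \<in> Trial \<and>
                  (\<forall>(x, g, xH)\<in>Test. B_star T A z x g = F_load T f u0 x xH))
      in sol y \<and> (\<forall>z. sol z \<longrightarrow> (AE t in time_measure T. z t = y t)))"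

section \<open>Discretization\<close>

definition is_partition :: "real \<Rightarrow> nat \<Rightarrow> (nat \<Rightarrow> real) \<Rightarrow> bool" where
  "is_partition T N \<tau> \<longleftrightarrow> \<tau> 0 = 0 \<and> \<tau> N = T \<and> (\<forall>i<N. \<tau> i < \<tau> (Suc i))"

definition mesh :: "nat \<Rightarrow> (nat \<Rightarrow> real) \<Rightarrow> real" where
  "mesh N \<tau> = Max ((\<lambda>i. \<tau> (Suc i) - \<tau> i) ` {..<N})"

text \<open>Values at the nodes are irrelevant for discontinuous piecewise polynomials, which are
  elements of \<open>L\<^sup>2\<close>.\<close>

definition pw_poly :: "nat \<Rightarrow> (nat \<Rightarrow> real) \<Rightarrow> nat \<Rightarrow> (real \<Rightarrow> real) set" where
  "pw_poly N \<tau> q =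
     {\<phi>. \<forall>i<N. \<exists>P. degree P \<le> q \<and> (\<forall>t\<in>{\<tau> i<..<\<tau> (Suc i)}. \<phi> t = poly P t)}"

definition cont_pw_poly :: "nat \<Rightarrow> (nat \<Rightarrow> real) \<Rightarrow> nat \<Rightarrow> (real \<Rightarrow> real) set" where
  "cont_pw_poly N \<tau> q = {\<phi> \<in> pw_poly N \<tau> q. continuous_on {\<tau> 0..\<tau> N} \<phi>}"

definition tensor_space ::
    "(real \<Rightarrow> real) set \<Rightarrow> 'v::real_vector set \<Rightarrow> (real \<Rightarrow> 'v) set" where
  "tensor_space Q W =
     {\<lambda>t. \<Sum>j<m. \<phi> j t *\<^sub>R w j |(m::nat) \<phi> w. \<forall>j<m. \<phi> j \<in> Q \<and> w j \<in> W}"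

definition nonzero_fin_dim_subspace :: "'v::real_vector set \<Rightarrow> bool" where
  "nonzero_fin_dim_subspace W \<longleftrightarrow> W \<noteq> {0} \<and> (\<exists>B. finite B \<and> W = span B)"

definition H_projection ::
    "('v::real_inner \<Rightarrow>\<^sub>L 'h::real_inner) \<Rightarrow> 'v set \<Rightarrow> 'h \<Rightarrow> 'v" where
  "H_projection emb W x = (THE p. p \<in> W \<and> (\<forall>w\<in>W. (x - emb p) \<bullet> emb w = 0))"

text \<open>The supremum is over a bounded set because \<open>W\<close> is finite-dimensional.\<close>

definition cfl_constant ::
    "('v::real_inner \<Rightarrow>\<^sub>L 'h::real_inner) \<Rightarrow> 'v set \<Rightarrow> real \<Rightarrow> real" where
  "cfl_constant emb W k = k * (SUP v\<in>W - {0}. norm v / norm (to_dual emb v))"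

end

theory Submission
  imports Defs
begin

text \<open>All three solutions satisfy \<open>B(y, x) = F(x)\<close> for \<open>y\<close> in a closed subspace \<open>S\<close> of \<open>L\<^sup>2((0,T);V)\<close>, and
  uniqueness means that the functionals \<open>B(\<cdot>, x)\<close> separate the points of \<open>S\<close>. By the projection
  theorem the norm of \<open>y\<close> is then the supremum of \<open>\<bar>F(x)\<bar> / \<parallel>B(\<cdot>, x)\<parallel>\<close> over the test functions, where
  \<open>\<parallel>B(\<cdot>, x)\<parallel>\<close> is the dual norm on \<open>S\<close>.

  This gives the bound: if some \<open>z\<close> in \<open>S\<close> satisfies \<open>B(z, x) \<ge> \<parallel>x(0)\<parallel>\<^sup>2 / 2 + A\<^sub>m\<^sub>i\<^sub>n \<parallel>z\<parallel>\<^sup>2\<close> and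
  \<open>\<parallel>x\<parallel> \<le> C \<parallel>z\<parallel>\<close>, then \<open>\<parallel>y\<parallel> \<le> C \<parallel>f\<parallel> / A\<^sub>m\<^sub>i\<^sub>n + (2 / A\<^sub>m\<^sub>i\<^sub>n)\<^bsup>1/2\<^esup> \<parallel>u\<^sub>0\<parallel>\<close>. For \<open>u\<close> and \<open>u\<^sub>h\<close> one takes
  \<open>z = x\<close> and the energy identity; for \<open>U\<close> one takes for \<open>z\<close> the \<open>L\<^sup>2\<close>-projection of \<open>x\<close> onto the trial space,
  which is injective on the finite-dimensional test space. It also gives measurability in \<open>\<omega>\<close>: the distance of
  the solution to a fixed trial function is a supremum of the same kind, which may be taken over countable
  dense sets that do not depend on \<open>\<omega>\<close>.\<close>

section \<open>Hilbert spaces\<close>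

text \<open>The obstacle is that \<open>u\<close> is an arbitrary choice of solutions: nothing links
  \<open>u \<omega>\<close> for different \<omega>, and its values are functions rather than
  classes. The norm formula helps because the solution enters it only through F(x), which is
  measurable in \<omega>. No inf-sup constant is estimated: uniqueness makes the projected
  functionals dense, and then one good z for each x bounds the solution. Self-adjointness makes B(.,
  x) a function of A applied to the fixed test function, so strong measurability of A suffices. The
  half of |x(0)|^2 is the energy identity, to be proved for derivatives that exist only weakly with
  values in the dual of V; it is the source of the 2 under the root. The inverse of Amin has power
  1/2 at u0 and this root lies in L^(2 gamma), whence 2 gamma in the second exponent. For U the
  constant C comes from injectivity on a finite-dimensional space; it depends on the discretization
  but not on \<omega>, as membership of each single U in L^p requires.\<close>

lemma hilbert_projection:
  fixes S :: "'a::{real_inner,banach} set"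
  assumes "closed S" "subspace S"
  obtains p where "p \<in> S" "\<And>s. s \<in> S \<Longrightarrow> (x - p) \<bullet> s = 0"
proof -
  define d where "d = (INF s\<in>S. (norm (x - s))\<^sup>2)"
  have bdd: "bdd_below ((\<lambda>s. (norm (x - s))\<^sup>2) ` S)" by (rule bdd_belowI[of _ 0]) auto
  have ne: "S \<noteq> {}" using subspace_0[OF assms(2)] by auto
  have d_le: "d \<le> (norm (x - s))\<^sup>2" if "s \<in> S" for s
    unfolding d_def by (rule cINF_lower[OF bdd that])
  have "\<exists>s\<in>S. (norm (x - s))\<^sup>2 < d + 1 / real (Suc n)" for n
    using cInf_lessD[of "(\<lambda>s. (norm (x - s))\<^sup>2) ` S" "d + 1 / real (Suc n)"] ne
    by (fastforce simp: d_def)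
  then obtain s where sS: "\<And>n. s n \<in> S" and s: "\<And>n. (norm (x - s n))\<^sup>2 < d + 1 / real (Suc n)"
    by metis
  \<comment> \<open>The midpoint of two near-minimizers lies in S, so the parallelogram identity
    makes a minimizing sequence Cauchy.\<close>
  have parallel: "(norm (a - b))\<^sup>2 = 2 * (norm (x - a))\<^sup>2 + 2 * (norm (x - b))\<^sup>2
      - 4 * (norm (x - (1/2) *\<^sub>R (a + b)))\<^sup>2" for a b :: 'a
    by (simp add: power2_norm_eq_inner inner_simps inner_commute field_simps)
  have close: "(norm (s m - s n))\<^sup>2 \<le> 2 / real (Suc m) + 2 / real (Suc n)" for m n
  proof -
    have "(1/2) *\<^sub>R (s m + s n) \<in> S"
      using sS assms(2) by (intro subspace_mul subspace_add) auto
    from d_le[OF this] have "(norm (s m - s n))\<^sup>2 \<le> 2 * (1 / real (Suc m)) + 2 * (1 / real (Suc n))"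
      using parallel[of "s m" "s n"] s[of m] s[of n] by linarith
    then show ?thesis by simp
  qed
  have "Cauchy s"
  proof (rule metric_CauchyI)
    fix e :: real assume "e > 0"
    then obtain k where k: "4 / e\<^sup>2 < real k" using reals_Archimedean2 by blast
    then have k0: "k > 0" using \<open>e > 0\<close> by (cases k) (auto simp: field_simps mult_less_0_iff)
    have "dist (s m) (s n) < e" if "m \<ge> k" "n \<ge> k" for m n
    proof -
      have "2 / real (Suc m) < 2 / real k" "2 / real (Suc n) < 2 / real k"
        using that k0 by (auto intro!: divide_strict_left_mono)
      then have "(norm (s m - s n))\<^sup>2 < 4 / real k" using close[of m n] by simp
      also have "\<dots> < e\<^sup>2" using k k0 \<open>e > 0\<close> by (simp add: field_simps)
      finally show ?thesis using \<open>e > 0\<close> by (simp add: dist_norm power_less_imp_less_base)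
    qed
    then show "\<exists>M. \<forall>m\<ge>M. \<forall>n\<ge>M. dist (s m) (s n) < e" by blast
  qed
  then obtain p where p: "s \<longlonglongrightarrow> p" using Cauchy_convergent convergent_def by blast
  have pS: "p \<in> S" using closed_sequentially[OF assms(1)] sS p by blast
  have "(\<lambda>n. d + 1 / real (Suc n)) \<longlonglongrightarrow> d + 0"
    by (intro tendsto_intros LIMSEQ_Suc[OF lim_1_over_n])
  moreover have "(\<lambda>n. (norm (x - s n))\<^sup>2) \<longlonglongrightarrow> (norm (x - p))\<^sup>2"
    by (intro tendsto_intros p)
  ultimately have pd: "(norm (x - p))\<^sup>2 \<le> d"
    using LIMSEQ_le s less_imp_le by (metis (no_types, lifting) add.right_neutral)
  have "(x - p) \<bullet> v = 0" if v: "v \<in> S" for v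
  proof (cases "v = 0")
    case False
    \<comment> \<open>Moving p by the best multiple of v would lower the squared distance by ((x -
      p) \<bullet> v)^2 / (v \<bullet> v), which therefore vanishes.\<close>
    define c where "c = ((x - p) \<bullet> v) / (v \<bullet> v)"
    have vv: "v \<bullet> v > 0" using False by simp
    have "p + c *\<^sub>R v \<in> S" using pS v assms(2) by (intro subspace_mul subspace_add) auto
    from d_le[OF this] pd have "(norm (x - p))\<^sup>2 \<le> (norm (x - p - c *\<^sub>R v))\<^sup>2"
      unfolding diff_diff_eq by linarith
    also have "\<dots> = (norm (x - p))\<^sup>2 - 2 * c * ((x - p) \<bullet> v) + c\<^sup>2 * (v \<bullet> v)"
      by (simp only: power2_norm_eq_inner) (simp add: inner_simps inner_commute algebra_simps power2_eq_square)
    also have "\<dots> = (norm (x - p))\<^sup>2 - ((x - p) \<bullet> v)\<^sup>2 / (v \<bullet> v)"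
      using vv by (simp add: c_def field_simps power2_eq_square)
    finally have "((x - p) \<bullet> v)\<^sup>2 / (v \<bullet> v) \<le> 0" by simp
    then have "((x - p) \<bullet> v)\<^sup>2 \<le> 0" using vv by (simp add: divide_le_0_iff)
    then show ?thesis by simp
  qed simp
  with pS show ?thesis using that by blast
qed

lemma riesz_representation:
  fixes f :: "'a::{real_inner,banach} \<Rightarrow>\<^sub>L real"
  obtains k where "\<And>z. f z = z \<bullet> k" "norm k = norm f"
proof -
  have "\<exists>k. \<forall>z. f z = z \<bullet> k"
  proof (cases "\<forall>z. f z = 0")
    case False
    then obtain x where x: "f x \<noteq> 0" by blast
    let ?S = "{z. f z = 0}"
    have "closed ?S" by (intro closed_Collect_eq continuous_intros)
    moreover have "subspace ?S"
      by (auto simp: subspace_def blinfun.add_right blinfun.scaleR_right)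
    ultimately obtain p where p: "p \<in> ?S" "\<And>s. s \<in> ?S \<Longrightarrow> (x - p) \<bullet> s = 0"
      using hilbert_projection by metis
    define e where "e = x - p"
    have fe: "f e \<noteq> 0" using x p(1) by (simp add: e_def blinfun.diff_right)
    then have ee: "e \<bullet> e > 0" by (metis blinfun.zero_right inner_gt_zero_iff)
    have "f z = z \<bullet> ((f e / (e \<bullet> e)) *\<^sub>R e)" for z
    proof -
      have "z - (f z / f e) *\<^sub>R e \<in> ?S" using fe by (simp add: blinfun.diff_right blinfun.scaleR_right)
      then have "e \<bullet> (z - (f z / f e) *\<^sub>R e) = 0" using p(2) e_def by blast
      then show ?thesis using fe ee by (simp add: inner_simps inner_commute field_simps)
    qed
    then show ?thesis by blast
  qed (auto intro!: exI[of _ 0])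
  then obtain k where k: "\<And>z. f z = z \<bullet> k" by blast
  have "norm f \<le> norm k"
    by (rule norm_blinfun_bound) (use Cauchy_Schwarz_ineq2 in \<open>auto simp: k mult.commute\<close>)
  moreover have "norm k * norm k \<le> norm f * norm k"
    using norm_blinfun[of f k] by (simp add: k dot_square_norm power2_eq_square)
  then have "norm k \<le> norm f" by (cases "k = 0") (auto simp: mult_le_cancel_right)
  ultimately show ?thesis using that k by force
qed

text \<open>The dual of V carries no inner product as a type. Through this isometry square
  integrability, measurability and orthogonality of functionals are read off in V itself.\<close>

definition riesz :: "('a::{real_inner,banach} \<Rightarrow>\<^sub>L real) \<Rightarrow> 'a" where
  "riesz f = (SOME k. (\<forall>z. f z = z \<bullet> k) \<and> norm k = norm f)"

lemma riesz: "z \<bullet> riesz f = f z" "norm (riesz f) = norm f"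
proof -
  have "(\<forall>z. f z = z \<bullet> riesz f) \<and> norm (riesz f) = norm f"
    unfolding riesz_def by (rule someI_ex) (metis riesz_representation)
  then show "z \<bullet> riesz f = f z" "norm (riesz f) = norm f" by simp_all
qed

lemma riesz_unique:
  fixes f :: "'a::{real_inner,banach} \<Rightarrow>\<^sub>L real"
  shows "(\<And>z. z \<bullet> k = f z) \<Longrightarrow> riesz f = k"
  by (metis riesz(1) vector_eq_rdot inner_commute)

lemma bounded_linear_riesz: "bounded_linear riesz"
proof
  show "riesz (f + g) = riesz f + riesz g" for f g :: "'a \<Rightarrow>\<^sub>L real"
    by (rule riesz_unique) (simp add: inner_simps riesz blinfun.add_left)
  show "riesz (c *\<^sub>R f) = c *\<^sub>R riesz f" for c and f :: "'a \<Rightarrow>\<^sub>L real"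
    by (rule riesz_unique) (simp add: inner_simps riesz blinfun.scaleR_left)
  show "\<exists>K. \<forall>f::'a \<Rightarrow>\<^sub>L real. norm (riesz f) \<le> norm f * K" by (intro exI[of _ 1]) (simp add: riesz)
qed

lemmas riesz_add = linear_add[OF bounded_linear.linear[OF bounded_linear_riesz]]
lemmas riesz_diff = linear_diff[OF bounded_linear.linear[OF bounded_linear_riesz]]
lemmas riesz_scaleR = linear_scale[OF bounded_linear.linear[OF bounded_linear_riesz]]

lemma borel_measurable_riesz [measurable (raw)]:
  "f \<in> borel_measurable M \<Longrightarrow> (\<lambda>x. riesz (f x)) \<in> borel_measurable M"
  by (rule borel_measurable_continuous_on[OF linear_continuous_on[OF bounded_linear_riesz]])

lemma subspace_closure:
  fixes S :: "'a::real_normed_vector set"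
  assumes "subspace S"
  shows "subspace (closure S)"
proof (rule subspaceI)
  show "0 \<in> closure S" using subspace_0[OF assms] closure_subset by blast
next
  fix x y assume "x \<in> closure S" "y \<in> closure S"
  then obtain a b where "\<And>n. a n \<in> S" "a \<longlonglongrightarrow> x" "\<And>n. b n \<in> S" "b \<longlonglongrightarrow> y"
    by (auto simp: closure_sequential)
  then have "\<forall>n. a n + b n \<in> S" "(\<lambda>n. a n + b n) \<longlonglongrightarrow> x + y"
    using subspace_add[OF assms] tendsto_add by blast+
  then show "x + y \<in> closure S" unfolding closure_sequential by (intro exI conjI)
next
  fix c x assume "x \<in> closure S"
  then obtain a where "\<And>n. a n \<in> S" "a \<longlonglongrightarrow> x"
    by (auto simp: closure_sequential)
  then have "\<forall>n. c *\<^sub>R a n \<in> S" "(\<lambda>n. c *\<^sub>R a n) \<longlonglongrightarrow> c *\<^sub>R x"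
    using subspace_mul[OF assms] tendsto_scaleR tendsto_const by blast+
  then show "c *\<^sub>R x \<in> closure S" unfolding closure_sequential by (intro exI conjI)
qed

lemma dense_if_orthogonal_trivial:
  fixes K :: "'a::{real_inner,banach} set"
  assumes "subspace K" "\<And>z. (\<And>k. k \<in> K \<Longrightarrow> z \<bullet> k = 0) \<Longrightarrow> z = 0"
  shows "closure K = UNIV"
proof -
  have "x \<in> closure K" for x
  proof -
    obtain p where p: "p \<in> closure K" "\<And>s. s \<in> closure K \<Longrightarrow> (x - p) \<bullet> s = 0"
      using hilbert_projection[OF closed_closure subspace_closure[OF assms(1)]] by metis
    then have "x - p = 0" using assms(2) closure_subset by blast
    then show ?thesis using p(1) by simp
  qed
  then show ?thesis by blast
qed

lemma hilbert_projection_linear: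
  fixes S :: "'a::{real_inner,banach} set"
  assumes S: "closed S" "subspace S"
  obtains P where "linear P" "\<And>x. P x \<in> S" "\<And>s x. s \<in> S \<Longrightarrow> s \<bullet> P x = s \<bullet> x"
proof -
  define P where "P = (\<lambda>x. SOME p. p \<in> S \<and> (\<forall>s\<in>S. (x - p) \<bullet> s = 0))"
  have P: "P x \<in> S \<and> (\<forall>s\<in>S. (x - P x) \<bullet> s = 0)" for x
    unfolding P_def by (rule someI_ex) (metis hilbert_projection[OF S])
  have Pin: "s \<bullet> P x = s \<bullet> x" if "s \<in> S" for s x
  proof -
    have "(x - P x) \<bullet> s = 0" using P that by blast
    then show ?thesis by (simp add: inner_diff_right inner_commute[of _ s])
  qed
  have P_unique: "P x = p" if "p \<in> S" "\<And>s. s \<in> S \<Longrightarrow> s \<bullet> p = s \<bullet> x" for x p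
  proof -
    have "P x - p \<in> S" using P that subspace_diff[OF S(2)] by blast
    then have "(P x - p) \<bullet> (P x - p) = 0" using that Pin by (simp add: inner_diff_right)
    then show ?thesis by simp
  qed
  have P_add: "P (x + z) = P x + P z" for x z
    by (rule P_unique) (auto simp: P Pin inner_add_right intro: subspace_add[OF S(2)])
  have P_scale: "P (c *\<^sub>R x) = c *\<^sub>R P x" for c x
    by (rule P_unique) (auto simp: P Pin intro: subspace_mul[OF S(2)])
  show ?thesis using that[OF linearI[OF P_add P_scale]] P Pin by blast
qed

lemma norm_le_dual_on_subspace:
  fixes S K :: "'a::{real_inner,banach} set"
  assumes S: "closed S" "subspace S" and K: "subspace K"
    and total: "\<And>z. z \<in> S \<Longrightarrow> (\<And>k. k \<in> K \<Longrightarrow> z \<bullet> k = 0) \<Longrightarrow> z = 0"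
    and y: "y \<in> S"
    and bound: "\<And>k c. k \<in> K \<Longrightarrow> 0 \<le> c \<Longrightarrow> (\<And>z. z \<in> S \<Longrightarrow> z \<bullet> k \<le> c * norm z) \<Longrightarrow> y \<bullet> k \<le> C * c"
  shows "norm y \<le> C"
proof -
  obtain P where P: "linear P" "\<And>x. P x \<in> S" and Pin: "\<And>s x. s \<in> S \<Longrightarrow> s \<bullet> P x = s \<bullet> x"
    using hilbert_projection_linear[OF S] by metis
  have "subspace (P ` K)" by (rule linear_subspace_image[OF P(1) K])
  then obtain p where p: "p \<in> closure (P ` K)" "\<And>s. s \<in> closure (P ` K) \<Longrightarrow> (y - p) \<bullet> s = 0"
    using hilbert_projection[OF closed_closure subspace_closure] by metis
  have "closure (P ` K) \<subseteq> S" using P(2) S(1) by (intro closure_minimal) auto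
  then have ypS: "y - p \<in> S" using p y subspace_diff[OF S(2)] by blast
  have "y - p = 0"
  proof (rule total[OF ypS])
    fix k assume "k \<in> K"
    then have "P k \<in> closure (P ` K)" by (intro subsetD[OF closure_subset] imageI)
    then show "(y - p) \<bullet> k = 0" using p(2)[of "P k"] Pin[OF ypS, of k] by simp
  qed
  then have "y \<in> closure (P ` K)" using p by simp
  then obtain a where a: "\<And>n. a n \<in> P ` K" "a \<longlonglongrightarrow> y" by (auto simp: closure_sequential)
  then have "\<forall>n. \<exists>k\<in>K. a n = P k" by blast
  then obtain k where k: "\<And>n. k n \<in> K" "\<And>n. a n = P (k n)" by metis
  have "a = (\<lambda>n. P (k n))" using k(2) by blast
  with a(2) have lim: "(\<lambda>n. P (k n)) \<longlonglongrightarrow> y" by simp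
  have "y \<bullet> P (k n) \<le> C * norm (P (k n))" for n
  proof -
    have "z \<bullet> k n \<le> norm (P (k n)) * norm z" if "z \<in> S" for z
      using norm_cauchy_schwarz[of z "P (k n)"] Pin[OF that] by (simp add: mult.commute)
    from bound[OF k(1) _ this] show ?thesis using Pin[OF y] by simp
  qed
  moreover have "(\<lambda>n. y \<bullet> P (k n)) \<longlonglongrightarrow> y \<bullet> y" "(\<lambda>n. C * norm (P (k n))) \<longlonglongrightarrow> C * norm y"
    by (intro tendsto_intros lim)+
  ultimately have "y \<bullet> y \<le> C * norm y" by (intro LIMSEQ_le) auto
  then have "norm y * norm y \<le> C * norm y" by (simp add: dot_square_norm power2_eq_square)
  then show ?thesis
  proof (cases "y = 0")
    case True
    \<comment> \<open>Division by |y| says nothing here; the hypothesis for k = 0 and c = 1 gives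
      the sign of C.\<close>
    have "0 \<le> C"
      using bound[OF subspace_0[OF K], of 1] True by simp
    with True show ?thesis by simp
  qed simp
qed

lemma orthogonal_expansion:
  fixes C :: "'a::real_inner set"
  assumes "finite C" "pairwise orthogonal C" "x \<in> span C"
  shows "x = (\<Sum>c\<in>C. ((x \<bullet> c) / (c \<bullet> c)) *\<^sub>R c)" (is "x = ?P")
proof -
  have "(x - ?P) \<bullet> c = 0" if c: "c \<in> C" for c
  proof -
    have "?P \<bullet> c = (\<Sum>d\<in>C. if d = c then x \<bullet> c else 0)"
      unfolding inner_sum_left
      by (rule sum.cong) (use assms(2) c in \<open>auto simp: pairwise_def orthogonal_def\<close>)
    then show ?thesis using assms(1) c by (simp add: inner_diff_left)
  qed
  moreover have "?P \<in> span C" by (intro span_sum span_scale span_base)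
  then have "x - ?P \<in> span C" using assms(3) by (rule span_diff[rotated])
  ultimately have "orthogonal (x - ?P) (x - ?P)"
    using orthogonal_to_span[of "x - ?P" C "x - ?P"] by (auto simp: orthogonal_def inner_commute)
  then show ?thesis by (simp add: orthogonal_self)
qed

text \<open>The span is the fixed-point set of a continuous map, the expansion in a finite
  orthogonal family. A zero vector in the family does no harm, its coefficient being a division by
  0.\<close>

lemma closed_span_finite:
  fixes B :: "'a::real_inner set"
  assumes "finite B"
  shows "closed (span B)"
proof -
  obtain C where C: "finite C" "span C = span B" "pairwise orthogonal C"
    using basis_orthogonal[OF assms] by blast
  define P where "P = (\<lambda>x. \<Sum>c\<in>C. ((x \<bullet> c) / (c \<bullet> c)) *\<^sub>R c)"
  have "span C = {x. P x = x}"
  proof (intro equalityI subsetI CollectI)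
    fix x assume "x \<in> span C"
    then show "P x = x" using orthogonal_expansion[OF C(1,3)] by (simp add: P_def)
  next
    fix x assume "x \<in> {x. P x = x}"
    then have "x = P x" by simp
    also have "P x \<in> span C" by (auto simp: P_def intro!: span_sum span_scale intro: span_base)
    finally show "x \<in> span C" .
  qed
  moreover have "closed {x. P x = x}"
    unfolding P_def divide_inverse by (intro closed_Collect_eq continuous_intros)
  ultimately show ?thesis using C by simp
qed

lemma subspace_of_finite_span:
  assumes "subspace V" "V \<subseteq> span B'" "finite B'"
  obtains B where "finite B" "V = span B"
proof -
  obtain B where B: "B \<subseteq> V" "independent B" "V \<subseteq> span B" using maximal_independent_subset by blast
  have "finite B" using independent_span_bound[OF assms(3) B(2)] B(1) assms(2) by auto
  moreover have "span B \<subseteq> V" using B(1) assms(1) by (rule span_minimal)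
  ultimately show ?thesis using that[of B] B(3) by auto
qed

lemma closed_finite_dim_subspace:
  fixes V :: "'a::real_inner set"
  assumes "subspace V" "V \<subseteq> span B" "finite B"
  shows "closed V"
  using subspace_of_finite_span[OF assms] closed_span_finite by metis

text \<open>Choose an orthogonal family C spanning the image and a preimage \<open>s c\<close> of
  each member. By injectivity x is the same combination of the \<open>s c\<close> as f x is of the
  c, and the coefficients are at most |f x| / |c|. The argument is explicit and needs no compactness
  of the unit sphere.\<close>

lemma linear_injective_bound:
  fixes f :: "'b::real_normed_vector \<Rightarrow> 'a::real_inner"
  assumes f: "linear f" and V: "subspace V" "V \<subseteq> span B'" "finite B'"
    and inj: "\<And>x. x \<in> V \<Longrightarrow> f x = 0 \<Longrightarrow> x = 0"
  obtains C where "0 \<le> C" "\<And>x. x \<in> V \<Longrightarrow> norm x \<le> C * norm (f x)"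
proof -
  obtain B where B: "finite B" and VB: "V = span B" using subspace_of_finite_span[OF V] by metis
  obtain C where C: "finite C" "span C = span (f ` B)" "pairwise orthogonal C"
    using basis_orthogonal[of "f ` B"] B by blast
  have "\<exists>s. s \<in> span B \<and> f s = c" if "c \<in> C" for c
    using that C(2) span_base[of c C] linear_span_image[OF f, of B] by (metis imageE)
  then obtain s where s: "\<And>c. c \<in> C \<Longrightarrow> s c \<in> span B" "\<And>c. c \<in> C \<Longrightarrow> f (s c) = c" by metis
  have "norm x \<le> (\<Sum>c\<in>C. norm (s c) / norm c) * norm (f x)" if x: "x \<in> span B" for x
  proof -
    define P where "P = (\<Sum>c\<in>C. ((f x \<bullet> c) / (c \<bullet> c)) *\<^sub>R c)"
    define y where "y = (\<Sum>c\<in>C. ((f x \<bullet> c) / (c \<bullet> c)) *\<^sub>R s c)"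
    have "f x \<in> span C" using x C(2) linear_span_image[OF f, of B] by blast
    then have "f x = P" unfolding P_def by (rule orthogonal_expansion[OF C(1,3)])
    also have "P = f y" using s(2)
      by (simp add: P_def y_def linear_sum[OF f] linear_scale[OF f])
    finally have "f (x - y) = 0" by (simp add: linear_diff[OF f])
    moreover have "y \<in> span B" using s(1) by (auto simp: y_def intro!: span_sum span_scale)
    ultimately have "x = y" using inj[of "x - y"] x span_diff[of x B y] by (simp add: VB)
    have "norm y \<le> (\<Sum>c\<in>C. norm (((f x \<bullet> c) / (c \<bullet> c)) *\<^sub>R s c))"
      unfolding y_def by (rule norm_sum)
    also have "\<dots> \<le> (\<Sum>c\<in>C. norm (s c) / norm c * norm (f x))"
    proof (rule sum_mono)
      fix c assume "c \<in> C"
      show "norm (((f x \<bullet> c) / (c \<bullet> c)) *\<^sub>R s c) \<le> norm (s c) / norm c * norm (f x)"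
      proof (cases "c = 0")
        case False
        have "\<bar>f x \<bullet> c\<bar> / (c \<bullet> c) \<le> (norm (f x) * norm c) / (c \<bullet> c)"
          by (intro divide_right_mono Cauchy_Schwarz_ineq2) auto
        also have "\<dots> = norm (f x) / norm c" using False
          by (simp add: dot_square_norm power2_eq_square)
        finally have "\<bar>f x \<bullet> c\<bar> / (c \<bullet> c) * norm (s c) \<le> norm (f x) / norm c * norm (s c)"
          by (rule mult_right_mono) auto
        then show ?thesis by (simp add: mult.commute)
      qed simp
    qed
    finally show ?thesis using \<open>x = y\<close> by (simp add: sum_distrib_right)
  qed
  then show ?thesis using that[of "\<Sum>c\<in>C. norm (s c) / norm c"] by (simp add: VB sum_nonneg)
qed

section \<open>The Hilbert space of square integrable functions\<close>

lemma negligible_if_integrals_zero: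
  fixes h :: "real \<Rightarrow> real"
  assumes int: "\<And>a b. h integrable_on {a..b}"
    and zero: "\<And>a b. a \<in> \<rat> \<Longrightarrow> b \<in> \<rat> \<Longrightarrow> a < b \<Longrightarrow> integral {a..b} h = 0"
  shows "negligible {t. h t \<noteq> 0}"
proof -
  \<comment> \<open>The indefinite integral from a rational point is continuous and vanishes at
    rational points, which form a dense set.\<close>
  have all: "integral {x..y} h = 0" if xy: "x < y" for x y
  proof -
    obtain c where c: "c \<in> \<rat>" "x - 1 < c" "c < x" using Rats_dense_in_real[of "x - 1" x] by auto
    obtain d where d: "d \<in> \<rat>" "y < d" "d < y + 1" using Rats_dense_in_real[of y "y + 1"] by auto
    have cont: "continuous_on {c..d} (\<lambda>u. integral {c..u} h)"
      by (rule indefinite_integral_continuous_1[OF int])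
    have F: "integral {c..u} h = 0" if u: "u \<in> {c<..<d}" for u
    proof -
      have "u \<in> closure ({c<..<d} \<inter> \<rat>)"
        unfolding closure_approachable
      proof (intro allI impI)
        fix e :: real assume "e > 0"
        then obtain r where "r \<in> \<rat>" "max c (u - e) < r" "r < u"
          using Rats_dense_in_real[of "max c (u - e)" u] u by auto
        then show "\<exists>y\<in>{c<..<d} \<inter> \<rat>. dist y u < e" using u by (auto simp: dist_real_def intro!: bexI[of _ r])
      qed
      moreover have "continuous_on {c<..<d} (\<lambda>u. integral {c..u} h)"
        by (rule continuous_on_subset[OF cont]) auto
      moreover have "closure ({c<..<d} \<inter> \<rat>) \<subseteq> {c..d}"
        by (intro closure_minimal) auto
      ultimately show ?thesis
        using continuous_constant_on_closure[of "{c<..<d} \<inter> \<rat>" "\<lambda>u. integral {c..u} h" 0 u]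
          continuous_on_subset[OF cont] zero[OF c(1)] by auto
    qed
    have "integral {c..x} h + integral {x..y} h = integral {c..y} h"
      by (rule Henstock_Kurzweil_Integration.integral_combine) (use c xy int in auto)
    then show ?thesis using F[of x] F[of y] c d xy by auto
  qed
  \<comment> \<open>Lebesgue differentiation: off a null set, h x is the limit of averages over
    short intervals to the right of x, and these averages are 0.\<close>
  obtain N where N: "negligible N"
    "\<And>x e. \<lbrakk>x \<notin> N; 0 < e\<rbrakk> \<Longrightarrow> \<exists>d>0. \<forall>r. 0 < r \<and> r < d \<longrightarrow>
        norm (integral (cbox x (x + r *\<^sub>R One)) h /\<^sub>R r ^ DIM(real) - h x) < e"
    using integrable_ccontinuous_explicit[of h] int by (metis box_real(2))
  have "h x = 0" if "x \<notin> N" for x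
  proof (rule ccontr)
    assume "h x \<noteq> 0"
    then have "0 < \<bar>h x\<bar>" by simp
    from N(2)[OF that this] obtain d where d: "d > 0" "\<And>r. 0 < r \<Longrightarrow> r < d \<Longrightarrow>
        norm (integral (cbox x (x + r *\<^sub>R One)) h /\<^sub>R r ^ DIM(real) - h x) < \<bar>h x\<bar>"
      by blast
    have "0 < d / 2" "d / 2 < d" using d(1) by auto
    moreover have "integral (cbox x (x + (d/2) *\<^sub>R One)) h = 0"
      using all[of x "x + d/2"] d(1) by simp
    ultimately have "norm (0 /\<^sub>R (d/2) ^ DIM(real) - h x) < \<bar>h x\<bar>" using d(2) by metis
    then show False by simp
  qed
  then have "{t. h t \<noteq> 0} \<subseteq> N" by blast
  then show ?thesis by (rule negligible_subset[OF N(1)])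
qed

lemma AE_zero_if_integrals_zero:
  fixes h :: "real \<Rightarrow> real"
  assumes h: "h \<in> borel_measurable borel" and int: "\<And>a b. integrable lborel (\<lambda>t. indicator {a..b} t * h t)"
    and zero: "\<And>a b. a \<in> \<rat> \<Longrightarrow> b \<in> \<rat> \<Longrightarrow> a < b \<Longrightarrow> (LINT t|lborel. indicator {a..b} t * h t) = 0"
  shows "AE t in lborel. h t = 0"
proof -
  have s: "set_integrable lborel {a..b} h" for a b
    using int by (simp add: set_integrable_def)
  have "negligible {t. h t \<noteq> 0}"
  proof (rule negligible_if_integrals_zero)
    show "h integrable_on {a..b}" for a b by (rule set_borel_integral_eq_integral(1)[OF s])
    show "integral {a..b} h = 0" if "a \<in> \<rat>" "b \<in> \<rat>" "a < b" for a b
      using zero[OF that] set_borel_integral_eq_integral(2)[OF s] by (simp add: set_lebesgue_integral_def)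
  qed
  then have "AE t in lebesgue. h t = 0"
    by (auto simp: negligible_iff_null_sets eventually_ae_filter)
  then show ?thesis by (simp add: AE_completion_iff)
qed

section \<open>The Hilbert space of classes of square integrable functions on the line\<close>

definition sq_integrable :: "(real \<Rightarrow> 'v::{real_inner,banach,second_countable_topology}) \<Rightarrow> bool" where
  "sq_integrable f \<longleftrightarrow> f \<in> borel_measurable borel \<and> integrable lborel (\<lambda>t. (norm (f t))\<^sup>2)"

lemma sq_integrableD:
  assumes "sq_integrable f"
  shows "f \<in> borel_measurable borel" "integrable lborel (\<lambda>t. (norm (f t))\<^sup>2)"
  using assms by (auto simp: sq_integrable_def)

lemma norm_add_sq_le: "(norm (x + y :: 'a::real_inner))\<^sup>2 \<le> 2 * (norm x)\<^sup>2 + 2 * (norm y)\<^sup>2"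
proof -
  have "(norm (x + y))\<^sup>2 + (norm (x - y))\<^sup>2 = 2 * (norm x)\<^sup>2 + 2 * (norm y)\<^sup>2"
    by (simp add: power2_norm_eq_inner inner_simps inner_commute)
  then show ?thesis using zero_le_power2[of "norm (x - y)"] by linarith
qed

lemma abs_inner_le_sq: "\<bar>x \<bullet> y\<bar> \<le> (norm (x :: 'a::real_inner))\<^sup>2 + (norm y)\<^sup>2"
proof -
  have "\<bar>x \<bullet> y\<bar> \<le> norm x * norm y" by (rule Cauchy_Schwarz_ineq2)
  also have "\<dots> \<le> (norm x)\<^sup>2 + (norm y)\<^sup>2"
    using sum_squares_bound[of "norm x" "norm y"] mult_nonneg_nonneg[OF norm_ge_zero norm_ge_zero, of x y]
    by linarith
  finally show ?thesis .
qed

lemma sq_integrable_add: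
  assumes "sq_integrable f" "sq_integrable g"
  shows "sq_integrable (\<lambda>t. f t + g t)"
  unfolding sq_integrable_def
proof
  note [measurable] = sq_integrableD(1)[OF assms(1)] sq_integrableD(1)[OF assms(2)]
  show "(\<lambda>t. f t + g t) \<in> borel_measurable borel" by measurable
  show "integrable lborel (\<lambda>t. (norm (f t + g t))\<^sup>2)"
  proof (rule Bochner_Integration.integrable_bound)
    show "integrable lborel (\<lambda>t. 2 * (norm (f t))\<^sup>2 + 2 * (norm (g t))\<^sup>2)"
      using sq_integrableD(2)[OF assms(1)] sq_integrableD(2)[OF assms(2)] by auto
    show "AE t in lborel. norm ((norm (f t + g t))\<^sup>2) \<le> norm (2 * (norm (f t))\<^sup>2 + 2 * (norm (g t))\<^sup>2)"
      using norm_add_sq_le by (auto simp: abs_of_nonneg)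
  qed measurable
qed

lemma sq_integrable_scaleR: "sq_integrable f \<Longrightarrow> sq_integrable (\<lambda>t. c *\<^sub>R f t)"
  by (auto simp: sq_integrable_def power_mult_distrib)

lemma sq_integrable_minus: "sq_integrable f \<Longrightarrow> sq_integrable (\<lambda>t. - f t)"
  using sq_integrable_scaleR[of f "-1"] by simp

lemma sq_integrable_diff: "sq_integrable f \<Longrightarrow> sq_integrable g \<Longrightarrow> sq_integrable (\<lambda>t. f t - g t)"
  using sq_integrable_add[OF _ sq_integrable_minus, of f g] by simp

lemma sq_integrable_zero: "sq_integrable (\<lambda>t. 0)"
  by (simp add: sq_integrable_def)

lemma integrable_inner:
  assumes "sq_integrable f" "sq_integrable g"
  shows "integrable lborel (\<lambda>t. f t \<bullet> g t)"
proof (rule Bochner_Integration.integrable_bound)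
  note [measurable] = sq_integrableD(1)[OF assms(1)] sq_integrableD(1)[OF assms(2)]
  show "(\<lambda>t. f t \<bullet> g t) \<in> borel_measurable lborel" by measurable
  show "integrable lborel (\<lambda>t. (norm (f t))\<^sup>2 + (norm (g t))\<^sup>2)"
    using sq_integrableD(2)[OF assms(1)] sq_integrableD(2)[OF assms(2)] by auto
qed (use abs_inner_le_sq in \<open>auto simp: abs_of_nonneg\<close>)

definition l2_rel :: "(real \<Rightarrow> 'v::{real_inner,banach,second_countable_topology}) \<Rightarrow> (real \<Rightarrow> 'v) \<Rightarrow> bool" where
  "l2_rel f g \<longleftrightarrow> sq_integrable f \<and> sq_integrable g \<and> (AE t in lborel. f t = g t)"

\<comment> \<open>Functions live on the whole line so that translations act without boundary terms;
  a function on (0,T) enters through its extension by zero. Borel representatives keep expressions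
  like G (t + r) jointly measurable for Fubini. The quotient is partial because the relation is
  reflexive only at square integrable functions.\<close>
quotient_type (overloaded) 'v l2 = "real \<Rightarrow> 'v::{real_inner,banach,second_countable_topology}" / partial: l2_rel
proof (rule part_equivpI)
  show "\<exists>x. l2_rel x x" by (auto simp: l2_rel_def intro!: exI[of _ "\<lambda>_. 0"] sq_integrable_zero)
  show "symp l2_rel" by (auto simp: symp_def l2_rel_def)
  show "transp l2_rel" by (auto simp: transp_def l2_rel_def)
qed

instantiation l2 :: ("{real_inner,banach,second_countable_topology}") real_inner
begin

lift_definition zero_l2 :: "'a l2" is "\<lambda>_. 0"
  by (simp add: l2_rel_def sq_integrable_zero)
lift_definition plus_l2 :: "'a l2 \<Rightarrow> 'a l2 \<Rightarrow> 'a l2" is "\<lambda>f g t. f t + g t"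
  by (auto simp: l2_rel_def sq_integrable_add)
lift_definition scaleR_l2 :: "real \<Rightarrow> 'a l2 \<Rightarrow> 'a l2" is "\<lambda>c f t. c *\<^sub>R f t"
  by (auto simp: l2_rel_def sq_integrable_scaleR)
lift_definition uminus_l2 :: "'a l2 \<Rightarrow> 'a l2" is "\<lambda>f t. - f t"
  by (auto simp: l2_rel_def sq_integrable_minus)
lift_definition minus_l2 :: "'a l2 \<Rightarrow> 'a l2 \<Rightarrow> 'a l2" is "\<lambda>f g t. f t - g t"
  by (auto simp: l2_rel_def sq_integrable_diff)
lift_definition inner_l2 :: "'a l2 \<Rightarrow> 'a l2 \<Rightarrow> real" is "\<lambda>f g. LINT t|lborel. f t \<bullet> g t"
  unfolding l2_rel_def
  by (intro Bochner_Integration.integral_cong_AE; auto dest!: sq_integrableD(1) elim!: AE_mp)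
definition "norm_l2 (x::'a l2) = sqrt (x \<bullet> x)"
definition "dist_l2 (x::'a l2) y = norm (x - y)"
definition "sgn_l2 (x::'a l2) = inverse (norm x) *\<^sub>R x"
definition "uniformity_l2 = (INF e\<in>{0<..}. principal {(x::'a l2, y). dist x y < e})"
definition "open_l2 (U :: 'a l2 set) = (\<forall>x\<in>U. eventually (\<lambda>(x', y). x' = x \<longrightarrow> y \<in> U) uniformity)"

instance
proof
  fix x y z :: "'a l2" and a b r s :: real
  show "x + y + z = x + (y + z)"
    by transfer (auto simp: l2_rel_def sq_integrable_add add.assoc)
  show "x + y = y + x" by transfer (auto simp: l2_rel_def sq_integrable_add add.commute)
  show "0 + x = x" by transfer (auto simp: l2_rel_def)
  show "- x + x = 0" by transfer (auto simp: l2_rel_def sq_integrable_zero)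
  show "x - y = x + - y" by transfer (auto simp: l2_rel_def sq_integrable_diff)
  show "a *\<^sub>R (x + y) = a *\<^sub>R x + a *\<^sub>R y"
    by transfer (auto simp: l2_rel_def sq_integrable_add sq_integrable_scaleR scaleR_add_right)
  show "(a + b) *\<^sub>R x = a *\<^sub>R x + b *\<^sub>R x"
    by transfer (auto simp: l2_rel_def sq_integrable_add sq_integrable_scaleR scaleR_add_left)
  show "a *\<^sub>R b *\<^sub>R x = (a * b) *\<^sub>R x"
    by transfer (auto simp: l2_rel_def sq_integrable_scaleR)
  show "1 *\<^sub>R x = x" by transfer (auto simp: l2_rel_def)
  show "dist x y = norm (x - y)" by (simp add: dist_l2_def)
  show "sgn x = inverse (norm x) *\<^sub>R x" by (simp add: sgn_l2_def)
  show "uniformity = (INF e\<in>{0<..}. principal {(x::'a l2, y). dist x y < e})" by (simp add: uniformity_l2_def)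
  show "open U \<longleftrightarrow> (\<forall>x\<in>U. eventually (\<lambda>(x', y). x' = x \<longrightarrow> y \<in> U) uniformity)" for U :: "'a l2 set"
    by (simp add: open_l2_def)
  show "x \<bullet> y = y \<bullet> x" by transfer (simp add: inner_commute)
  show "(x + y) \<bullet> z = x \<bullet> z + y \<bullet> z"
    by transfer (auto simp: l2_rel_def inner_add_left integrable_inner)
  show "(r *\<^sub>R x) \<bullet> y = r * (x \<bullet> y)" by transfer (auto simp: l2_rel_def)
  show "0 \<le> x \<bullet> x" by transfer auto
  show "x \<bullet> x = 0 \<longleftrightarrow> x = 0"
  proof transfer
    fix f :: "real \<Rightarrow> 'a" assume "l2_rel f f"
    then have f: "sq_integrable f" by (simp add: l2_rel_def)
    have "(LINT t|lborel. f t \<bullet> f t) = 0 \<longleftrightarrow> (AE t in lborel. f t \<bullet> f t = 0)"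
      by (rule integral_nonneg_eq_0_iff_AE[OF integrable_inner[OF f f]]) auto
    then show "((LINT t|lborel. f t \<bullet> f t) = 0) = l2_rel f (\<lambda>_. 0)"
      using f by (simp add: l2_rel_def sq_integrable_zero)
  qed
  show "norm x = sqrt (x \<bullet> x)" by (simp add: norm_l2_def)
qed

end

lemma norm_l2_sq: "sq_integrable f \<Longrightarrow> (norm (abs_l2 f))\<^sup>2 = (LINT t|lborel. (norm (f t))\<^sup>2)"
  by (simp add: power2_norm_eq_inner inner_l2.abs_eq l2_rel_def)

lemma l2_cases: obtains f where "sq_integrable f" "x = abs_l2 f"
  using Quotient_l2 by (metis Quotient_def l2_rel_def)

lemma abs_l2_diff:
  assumes "sq_integrable f" "sq_integrable g"
  shows "abs_l2 f - abs_l2 g = abs_l2 (\<lambda>t. f t - g t)"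
  using assms by (simp add: minus_l2.abs_eq l2_rel_def)

lemma abs_l2_eq_iff: "sq_integrable f \<Longrightarrow> sq_integrable g \<Longrightarrow>
    abs_l2 f = abs_l2 g \<longleftrightarrow> (AE t in lborel. f t = g t)"
  using Quotient_rel_abs[OF Quotient_l2] Quotient_rel[OF Quotient_l2, of f g] by (auto simp: l2_rel_def)

lemma nn_integral_l2:
  "sq_integrable f \<Longrightarrow> (\<integral>\<^sup>+t. ennreal ((norm (f t))\<^sup>2) \<partial>lborel) = ennreal ((norm (abs_l2 f))\<^sup>2)"
  by (simp add: norm_l2_sq nn_integral_eq_integral sq_integrableD)

lemma sq_integrableI:
  assumes "f \<in> borel_measurable borel" "(\<integral>\<^sup>+t. ennreal ((norm (f t))\<^sup>2) \<partial>lborel) < \<infinity>"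
  shows "sq_integrable f"
  using assms by (auto simp: sq_integrable_def integrable_iff_bounded)

text \<open>The Riesz-Fischer argument. The subsequence converging almost everywhere is part of the
  conclusion because closedness of spaces of W-valued functions is later decided pointwise.\<close>

lemma l2_Cauchy_AE_subseq:
  fixes F :: "nat \<Rightarrow> real \<Rightarrow> 'a::{real_inner,banach,second_countable_topology}"
  assumes F: "\<And>n. sq_integrable (F n)" and X: "Cauchy (\<lambda>n. abs_l2 (F n))"
  obtains r g where "strict_mono r" "sq_integrable g" "(\<lambda>n. abs_l2 (F n)) \<longlonglongrightarrow> abs_l2 g"
    "AE t in lborel. (\<lambda>k. F (r k) t) \<longlonglongrightarrow> g t"
proof -
  define X where "X n = abs_l2 (F n)" for n
  have X: "Cauchy X" using X by (simp add: X_def[abs_def])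
  have "\<forall>k. \<exists>N. \<forall>m\<ge>N. \<forall>n\<ge>N. dist (X m) (X n) < (1/2)^k"
    using metric_CauchyD[OF X] by (metis zero_less_divide_1_iff zero_less_numeral zero_less_power)
  then obtain N where N: "\<And>k m n. m \<ge> N k \<Longrightarrow> n \<ge> N k \<Longrightarrow> dist (X m) (X n) < (1/2)^k" by metis
  \<comment> \<open>The sum dominates N i for every i <= k, and the added k makes r strictly
    increasing.\<close>
  define r where "r k = (\<Sum>i\<le>k. N i) + k" for k
  have rN: "N k \<le> r m" if "k \<le> m" for k m
  proof -
    have "N k \<le> (\<Sum>i\<le>m. N i)" using that by (intro member_le_sum) auto
    then show ?thesis by (simp add: r_def)
  qed
  have r_mono: "strict_mono r" by (auto simp: strict_mono_Suc_iff r_def)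
  define f where "f k = F (r k)" for k
  have f: "sq_integrable (f k)" "X (r k) = abs_l2 (f k)" for k by (simp_all add: f_def F X_def)
  have [measurable]: "f k \<in> borel_measurable borel" for k using f sq_integrableD by blast
  have close: "norm (abs_l2 (\<lambda>t. f m t - f k t)) < (1/2)^k" if "k \<le> m" for k m
    using N[OF rN[OF that] rN[OF order.refl]] f abs_l2_diff[OF f(1)[of m] f(1)[of k]]
    by (simp add: dist_norm)
  \<comment> \<open>The weight 2^k still leaves a convergent series of integrals, since the squared
    distances are below 4^(-k). Finiteness of the sum at t bounds |f (k+1) t - f k t| by a constant
    times 2^(-k/2), which is summable.\<close>
  let ?d = "\<lambda>k t. ennreal (2^k * (norm (f (Suc k) t - f k t))\<^sup>2)"
  have "(\<integral>\<^sup>+t. (\<Sum>k. ?d k t) \<partial>lborel) = (\<Sum>k. \<integral>\<^sup>+t. ?d k t \<partial>lborel)"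
    by (rule nn_integral_suminf) measurable
  also have "\<dots> \<le> (\<Sum>k. ennreal ((1/2)^k))"
  proof (rule suminf_le)
    fix k
    have "(\<integral>\<^sup>+t. ?d k t \<partial>lborel) = ennreal (2^k) * (\<integral>\<^sup>+t. ennreal ((norm (f (Suc k) t - f k t))\<^sup>2) \<partial>lborel)"
      by (subst nn_integral_cmult[symmetric]) (auto simp: ennreal_mult)
    also have "\<dots> = ennreal (2^k * (norm (abs_l2 (\<lambda>t. f (Suc k) t - f k t)))\<^sup>2)"
      using nn_integral_l2[OF sq_integrable_diff[OF f(1)[of "Suc k"] f(1)[of k]]] by (simp add: ennreal_mult)
    also have "\<dots> \<le> ennreal (2^k * ((1/2)^k)\<^sup>2)"
      using close[of k "Suc k"] by (intro ennreal_leI mult_left_mono power_mono) auto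
    also have "(2::real)^k * ((1/2)^k)\<^sup>2 = (1/2)^k" by (simp add: power2_eq_square power_divide)
    finally show "(\<integral>\<^sup>+t. ?d k t \<partial>lborel) \<le> ennreal ((1/2)^k)" .
  qed auto
  also have "\<dots> = ennreal 2" by (rule suminf_ennreal_eq) (use geometric_sums[of "1/2::real"] in auto)
  finally have "(\<integral>\<^sup>+t. (\<Sum>k. ?d k t) \<partial>lborel) \<noteq> \<infinity>" by (auto simp: top_unique)
  then have "AE t in lborel. (\<Sum>k. ?d k t) \<noteq> \<infinity>" by (intro nn_integral_PInf_AE) auto
  then have conv: "AE t in lborel. convergent (\<lambda>k. f k t)"
  proof eventually_elim
    fix t assume "(\<Sum>k. ?d k t) \<noteq> \<infinity>"
    then have "summable (\<lambda>k. 2^k * (norm (f (Suc k) t - f k t))\<^sup>2)"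
      by (intro summable_suminf_not_top) auto
    then have "Bseq (\<lambda>k. 2^k * (norm (f (Suc k) t - f k t))\<^sup>2)"
      by (intro convergent_imp_Bseq) (use summable_LIMSEQ_zero convergent_def in blast)
    then obtain C where C: "C > 0" "\<And>k. 2^k * (norm (f (Suc k) t - f k t))\<^sup>2 \<le> C"
      by (auto simp: Bseq_def abs_mult)
    have "summable (\<lambda>k. f (Suc k) t - f k t)"
    proof (rule summable_comparison_test')
      show "summable (\<lambda>k. sqrt C * (1 / sqrt 2)^k)"
        by (intro summable_mult summable_geometric) (auto simp: real_less_rsqrt)
      fix k
      have "(norm (f (Suc k) t - f k t))\<^sup>2 \<le> C / 2^k" using C(2)[of k] by (simp add: field_simps)
      then have "norm (f (Suc k) t - f k t) \<le> sqrt (C / 2^k)" by (rule real_le_rsqrt)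
      then show "norm (f (Suc k) t - f k t) \<le> sqrt C * (1 / sqrt 2)^k"
        by (simp add: real_sqrt_divide real_sqrt_power power_divide)
    qed
    then have "convergent (\<lambda>n. \<Sum>k<n. f (Suc k) t - f k t)" by (simp add: summable_iff_convergent)
    then have "convergent (\<lambda>n. f n t - f 0 t)" by (simp add: sum_lessThan_telescope[of "\<lambda>k. f k t"])
    then have "convergent (\<lambda>n. (f n t - f 0 t) + f 0 t)" by (intro convergent_add convergent_const)
    then show "convergent (\<lambda>k. f k t)" by simp
  qed
  define g where "g t = lim (\<lambda>k. f k t)" for t
  have [measurable]: "g \<in> borel_measurable borel" unfolding g_def by measurable
  \<comment> \<open>Fatou in m: the pointwise limit inherits the tail estimate, which yields both
    square integrability of g and convergence in norm.\<close>
  have gf: "(\<integral>\<^sup>+t. ennreal ((norm (g t - f k t))\<^sup>2) \<partial>lborel) \<le> ennreal (((1/2)^k)\<^sup>2)" for k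
  proof -
    have "(\<integral>\<^sup>+t. ennreal ((norm (g t - f k t))\<^sup>2) \<partial>lborel)
        = (\<integral>\<^sup>+t. liminf (\<lambda>m. ennreal ((norm (f m t - f k t))\<^sup>2)) \<partial>lborel)"
    proof (rule nn_integral_cong_AE, use conv in eventually_elim)
      fix t assume "convergent (\<lambda>k. f k t)"
      then have "(\<lambda>m. f m t) \<longlonglongrightarrow> g t" by (simp add: g_def convergent_LIMSEQ_iff)
      then have "(\<lambda>m. ennreal ((norm (f m t - f k t))\<^sup>2)) \<longlonglongrightarrow> ennreal ((norm (g t - f k t))\<^sup>2)"
        by (intro tendsto_intros)
      then show "ennreal ((norm (g t - f k t))\<^sup>2) = liminf (\<lambda>m. ennreal ((norm (f m t - f k t))\<^sup>2))"
        by (metis lim_imp_Liminf sequentially_bot)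
    qed
    also have "\<dots> \<le> liminf (\<lambda>m. \<integral>\<^sup>+t. ennreal ((norm (f m t - f k t))\<^sup>2) \<partial>lborel)"
      by (rule nn_integral_liminf) measurable
    also have "\<dots> \<le> liminf (\<lambda>m. ennreal (((1/2)^k)\<^sup>2))"
    proof (rule Liminf_mono, rule eventually_sequentiallyI[of k])
      fix m assume "k \<le> m"
      then show "(\<integral>\<^sup>+t. ennreal ((norm (f m t - f k t))\<^sup>2) \<partial>lborel) \<le> ennreal (((1/2)^k)\<^sup>2)"
        using nn_integral_l2[OF sq_integrable_diff[OF f(1)[of m] f(1)[of k]]] close[of k m]
        by (auto intro!: ennreal_leI power_mono)
    qed
    also have "\<dots> = ennreal (((1/2)^k)\<^sup>2)" by (simp add: Liminf_const)
    finally show ?thesis .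
  qed
  have d: "sq_integrable (\<lambda>t. g t - f k t)" for k
    by (rule sq_integrableI) (use gf[of k] in \<open>auto simp: le_less_trans\<close>)
  have g: "sq_integrable g" using sq_integrable_add[OF d[of 0] f(1)[of 0]] unfolding diff_add_cancel .
  have "norm (abs_l2 g - X (r k)) \<le> (1/2)^k" for k
  proof -
    have "ennreal ((norm (abs_l2 g - X (r k)))\<^sup>2) \<le> ennreal (((1/2)^k)\<^sup>2)"
      using gf[of k] unfolding nn_integral_l2[OF d] f(2) abs_l2_diff[OF g f(1)] .
    then have "(norm (abs_l2 g - X (r k)))\<^sup>2 \<le> ((1/2)^k)\<^sup>2"
      by (simp only: ennreal_le_iff zero_le_power2)
    then show ?thesis by (rule power2_le_imp_le) simp
  qed
  then have "eventually (\<lambda>k. norm (X (r k) - abs_l2 g) \<le> (1/2)^k) sequentially"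
    by (simp add: norm_minus_commute)
  moreover have "(\<lambda>k. (1/2::real)^k) \<longlonglongrightarrow> 0" by (rule LIMSEQ_realpow_zero) auto
  ultimately have "(\<lambda>k. X (r k) - abs_l2 g) \<longlonglongrightarrow> 0" by (rule Lim_null_comparison)
  then have "(X \<circ> r) \<longlonglongrightarrow> abs_l2 g" by (simp add: o_def LIM_zero_iff)
  from Cauchy_converges_subseq[OF X r_mono this]
  have "(\<lambda>n. abs_l2 (F n)) \<longlonglongrightarrow> abs_l2 g" by (simp add: X_def[abs_def])
  moreover have "AE t in lborel. (\<lambda>k. F (r k) t) \<longlonglongrightarrow> g t"
    using conv by eventually_elim (simp add: g_def f_def convergent_LIMSEQ_iff)
  ultimately show ?thesis using that r_mono g by blast
qed

instance l2 :: ("{real_inner,banach,second_countable_topology}") banach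
proof
  fix X :: "nat \<Rightarrow> 'a l2" assume X: "Cauchy X"
  have "\<exists>f. sq_integrable f \<and> X k = abs_l2 f" for k by (metis l2_cases)
  then obtain F where F: "\<And>k. sq_integrable (F k)" "\<And>k. X k = abs_l2 (F k)" by metis
  then have X_eq: "X = (\<lambda>n. abs_l2 (F n))" by blast
  obtain r g where "(\<lambda>n. abs_l2 (F n)) \<longlonglongrightarrow> abs_l2 g"
    by (rule l2_Cauchy_AE_subseq[OF F(1) X[unfolded X_eq]])
  then show "convergent X" unfolding X_eq by (rule convergentI)
qed

section \<open>Separability\<close>

lemma countable_dense_if_total:
  fixes E :: "'a::{real_inner,banach} set"
  assumes "countable E" and total: "\<And>z. (\<And>e. e \<in> E \<Longrightarrow> z \<bullet> e = 0) \<Longrightarrow> z = 0"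
  obtains Q :: "'a set" where "countable Q" "closure Q = UNIV"
proof -
  define \<sigma> where "\<sigma> l = sum_list (map (\<lambda>(r, e). of_rat r *\<^sub>R e) l)" for l :: "(rat \<times> 'a) list"
  define Q where "Q = \<sigma> ` lists (UNIV \<times> E)"
  have count: "countable Q" unfolding Q_def using assms(1) by (intro countable_image countable_lists) auto
  have zero: "0 \<in> Q" unfolding Q_def by (rule image_eqI[of _ _ "[]"]) (auto simp: \<sigma>_def)
  have add: "x + y \<in> Q" if "x \<in> Q" "y \<in> Q" for x y
  proof -
    from that obtain k l where "k \<in> lists (UNIV \<times> E)" "x = \<sigma> k" "l \<in> lists (UNIV \<times> E)" "y = \<sigma> l"
      by (auto simp: Q_def)
    then have "k @ l \<in> lists (UNIV \<times> E)" "x + y = \<sigma> (k @ l)" by (auto simp: \<sigma>_def)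
    then show ?thesis unfolding Q_def by blast
  qed
  have scale: "of_rat q *\<^sub>R x \<in> Q" if "x \<in> Q" for x q
  proof -
    from that obtain l where l: "l \<in> lists (UNIV \<times> E)" "x = \<sigma> l" by (auto simp: Q_def)
    have "of_rat q *\<^sub>R \<sigma> l = \<sigma> (map (\<lambda>(r, e). (q * r, e)) l)" for l
      by (induction l) (auto simp: \<sigma>_def scaleR_add_right of_rat_mult)
    moreover have "map (\<lambda>(r, e). (q * r, e)) l \<in> lists (UNIV \<times> E)" using l(1) by auto
    ultimately show ?thesis unfolding Q_def l(2) by (metis imageI)
  qed
  have base: "e \<in> Q" if "e \<in> E" for e
    unfolding Q_def by (rule image_eqI[of _ _ "[(1, e)]"]) (use that in \<open>auto simp: \<sigma>_def\<close>)
  have "subspace (closure Q)"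
  proof (rule subspaceI)
    show "0 \<in> closure Q" using zero closure_subset by blast
  next
    fix x y assume "x \<in> closure Q" "y \<in> closure Q"
    then obtain a b where "\<And>n. a n \<in> Q" "a \<longlonglongrightarrow> x" "\<And>n. b n \<in> Q" "b \<longlonglongrightarrow> y"
      by (auto simp: closure_sequential)
    then have "\<forall>n. a n + b n \<in> Q" "(\<lambda>n. a n + b n) \<longlonglongrightarrow> x + y"
      using add tendsto_add by blast+
    then show "x + y \<in> closure Q" unfolding closure_sequential by (intro exI conjI)
  next
    fix c x assume x: "x \<in> closure Q"
    have rat: "of_rat q *\<^sub>R x \<in> closure Q" for q
    proof -
      obtain a where "\<And>n. a n \<in> Q" "a \<longlonglongrightarrow> x" using x by (auto simp: closure_sequential)
      then have "\<forall>n. of_rat q *\<^sub>R a n \<in> Q" "(\<lambda>n. of_rat q *\<^sub>R a n) \<longlonglongrightarrow> of_rat q *\<^sub>R x"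
        using scale tendsto_scaleR tendsto_const by blast+
      then show ?thesis unfolding closure_sequential by (intro exI conjI)
    qed
    \<comment> \<open>The scalars that keep x in the closure form a closed set containing the
      rationals, hence all reals.\<close>
    have "closed {c. c *\<^sub>R x \<in> closure Q}"
      by (rule closed_vimage[of "closure Q" "\<lambda>c. c *\<^sub>R x", unfolded vimage_def]) (auto intro!: continuous_intros)
    moreover have "\<rat> \<subseteq> {c. c *\<^sub>R x \<in> closure Q}" using rat by (auto elim!: Rats_cases)
    ultimately have "closure \<rat> \<subseteq> {c. c *\<^sub>R x \<in> closure Q}" by (intro closure_minimal)
    then show "c *\<^sub>R x \<in> closure Q" by (auto simp: Rats_closure_real)
  qed
  then have "closure (closure Q) = UNIV"
  proof (rule dense_if_orthogonal_trivial)
    fix z assume "\<And>k. k \<in> closure Q \<Longrightarrow> z \<bullet> k = 0"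
    then show "z = 0" using total base closure_subset by (metis subsetD)
  qed
  then show ?thesis using that count by simp
qed

text \<open>Second countability passes to arbitrary subsets; \<open>countable_dense_subset\<close>
  relies on this for trial and test functions.\<close>

lemma second_countable_if_dense:
  fixes Q :: "'a::metric_space set"
  assumes "countable Q" "closure Q = UNIV"
  shows "\<exists>B::'a set set. countable B \<and> open = generate_topology B"
proof (intro exI conjI)
  let ?B = "(\<lambda>(q, n). ball q (1 / real (Suc n))) ` (Q \<times> (UNIV::nat set))"
  show "countable ?B" using assms(1) by (intro countable_image) auto
  have "topological_basis ?B"
  proof (rule topological_basisI)
    fix U :: "'a set" and x assume "open U" "x \<in> U"
    then obtain e where e: "e > 0" "ball x e \<subseteq> U" by (meson open_contains_ball)
    obtain n where n: "1 / real (Suc n) < e / 2" using nat_approx_posE[of "e/2"] e by auto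
    have "x \<in> closure Q" using assms(2) by simp
    moreover have "(0::real) < 1 / real (Suc n)" by simp
    ultimately obtain q where q: "q \<in> Q" "dist q x < 1 / real (Suc n)"
      unfolding closure_approachable by blast
    have "ball q (1 / real (Suc n)) \<subseteq> ball x e"
    proof
      fix y assume "y \<in> ball q (1 / real (Suc n))"
      then have "dist x y < 1 / real (Suc n) + 1 / real (Suc n)"
        using q dist_triangle[of x y q] by (simp add: dist_commute)
      then show "y \<in> ball x e" using n by (simp add: mem_ball)
    qed
    with q e show "\<exists>B'\<in>?B. x \<in> B' \<and> B' \<subseteq> U"
      by (intro bexI[of _ "ball q (1 / real (Suc n))"]) (auto simp: dist_commute)
  qed auto
  then show "open = generate_topology ?B" by (rule topological_basis_imp_subbasis)
qed

lemma countable_dense_UNIV: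
  obtains D :: "'a::second_countable_topology set" where "countable D" "closure D = UNIV"
proof -
  obtain D :: "'a set" where D: "countable D" "\<And>X. open X \<Longrightarrow> X \<noteq> {} \<Longrightarrow> \<exists>d\<in>D. d \<in> X"
    using countable_dense_setE by blast
  have "- closure D = {}"
  proof (rule ccontr)
    assume "- closure D \<noteq> {}"
    then obtain d where "d \<in> D" "d \<in> - closure D" using D(2)[of "- closure D"] by (auto simp: open_Compl)
    then show False using closure_subset[of D] by auto
  qed
  then have "closure D = UNIV" by auto
  then show ?thesis using that D(1) by blast
qed

definition l2_step :: "real \<Rightarrow> real \<Rightarrow> 'v \<Rightarrow> 'v::{real_inner,banach,second_countable_topology} l2" where
  "l2_step a b v = abs_l2 (\<lambda>t. indicator {a..b} t *\<^sub>R v)"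

lemma integrable_indicator_Icc: "integrable lborel (indicat_real {a..b::real})"
  by (rule integrable_real_indicator) (auto simp: emeasure_lborel_Icc_eq)

lemma sq_integrable_step: "sq_integrable (\<lambda>t. indicator {a..b} t *\<^sub>R v)"
proof -
  have "(\<lambda>t. (norm (indicator {a..b} t *\<^sub>R v))\<^sup>2) = (\<lambda>t. indicator {a..b} t * (norm v)\<^sup>2)"
    by (auto simp: indicator_def)
  then show ?thesis using integrable_indicator_Icc[of a b] by (auto simp: sq_integrable_def)
qed

lemma inner_l2_abs:
  "sq_integrable f \<Longrightarrow> sq_integrable g \<Longrightarrow> abs_l2 f \<bullet> abs_l2 g = (LINT t|lborel. f t \<bullet> g t)"
  by (simp add: inner_l2.abs_eq l2_rel_def)

text \<open>Countability of D keeps the union of the exceptional null sets null; density then gives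
  f t \<bullet> f t = 0 at every remaining t.\<close>

lemma AE_zero_if_weakly_zero:
  fixes f :: "real \<Rightarrow> 'v::{real_inner,second_countable_topology}"
  assumes "countable D" "closure D = UNIV" "\<And>v. v \<in> D \<Longrightarrow> AE t in M. f t \<bullet> v = 0"
  shows "AE t in M. f t = 0"
proof -
  have "AE t in M. \<forall>v\<in>D. f t \<bullet> v = 0" using assms by (simp add: AE_ball_countable)
  then show ?thesis
  proof eventually_elim
    fix t assume "\<forall>v\<in>D. f t \<bullet> v = 0"
    then have "D \<subseteq> {v. f t \<bullet> v = 0}" by auto
    moreover have "closed {v. f t \<bullet> v = 0}" by (intro closed_Collect_eq continuous_intros)
    ultimately have "closure D \<subseteq> {v. f t \<bullet> v = 0}" by (rule closure_minimal)
    then have "f t \<bullet> f t = 0" using assms(2) by blast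
    then show "f t = 0" by simp
  qed
qed

lemma l2_steps_total:
  fixes D :: "'v::{real_inner,banach,second_countable_topology} set"
  assumes "countable D" "closure D = UNIV"
    and "\<And>a b v. a \<in> \<rat> \<Longrightarrow> b \<in> \<rat> \<Longrightarrow> v \<in> D \<Longrightarrow> z \<bullet> l2_step a b v = 0"
  shows "z = 0"
proof -
  obtain f where f: "sq_integrable f" "z = abs_l2 f" by (rule l2_cases)
  note [measurable] = sq_integrableD(1)[OF f(1)]
  have "AE t in lborel. f t \<bullet> v = 0" if "v \<in> D" for v
  proof (rule AE_zero_if_integrals_zero)
    show "integrable lborel (\<lambda>t. indicator {a..b} t * (f t \<bullet> v))" for a b
      using integrable_inner[OF f(1) sq_integrable_step[of a b v]] by simp
    show "(LINT t|lborel. indicator {a..b} t * (f t \<bullet> v)) = 0" if "a \<in> \<rat>" "b \<in> \<rat>" for a b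
      using assms(3)[OF that \<open>v \<in> D\<close>] by (simp add: f l2_step_def inner_l2_abs sq_integrable_step)
  qed measurable
  from AE_zero_if_weakly_zero[OF assms(1,2) this] have "AE t in lborel. f t = 0" .
  then have "f = f \<and> abs_l2 f = abs_l2 (\<lambda>_. 0)" by (simp add: abs_l2_eq_iff f sq_integrable_zero)
  then show ?thesis by (simp add: f zero_l2.abs_eq l2_rel_def sq_integrable_zero)
qed

lemma l2_countable_steps_total:
  obtains E :: "'v::{real_inner,banach,second_countable_topology} l2 set"
  where "countable E" "\<And>z. (\<And>e. e \<in> E \<Longrightarrow> z \<bullet> e = 0) \<Longrightarrow> z = 0"
    "\<And>e. e \<in> E \<Longrightarrow> \<exists>a b v. e = l2_step a b v"
proof -
  obtain D :: "'v set" where D: "countable D" "closure D = UNIV" by (rule countable_dense_UNIV)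
  let ?E = "(\<lambda>(a, b, v). l2_step a b v) ` (\<rat> \<times> \<rat> \<times> D)"
  have "countable ?E" using D(1) countable_rat by (intro countable_image countable_SIGMA) auto
  moreover have "z = 0" if "\<And>e. e \<in> ?E \<Longrightarrow> z \<bullet> e = 0" for z
  proof (rule l2_steps_total[OF D])
    fix a b :: real and v assume "a \<in> \<rat>" "b \<in> \<rat>" "v \<in> D"
    then show "z \<bullet> l2_step a b v = 0"
      by (intro that image_eqI[of _ _ "(a, b, v)"]) auto
  qed
  moreover have "\<exists>a b v. e = l2_step a b v" if "e \<in> ?E" for e using that by auto
  ultimately show ?thesis by (rule that)
qed

instance l2 :: ("{real_inner,banach,second_countable_topology}") second_countable_topology
proof
  obtain E :: "'a l2 set" where E: "countable E" "\<And>z. (\<And>e. e \<in> E \<Longrightarrow> z \<bullet> e = 0) \<Longrightarrow> z = 0"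
    using l2_countable_steps_total by metis
  obtain Q :: "'a l2 set" where Q: "countable Q" "closure Q = UNIV"
    using countable_dense_if_total[OF E] .
  from second_countable_if_dense[OF this]
  show "\<exists>B::'a l2 set set. countable B \<and> open = generate_topology B" .
qed

section \<open>Translations and their strong continuity\<close>

lemma sq_integrable_shift:
  assumes "sq_integrable f"
  shows "sq_integrable (\<lambda>t. f (t + s))"
proof -
  have "integrable lborel (\<lambda>t. (norm (f (s + 1 * t)))\<^sup>2)"
    by (rule lborel_integrable_real_affine) (use assms in \<open>auto simp: sq_integrable_def\<close>)
  moreover have "(\<lambda>t. f (t + s)) \<in> borel_measurable borel"
    using sq_integrableD(1)[OF assms] by measurable
  ultimately show ?thesis by (simp add: sq_integrable_def add.commute)
qed

lemma AE_lborel_shift: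
  assumes "AE t in lborel. P (t::real)"
  shows "AE t in lborel. P (t + s)"
proof -
  have "AE t in distr lborel borel ((+) s). P t"
    using assms by (subst lborel_distr_plus)
  then have "AE t in lborel. P (s + t)" by (rule AE_distrD[rotated]) auto
  then show ?thesis by (simp add: add.commute)
qed

lift_definition shift_l2 :: "real \<Rightarrow> 'v l2 \<Rightarrow> 'v::{real_inner,banach,second_countable_topology} l2"
  is "\<lambda>s f t. f (t + s)"
  by (simp add: l2_rel_def sq_integrable_shift AE_lborel_shift[of "\<lambda>t. f t = g t" for f g])

lemma shift_l2_add: "shift_l2 s (x + y) = shift_l2 s x + shift_l2 s y"
  by transfer (auto simp: l2_rel_def sq_integrable_shift sq_integrable_add)

lemma shift_l2_scaleR: "shift_l2 s (c *\<^sub>R x) = c *\<^sub>R shift_l2 s x"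
  by transfer (auto simp: l2_rel_def sq_integrable_shift sq_integrable_scaleR)

lemma shift_l2_abs: "sq_integrable f \<Longrightarrow> shift_l2 s (abs_l2 f) = abs_l2 (\<lambda>t. f (t + s))"
  by (simp add: shift_l2.abs_eq l2_rel_def)

lemma norm_shift_l2: "norm (shift_l2 s x) = norm x"
proof -
  obtain f where f: "sq_integrable f" "x = abs_l2 f" by (rule l2_cases)
  have "(LINT t|lborel. (norm (f (t + s)))\<^sup>2) = (LINT t|lborel. (norm (f t))\<^sup>2)"
    using lborel_integral_real_affine[of 1 "\<lambda>t. (norm (f t))\<^sup>2" s] by (simp add: add.commute)
  then have "(norm (shift_l2 s x))\<^sup>2 = (norm x)\<^sup>2"
    by (simp add: f shift_l2_abs norm_l2_sq sq_integrable_shift)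
  then show ?thesis by simp
qed

lemma shift_l2_diff: "shift_l2 s (x - y) = shift_l2 s x - shift_l2 s y"
  using shift_l2_add[of s "x - y" y] by (simp add: algebra_simps)

text \<open>A shifted indicator differs from the original only within distance |s| of an endpoint,
  that is, on two intervals of length 2 |s|. This is the origin of the factor 4 |s|.\<close>

lemma shift_step_tendsto: "((\<lambda>s. shift_l2 s (l2_step a b v)) \<longlongrightarrow> l2_step a b v) (at 0)"
proof -
  have bound: "(norm (shift_l2 s (l2_step a b v) - l2_step a b v))\<^sup>2 \<le> 4 * \<bar>s\<bar> * (norm v)\<^sup>2" for s
  proof -
    let ?J = "{a - \<bar>s\<bar>..a + \<bar>s\<bar>}" and ?K = "{b - \<bar>s\<bar>..b + \<bar>s\<bar>}"
    have sq: "sq_integrable (\<lambda>t. indicator {a..b} (t + s) *\<^sub>R v - indicator {a..b} t *\<^sub>R v)"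
      by (intro sq_integrable_diff sq_integrable_step sq_integrable_shift[OF sq_integrable_step])
    have "(norm (shift_l2 s (l2_step a b v) - l2_step a b v))\<^sup>2
        = (LINT t|lborel. (norm (indicator {a..b} (t + s) *\<^sub>R v - indicator {a..b} t *\<^sub>R v))\<^sup>2)"
      unfolding l2_step_def
      by (subst shift_l2_abs, rule sq_integrable_step, subst abs_l2_diff)
        (simp_all add: norm_l2_sq[OF sq] sq_integrable_step sq_integrable_shift[OF sq_integrable_step])
    also have "\<dots> \<le> (LINT t|lborel. (indicator ?J t + indicator ?K t) * (norm v)\<^sup>2)"
    proof (rule integral_mono)
      show "integrable lborel (\<lambda>t. (norm (indicator {a..b} (t + s) *\<^sub>R v - indicator {a..b} t *\<^sub>R v))\<^sup>2)"
        using sq by (rule sq_integrableD)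
      show "integrable lborel (\<lambda>t. (indicator ?J t + indicator ?K t) * (norm v)\<^sup>2)"
        by (intro integrable_mult_left Bochner_Integration.integrable_add integrable_indicator_Icc)
      show "(norm (indicator {a..b} (t + s) *\<^sub>R v - indicator {a..b} t *\<^sub>R v))\<^sup>2
          \<le> (indicator ?J t + indicator ?K t) * (norm v)\<^sup>2" for t
        by (auto simp: indicator_def)
    qed
    also have "\<dots> = 4 * \<bar>s\<bar> * (norm v)\<^sup>2"
      using integrable_indicator_Icc[of "a - \<bar>s\<bar>" "a + \<bar>s\<bar>"] integrable_indicator_Icc[of "b - \<bar>s\<bar>" "b + \<bar>s\<bar>"]
      by (simp add: Bochner_Integration.integral_add)
    finally show ?thesis .
  qed
  have "((\<lambda>s. 4 * \<bar>s\<bar> * (norm v)\<^sup>2) \<longlongrightarrow> 4 * \<bar>0\<bar> * (norm v)\<^sup>2) (at 0)"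
    by (intro tendsto_intros)
  then have "((\<lambda>s. (norm (shift_l2 s (l2_step a b v) - l2_step a b v))\<^sup>2) \<longlongrightarrow> 0) (at 0)"
    using Lim_null_comparison[OF always_eventually, of "\<lambda>s. (norm (shift_l2 s (l2_step a b v) - l2_step a b v))\<^sup>2"
        "\<lambda>s. 4 * \<bar>s\<bar> * (norm v)\<^sup>2" "at 0"] bound by simp
  from tendsto_real_sqrt[OF this]
  have "((\<lambda>s. norm (shift_l2 s (l2_step a b v) - l2_step a b v)) \<longlongrightarrow> 0) (at 0)" by simp
  then show ?thesis by (rule LIM_zero_cancel[OF tendsto_norm_zero_cancel])
qed

text \<open>Translations are isometries, so convergence on a dense subspace extends to all x by an
  epsilon/3 argument. The subspace of good x contains the steps, which are total.\<close>

lemma shift_l2_tendsto: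
  fixes x :: "'a::{real_inner,banach,second_countable_topology} l2"
  shows "((\<lambda>s. shift_l2 s x) \<longlongrightarrow> x) (at 0)"
proof -
  let ?K = "{x :: 'a l2. ((\<lambda>s. shift_l2 s x) \<longlongrightarrow> x) (at 0)}"
  have zero: "shift_l2 s 0 = 0" for s using shift_l2_scaleR[of s 0] by simp
  have "subspace ?K"
    by (rule subspaceI) (auto simp: zero shift_l2_add shift_l2_scaleR intro!: tendsto_intros)
  then have dense: "closure ?K = UNIV"
  proof (rule dense_if_orthogonal_trivial)
    obtain E :: "'a l2 set" where E: "\<And>z. (\<And>e. e \<in> E \<Longrightarrow> z \<bullet> e = 0) \<Longrightarrow> z = 0"
      "\<And>e. e \<in> E \<Longrightarrow> \<exists>a b v. e = l2_step a b v"
      using l2_countable_steps_total by metis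
    show "z = 0" if "\<And>k. k \<in> ?K \<Longrightarrow> z \<bullet> k = 0" for z
    proof (rule E(1))
      fix e assume "e \<in> E"
      then have "e \<in> ?K" using E(2) shift_step_tendsto by blast
      then show "z \<bullet> e = 0" by (rule that)
    qed
  qed
  show ?thesis
  proof (rule tendstoI)
    fix e :: real assume "e > 0"
    then have "e / 3 > 0" by simp
    moreover have "x \<in> closure ?K" using dense by simp
    ultimately obtain y where y: "y \<in> ?K" "dist y x < e / 3" unfolding closure_approachable by blast
    then have "\<forall>\<^sub>F s in at 0. dist (shift_l2 s y) y < e / 3"
      using \<open>e / 3 > 0\<close> tendstoD by blast
    then show "\<forall>\<^sub>F s in at 0. dist (shift_l2 s x) x < e"
    proof eventually_elim
      fix s assume s: "dist (shift_l2 s y) y < e / 3"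
      have "dist (shift_l2 s x) (shift_l2 s y) = dist x y"
        using norm_shift_l2[of s "x - y"] by (simp add: dist_norm shift_l2_diff)
      then show "dist (shift_l2 s x) x < e"
        using dist_triangle[of "shift_l2 s x" x "shift_l2 s y"] dist_triangle[of "shift_l2 s y" x y] s y(2)
        by (simp add: dist_commute)
    qed
  qed
qed

section \<open>From functions on (0,T) to classes on the line\<close>

lemma AE_time_measure: "(AE t in time_measure T. P t) \<longleftrightarrow> (AE t in lborel. 0 < t \<and> t < T \<longrightarrow> P t)"
  by (subst AE_restrict_space_iff) (auto simp: AE_completion_iff)

text \<open>Each simple function of an approximating sequence is Borel after a change on a null set,
  and countably many null sets remain null.\<close>

lemma borel_representative:
  fixes f :: "real \<Rightarrow> 'v::{banach,second_countable_topology}"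
  assumes "f \<in> borel_measurable lebesgue"
  obtains g where "g \<in> borel_measurable borel" "AE t in lborel. f t = g t"
proof -
  obtain s where s: "\<And>i. simple_function lebesgue (s i)" "\<And>t. (\<lambda>i. s i t) \<longlonglongrightarrow> f t"
    using borel_measurable_implies_sequence_metric[OF assms, of 0] by auto
  have "\<exists>s'. simple_function lborel s' \<and> (AE t in lborel. s i t = s' t)" for i
    using completion_ex_simple_function[OF s(1)] .
  then obtain s' where s': "\<And>i. simple_function lborel (s' i)" "\<And>i. AE t in lborel. s i t = s' i t"
    by metis
  have [measurable]: "s' i \<in> borel_measurable borel" for i
    using borel_measurable_simple_function[OF s'(1)] by simp
  define g where "g t = lim (\<lambda>i. s' i t)" for t
  have "g \<in> borel_measurable borel" unfolding g_def by measurable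
  moreover have "AE t in lborel. \<forall>i. s i t = s' i t" using s'(2) by (simp add: AE_all_countable)
  then have "AE t in lborel. f t = g t"
  proof eventually_elim
    fix t assume "\<forall>i. s i t = s' i t"
    then have "(\<lambda>i. s' i t) \<longlonglongrightarrow> f t" using s(2)[of t] by simp
    then show "f t = g t" unfolding g_def by (simp add: limI)
  qed
  ultimately show ?thesis by (rule that)
qed

lemma time_representative:
  fixes y :: "real \<Rightarrow> 'v::{banach,second_countable_topology}"
  assumes "y \<in> borel_measurable (time_measure T)"
  obtains g where "g \<in> borel_measurable borel"
    "AE t in lborel. g t = (if 0 < t \<and> t < T then y t else 0)"
proof -
  have "(\<lambda>t. if t \<in> {0<..<T} then y t else 0) \<in> borel_measurable lebesgue"
    using assms by (subst measurable_restrict_space_iff[symmetric]) auto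
  then obtain g where g: "g \<in> borel_measurable borel"
    "AE t in lborel. (if t \<in> {0<..<T} then y t else 0) = g t"
    by (rule borel_representative)
  from g(2) have "AE t in lborel. g t = (if 0 < t \<and> t < T then y t else 0)"
    by eventually_elim auto
  with g(1) show ?thesis by (rule that)
qed

text \<open>The bridge between Lebesgue integrals over (0,T) and Borel integrals over the line;
  \<open>eq\<close> admits any representative of the extension by zero.\<close>

lemma time_integral:
  fixes h :: "real \<Rightarrow> real"
  assumes h: "h \<in> borel_measurable (time_measure T)" and h': "h' \<in> borel_measurable borel"
    and eq: "AE t in lborel. h' t = (if 0 < t \<and> t < T then h t else 0)"
  shows "integrable (time_measure T) h \<longleftrightarrow> integrable lborel h'"
    and "(LINT t|time_measure T. h t) = (LINT t|lborel. h' t)"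
proof -
  let ?k = "\<lambda>t. indicator {0<..<T} t *\<^sub>R h t"
  have "(\<lambda>t. if t \<in> {0<..<T} then h t else 0) \<in> borel_measurable lebesgue"
    using h by (subst measurable_restrict_space_iff[symmetric]) auto
  also have "(\<lambda>t. if t \<in> {0<..<T} then h t else 0) = ?k" by (auto simp: indicator_def)
  finally have k: "?k \<in> borel_measurable lebesgue" .
  have h'': "h' \<in> borel_measurable lebesgue" using h' by (intro measurable_completion) auto
  from eq have eq': "AE t in lebesgue. ?k t = h' t"
    unfolding AE_completion_iff by eventually_elim (auto simp: indicator_def)
  have "integrable (time_measure T) h \<longleftrightarrow> integrable lebesgue ?k"
    by (subst integrable_restrict_space) auto
  also have "\<dots> \<longleftrightarrow> integrable lebesgue h'"
    by (rule integrable_cong_AE[OF k h'' eq'])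
  also have "\<dots> \<longleftrightarrow> integrable lborel h'" using h' by (intro integrable_completion) auto
  finally show "integrable (time_measure T) h \<longleftrightarrow> integrable lborel h'" .
  have "(LINT t|time_measure T. h t) = (LINT t|lebesgue. ?k t)"
    by (subst integral_restrict_space) auto
  also have "\<dots> = (LINT t|lebesgue. h' t)" by (rule integral_cong_AE[OF k h'' eq'])
  also have "\<dots> = (LINT t|lborel. h' t)" using h' by (intro integral_completion) auto
  finally show "(LINT t|time_measure T. h t) = (LINT t|lborel. h' t)" .
qed

text \<open>The class of the extension by zero. SOME picks a Borel representative; any two agree
  almost everywhere, so the class does not depend on the choice. The value is meaningful for y in
  \<open>L2\<close> only.\<close>

definition l2_of :: "real \<Rightarrow> (real \<Rightarrow> 'v) \<Rightarrow> 'v::{real_inner,banach,second_countable_topology} l2" where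
  "l2_of T y = abs_l2 (SOME f. sq_integrable f \<and> (AE t in lborel. f t = (if 0 < t \<and> t < T then y t else 0)))"

lemma L2D:
  assumes "y \<in> L2 T W"
  shows "y \<in> borel_measurable (time_measure T)" "integrable (time_measure T) (\<lambda>t. (norm (y t))\<^sup>2)"
    "AE t in time_measure T. y t \<in> W"
  using assms by (auto simp: L2_def)

lemma L2_UNIV: "y \<in> L2 T W \<Longrightarrow> y \<in> L2 T UNIV"
  by (auto simp: L2_def)

lemma l2_of_rep:
  assumes y: "y \<in> L2 T W"
  obtains f where "sq_integrable f" "l2_of T y = abs_l2 f"
    "AE t in lborel. f t = (if 0 < t \<and> t < T then y t else 0)"
proof -
  obtain g where g [measurable]: "g \<in> borel_measurable borel"
    and eq: "AE t in lborel. g t = (if 0 < t \<and> t < T then y t else 0)"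
    using time_representative[OF L2D(1)[OF y]] .
  have "AE t in lborel. (norm (g t))\<^sup>2 = (if 0 < t \<and> t < T then (norm (y t))\<^sup>2 else 0)"
    using eq by eventually_elim auto
  then have "integrable lborel (\<lambda>t. (norm (g t))\<^sup>2)"
    using L2D(2)[OF y] by (subst time_integral(1)[symmetric, where h="\<lambda>t. (norm (y t))\<^sup>2"]) auto
  then have "sq_integrable g \<and> (AE t in lborel. g t = (if 0 < t \<and> t < T then y t else 0))"
    using eq g by (simp add: sq_integrable_def)
  from someI[of "\<lambda>f. sq_integrable f \<and> (AE t in lborel. f t = (if 0 < t \<and> t < T then y t else 0))", OF this]
  show ?thesis using that[OF _ l2_of_def] by blast
qed

lemma l2_of_eqI:
  assumes "y \<in> L2 T W" "sq_integrable f" "AE t in lborel. f t = (if 0 < t \<and> t < T then y t else 0)"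
  shows "l2_of T y = abs_l2 f"
proof -
  obtain g where g: "sq_integrable g" "l2_of T y = abs_l2 g"
    "AE t in lborel. g t = (if 0 < t \<and> t < T then y t else 0)"
    using l2_of_rep[OF assms(1)] .
  have "AE t in lborel. g t = f t" using g(3) assms(3) by eventually_elim simp
  then show ?thesis using g assms(2) by (simp add: abs_l2_eq_iff)
qed

lemma L2_add:
  fixes y z :: "real \<Rightarrow> 'v::{real_inner,banach,second_countable_topology}"
  assumes y: "y \<in> L2 T W" and z: "z \<in> L2 T W" and W: "subspace W"
  shows "(\<lambda>t. y t + z t) \<in> L2 T W"
proof -
  note [measurable] = L2D(1)[OF y] L2D(1)[OF z]
  have "integrable (time_measure T) (\<lambda>t. (norm (y t + z t))\<^sup>2)"
  proof (rule Bochner_Integration.integrable_bound)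
    show "integrable (time_measure T) (\<lambda>t. 2 * (norm (y t))\<^sup>2 + 2 * (norm (z t))\<^sup>2)"
      using L2D(2)[OF y] L2D(2)[OF z] by auto
  qed (use norm_add_sq_le in \<open>auto simp: abs_of_nonneg\<close>)
  moreover have "AE t in time_measure T. y t + z t \<in> W"
    using L2D(3)[OF y] L2D(3)[OF z] by eventually_elim (rule subspace_add[OF W])
  ultimately show ?thesis by (simp add: L2_def)
qed

lemma L2_scaleR:
  fixes y :: "real \<Rightarrow> 'v::{real_inner,banach,second_countable_topology}"
  assumes y: "y \<in> L2 T W" and W: "subspace W"
  shows "(\<lambda>t. c *\<^sub>R y t) \<in> L2 T W"
proof -
  have "AE t in time_measure T. c *\<^sub>R y t \<in> W"
    using L2D(3)[OF y] by eventually_elim (rule subspace_mul[OF W])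
  then show ?thesis using L2D[OF y] by (auto simp: L2_def power_mult_distrib)
qed

lemma L2_diff:
  fixes y z :: "real \<Rightarrow> 'v::{real_inner,banach,second_countable_topology}"
  assumes "y \<in> L2 T W" "z \<in> L2 T W" "subspace W"
  shows "(\<lambda>t. y t - z t) \<in> L2 T W"
  using L2_add[OF assms(1) L2_scaleR[OF assms(2,3), of "-1"] assms(3)] by simp

lemma l2_of_add:
  assumes "y \<in> L2 T UNIV" "z \<in> L2 T UNIV"
  shows "l2_of T (\<lambda>t. y t + z t) = l2_of T y + l2_of T z"
proof -
  obtain f where f: "sq_integrable f" "l2_of T y = abs_l2 f"
    "AE t in lborel. f t = (if 0 < t \<and> t < T then y t else 0)" using l2_of_rep[OF assms(1)] .
  obtain g where g: "sq_integrable g" "l2_of T z = abs_l2 g"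
    "AE t in lborel. g t = (if 0 < t \<and> t < T then z t else 0)" using l2_of_rep[OF assms(2)] .
  have "l2_of T (\<lambda>t. y t + z t) = abs_l2 (\<lambda>t. f t + g t)"
  proof (rule l2_of_eqI[OF L2_add[OF assms]])
    show "AE t in lborel. f t + g t = (if 0 < t \<and> t < T then y t + z t else 0)"
      using f(3) g(3) by eventually_elim auto
  qed (use f g in \<open>auto intro: sq_integrable_add\<close>)
  then show ?thesis using f g by (simp add: plus_l2.abs_eq l2_rel_def)
qed

lemma l2_of_scaleR:
  assumes "y \<in> L2 T UNIV"
  shows "l2_of T (\<lambda>t. c *\<^sub>R y t) = c *\<^sub>R l2_of T y"
proof -
  obtain f where f: "sq_integrable f" "l2_of T y = abs_l2 f"
    "AE t in lborel. f t = (if 0 < t \<and> t < T then y t else 0)" using l2_of_rep[OF assms] .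
  have "l2_of T (\<lambda>t. c *\<^sub>R y t) = abs_l2 (\<lambda>t. c *\<^sub>R f t)"
  proof (rule l2_of_eqI[OF L2_scaleR[OF assms]])
    show "AE t in lborel. c *\<^sub>R f t = (if 0 < t \<and> t < T then c *\<^sub>R y t else 0)"
      using f(3) by eventually_elim auto
  qed (use f in \<open>auto intro: sq_integrable_scaleR\<close>)
  then show ?thesis using f by (simp add: scaleR_l2.abs_eq l2_rel_def)
qed

lemma l2_of_diff:
  assumes "y \<in> L2 T UNIV" "z \<in> L2 T UNIV"
  shows "l2_of T (\<lambda>t. y t - z t) = l2_of T y - l2_of T z"
  using l2_of_add[OF assms(1) L2_scaleR[OF assms(2), of "-1"]] l2_of_scaleR[OF assms(2), of "-1"] by simp

lemma l2_of_inner: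
  assumes y: "y \<in> L2 T UNIV" and z: "z \<in> L2 T UNIV"
  shows "l2_of T y \<bullet> l2_of T z = (LINT t|time_measure T. y t \<bullet> z t)"
    and "integrable (time_measure T) (\<lambda>t. y t \<bullet> z t)"
proof -
  note [measurable] = L2D(1)[OF y] L2D(1)[OF z]
  obtain f where f: "sq_integrable f" "l2_of T y = abs_l2 f"
    "AE t in lborel. f t = (if 0 < t \<and> t < T then y t else 0)" using l2_of_rep[OF y] .
  obtain g where g: "sq_integrable g" "l2_of T z = abs_l2 g"
    "AE t in lborel. g t = (if 0 < t \<and> t < T then z t else 0)" using l2_of_rep[OF z] .
  note [measurable] = sq_integrableD(1)[OF f(1)] sq_integrableD(1)[OF g(1)]
  have eq: "AE t in lborel. f t \<bullet> g t = (if 0 < t \<and> t < T then y t \<bullet> z t else 0)"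
    using f(3) g(3) by eventually_elim auto
  have m: "(\<lambda>t. y t \<bullet> z t) \<in> borel_measurable (time_measure T)" "(\<lambda>t. f t \<bullet> g t) \<in> borel_measurable borel"
    by measurable
  show "l2_of T y \<bullet> l2_of T z = (LINT t|time_measure T. y t \<bullet> z t)"
    by (simp add: f g inner_l2_abs time_integral(2)[OF m eq])
  show "integrable (time_measure T) (\<lambda>t. y t \<bullet> z t)"
    using time_integral(1)[OF m eq] integrable_inner[OF f(1) g(1)] by simp
qed

lemma norm_l2_of: "y \<in> L2 T UNIV \<Longrightarrow> norm (l2_of T y) = L2_norm T y"
  by (simp add: L2_norm_def norm_eq_sqrt_inner l2_of_inner)

lemma l2_of_eq_iff:
  assumes "y \<in> L2 T UNIV" "z \<in> L2 T UNIV"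
  shows "l2_of T y = l2_of T z \<longleftrightarrow> (AE t in time_measure T. y t = z t)"
proof -
  obtain f where f: "sq_integrable f" "l2_of T y = abs_l2 f"
    "AE t in lborel. f t = (if 0 < t \<and> t < T then y t else 0)" using l2_of_rep[OF assms(1)] .
  obtain g where g: "sq_integrable g" "l2_of T z = abs_l2 g"
    "AE t in lborel. g t = (if 0 < t \<and> t < T then z t else 0)" using l2_of_rep[OF assms(2)] .
  have "l2_of T y = l2_of T z \<longleftrightarrow> (AE t in lborel. f t = g t)" using f g by (simp add: abs_l2_eq_iff)
  also have "\<dots> \<longleftrightarrow> (AE t in lborel. 0 < t \<and> t < T \<longrightarrow> y t = z t)"
  proof
    assume "AE t in lborel. f t = g t"
    then show "AE t in lborel. 0 < t \<and> t < T \<longrightarrow> y t = z t"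
      using f(3) g(3) by eventually_elim auto
  next
    assume "AE t in lborel. 0 < t \<and> t < T \<longrightarrow> y t = z t"
    then show "AE t in lborel. f t = g t" using f(3) g(3) by eventually_elim auto
  qed
  finally show ?thesis by (simp add: AE_time_measure)
qed

lemma sq_integrable_L2:
  assumes f: "sq_integrable f" and W: "AE t in lborel. 0 < t \<and> t < T \<longrightarrow> f t \<in> W"
  shows "f \<in> L2 T W"
proof -
  have "f \<in> borel_measurable (time_measure T)"
    by (intro measurable_restrict_space1 measurable_completion) (use sq_integrableD(1)[OF f] in auto)
  moreover have "integrable (time_measure T) (\<lambda>t. (norm (f t))\<^sup>2)"
  proof -
    have "integrable lebesgue (\<lambda>t. (norm (f t))\<^sup>2)"
      using sq_integrableD[OF f] by (subst integrable_completion) auto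
    then have "integrable lebesgue (\<lambda>t. indicator {0<..<T} t *\<^sub>R (norm (f t))\<^sup>2)"
      by (rule integrable_mult_indicator[rotated]) auto
    then show ?thesis by (subst integrable_restrict_space) auto
  qed
  ultimately show ?thesis using W by (simp add: L2_def AE_time_measure)
qed

lemma subspace_l2_of:
  fixes Y :: "(real \<Rightarrow> 'v::{real_inner,banach,second_countable_topology}) set"
  assumes "Y \<subseteq> L2 T UNIV" "Y \<noteq> {}"
    and "\<And>y z. y \<in> Y \<Longrightarrow> z \<in> Y \<Longrightarrow> (\<lambda>t. y t + z t) \<in> Y"
    and "\<And>c y. y \<in> Y \<Longrightarrow> (\<lambda>t. c *\<^sub>R y t) \<in> Y"
  shows "subspace (l2_of T ` Y)"
proof (rule subspaceI)
  obtain y where y: "y \<in> Y" using assms(2) by blast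
  show "0 \<in> l2_of T ` Y"
    by (rule image_eqI[OF _ assms(4)[OF y, of 0]]) (use y assms(1) l2_of_scaleR[of y T 0] in auto)
next
  fix a b assume "a \<in> l2_of T ` Y" "b \<in> l2_of T ` Y"
  then obtain y z where yz: "y \<in> Y" "z \<in> Y" "a = l2_of T y" "b = l2_of T z" by blast
  then have "a + b = l2_of T (\<lambda>t. y t + z t)" using l2_of_add[of y T z] assms(1) by (simp add: subset_iff)
  then show "a + b \<in> l2_of T ` Y" using assms(3) yz by blast
next
  fix c a assume "a \<in> l2_of T ` Y"
  then obtain y where y: "y \<in> Y" "a = l2_of T y" by blast
  then have "c *\<^sub>R a = l2_of T (\<lambda>t. c *\<^sub>R y t)" using l2_of_scaleR[of y T c] assms(1) by (simp add: subset_iff)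
  then show "c *\<^sub>R a \<in> l2_of T ` Y" using assms(4) y by blast
qed

lemma L2_zero: "subspace W \<Longrightarrow> (\<lambda>t. 0) \<in> L2 T W"
  by (simp add: L2_def subspace_0)

text \<open>A convergent sequence of classes has representatives converging almost everywhere along
  a subsequence. Membership in the closed set W and vanishing outside (0,T) survive this
  limit.\<close>

lemma closed_l2_of_L2:
  fixes W :: "'v::{real_inner,banach,second_countable_topology} set"
  assumes W: "closed W" "subspace W"
  shows "closed (l2_of T ` L2 T W)"
  unfolding closed_sequential_limits
proof (intro allI impI, elim conjE)
  fix X x assume X: "\<forall>n. X n \<in> l2_of T ` L2 T W" "X \<longlonglongrightarrow> x"
  have "\<exists>f. sq_integrable f \<and> X n = abs_l2 f \<and>
      (AE t in lborel. f t \<in> W \<and> (\<not> (0 < t \<and> t < T) \<longrightarrow> f t = 0))" for n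
  proof -
    obtain y where y: "y \<in> L2 T W" "X n = l2_of T y" using X(1) by blast
    obtain f where f: "sq_integrable f" "l2_of T y = abs_l2 f"
      "AE t in lborel. f t = (if 0 < t \<and> t < T then y t else 0)" using l2_of_rep[OF y(1)] .
    have "AE t in lborel. 0 < t \<and> t < T \<longrightarrow> y t \<in> W"
      using L2D(3)[OF y(1)] by (simp add: AE_time_measure)
    then have "AE t in lborel. f t \<in> W \<and> (\<not> (0 < t \<and> t < T) \<longrightarrow> f t = 0)"
      using f(3) by eventually_elim (use subspace_0[OF W(2)] in auto)
    then show ?thesis using f y by auto
  qed
  then have "\<forall>n. \<exists>f. sq_integrable f \<and> X n = abs_l2 f \<and>
      (AE t in lborel. f t \<in> W \<and> (\<not> (0 < t \<and> t < T) \<longrightarrow> f t = 0))" by blast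
  from choice[OF this] obtain f where f: "\<And>n. sq_integrable (f n)" "\<And>n. X n = abs_l2 (f n)"
    and fW: "\<And>n. AE t in lborel. f n t \<in> W \<and> (\<not> (0 < t \<and> t < T) \<longrightarrow> f n t = 0)"
    by blast
  have X_eq: "X = (\<lambda>n. abs_l2 (f n))" using f(2) by blast
  have "Cauchy (\<lambda>n. abs_l2 (f n))" using LIMSEQ_imp_Cauchy[OF X(2)] by (simp add: X_eq)
  then obtain r g where g: "sq_integrable g" "(\<lambda>n. abs_l2 (f n)) \<longlonglongrightarrow> abs_l2 g"
    "AE t in lborel. (\<lambda>k. f (r k) t) \<longlonglongrightarrow> g t"
    by (rule l2_Cauchy_AE_subseq[OF f(1)])
  have x: "x = abs_l2 g" by (rule LIMSEQ_unique[OF X(2)[unfolded X_eq] g(2)])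
  have "AE t in lborel. \<forall>n. f n t \<in> W \<and> (\<not> (0 < t \<and> t < T) \<longrightarrow> f n t = 0)"
    using fW by (simp add: AE_all_countable)
  then have gW: "AE t in lborel. g t \<in> W \<and> (\<not> (0 < t \<and> t < T) \<longrightarrow> g t = 0)"
    using g(3)
  proof eventually_elim
    fix t assume t: "\<forall>n. f n t \<in> W \<and> (\<not> (0 < t \<and> t < T) \<longrightarrow> f n t = 0)" "(\<lambda>k. f (r k) t) \<longlonglongrightarrow> g t"
    have "g t \<in> W" by (rule closed_sequentially[OF W(1) _ t(2)]) (use t(1) in simp)
    moreover have "g t = 0" if "\<not> (0 < t \<and> t < T)"
    proof -
      have "(\<lambda>k. f (r k) t) = (\<lambda>k. 0)" using t(1) that by blast
      then show ?thesis using t(2) by (simp add: LIMSEQ_const_iff)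
    qed
    ultimately show "g t \<in> W \<and> (\<not> (0 < t \<and> t < T) \<longrightarrow> g t = 0)" by blast
  qed
  then have L: "g \<in> L2 T W" by (intro sq_integrable_L2[OF g(1)]) (auto elim!: AE_mp)
  have "l2_of T g = abs_l2 g"
  proof (rule l2_of_eqI[OF L g(1)])
    show "AE t in lborel. g t = (if 0 < t \<and> t < T then g t else 0)"
      using gW by eventually_elim auto
  qed
  then show "x \<in> l2_of T ` L2 T W" using L x by (intro image_eqI[OF _ L]) simp
qed

lemma L2_riesz:
  fixes g :: "real \<Rightarrow> 'v::{real_inner,banach,second_countable_topology} \<Rightarrow>\<^sub>L real"
  shows "g \<in> L2 T UNIV \<Longrightarrow> (\<lambda>t. riesz (g t)) \<in> L2 T UNIV"
  by (auto simp: L2_def riesz)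

lemma L2_norm_riesz: "L2_norm T (\<lambda>t. riesz (g t)) = L2_norm T g"
  by (simp add: L2_norm_def riesz)

section \<open>Smooth cut-off functions and weak derivatives\<close>

definition flat :: "real poly \<Rightarrow> real \<Rightarrow> real" where
  "flat P x = (if 0 < x then poly P (inverse x) * exp (- inverse x) else 0)"

lemma poly_exp_tendsto_0: "((\<lambda>y::real. poly P y * exp (- y)) \<longlongrightarrow> 0) at_top"
proof -
  have "((\<lambda>y. \<Sum>i\<le>degree P. coeff P i * (y ^ i / exp y)) \<longlongrightarrow> (\<Sum>i\<le>degree P. coeff P i * 0)) at_top"
    by (intro tendsto_intros tendsto_power_div_exp_0)
  moreover have "(\<lambda>y. \<Sum>i\<le>degree P. coeff P i * (y ^ i / exp y)) = (\<lambda>y. poly P y * exp (- y))"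
    by (simp add: poly_altdef sum_distrib_right exp_minus divide_inverse mult.assoc)
  ultimately show ?thesis by simp
qed

text \<open>With y = 1/x, the derivative of P(y) exp(-y) in x is y^2 (P(y) - P'(y)) exp(-y), so the
  polynomial parameter makes the family closed under differentiation. At 0 the right difference
  quotient is y P(y) exp(-y), which tends to 0.\<close>

lemma flat_has_derivative:
  "(flat P has_real_derivative flat ([:0, 0, 1:] * (P - pderiv P)) x) (at x)"
proof -
  consider "x > 0" | "x < 0" | "x = 0" by linarith
  then show ?thesis
  proof cases
    case 1
    have "((\<lambda>x. poly P (inverse x) * exp (- inverse x)) has_real_derivative
        flat ([:0, 0, 1:] * (P - pderiv P)) x) (at x)"
      using 1 by (auto intro!: derivative_eq_intros simp: flat_def poly_diff algebra_simps power2_eq_square)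
    then show ?thesis
      by (rule has_field_derivative_transform_within_open[of _ _ _ "{0<..}"]) (use 1 in \<open>auto simp: flat_def\<close>)
  next
    case 2
    have "((\<lambda>x. 0) has_real_derivative flat ([:0, 0, 1:] * (P - pderiv P)) x) (at x)"
      using 2 by (simp add: flat_def)
    then show ?thesis
      by (rule has_field_derivative_transform_within_open[of _ _ _ "{..<0}"]) (use 2 in \<open>auto simp: flat_def\<close>)
  next
    case 3
    have lim: "((\<lambda>y. poly ([:0, 1:] * P) y * exp (- y)) \<longlongrightarrow> 0) at_top" by (rule poly_exp_tendsto_0)
    have "((\<lambda>h. poly ([:0, 1:] * P) (inverse h) * exp (- inverse h)) \<longlongrightarrow> 0) (at_right 0)"
      by (rule filterlim_compose[OF lim filterlim_inverse_at_top_right])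
    then have "((\<lambda>h. flat P h / h) \<longlongrightarrow> 0) (at_right 0)"
    proof (rule Lim_transform_eventually)
      show "\<forall>\<^sub>F h in at_right 0. poly ([:0, 1:] * P) (inverse h) * exp (- inverse h) = flat P h / h"
        by (auto simp: eventually_at_right_field flat_def divide_inverse algebra_simps intro!: exI[of _ 1])
    qed
    moreover have "((\<lambda>h. flat P h / h) \<longlongrightarrow> 0) (at_left 0)"
      by (rule tendsto_eventually) (auto simp: eventually_at_left_field flat_def intro!: exI[of _ "-1"])
    ultimately have "((\<lambda>h. flat P h / h) \<longlongrightarrow> 0) (at 0)" by (simp add: filterlim_at_split)
    then show ?thesis using 3 by (simp add: DERIV_def flat_def)
  qed
qed

text \<open>The closure rules are those called for by the sum, product and chain rules. Every member
  then has a derivative in the set, and smoothness follows by induction without formulas for higher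
  derivatives.\<close>

inductive_set smooth_alg :: "(real \<Rightarrow> real) set" where
  flat: "flat P \<in> smooth_alg"
| add: "f \<in> smooth_alg \<Longrightarrow> g \<in> smooth_alg \<Longrightarrow> (\<lambda>x. f x + g x) \<in> smooth_alg"
| mult: "f \<in> smooth_alg \<Longrightarrow> g \<in> smooth_alg \<Longrightarrow> (\<lambda>x. f x * g x) \<in> smooth_alg"
| scale: "f \<in> smooth_alg \<Longrightarrow> (\<lambda>x. c * f x) \<in> smooth_alg"
| affine: "f \<in> smooth_alg \<Longrightarrow> (\<lambda>x. f (c * x + d)) \<in> smooth_alg"

lemma smooth_alg_deriv:
  "f \<in> smooth_alg \<Longrightarrow> \<exists>f'\<in>smooth_alg. \<forall>x. (f has_real_derivative f' x) (at x)"
proof (induction rule: smooth_alg.induct)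
  case (flat P)
  then show ?case using flat_has_derivative smooth_alg.flat by blast
next
  case (add f g)
  then obtain f' g' where "f' \<in> smooth_alg" "g' \<in> smooth_alg"
    "\<And>x. (f has_real_derivative f' x) (at x)" "\<And>x. (g has_real_derivative g' x) (at x)" by blast
  then show ?case by (intro bexI[of _ "\<lambda>x. f' x + g' x"]) (auto intro!: derivative_eq_intros smooth_alg.add)
next
  case (mult f g)
  then obtain f' g' where "f' \<in> smooth_alg" "g' \<in> smooth_alg"
    "\<And>x. (f has_real_derivative f' x) (at x)" "\<And>x. (g has_real_derivative g' x) (at x)" by blast
  with mult show ?case
    by (intro bexI[of _ "\<lambda>x. f' x * g x + f x * g' x"])
      (auto intro!: derivative_eq_intros smooth_alg.add smooth_alg.mult)
next
  case (scale f c)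
  then obtain f' where "f' \<in> smooth_alg" "\<And>x. (f has_real_derivative f' x) (at x)" by blast
  then show ?case
    by (intro bexI[of _ "\<lambda>x. c * f' x"]) (auto intro!: derivative_eq_intros smooth_alg.scale)
next
  case (affine f c d)
  then obtain f' where f': "f' \<in> smooth_alg" "\<And>x. (f has_real_derivative f' x) (at x)" by blast
  have "((\<lambda>x. f (c * x + d)) has_real_derivative c * f' (c * x + d)) (at x)" for x
    by (rule DERIV_cong[OF DERIV_chain2[OF f'(2)]]) (auto intro!: derivative_eq_intros)
  then show ?case
    by (intro bexI[of _ "\<lambda>x. c * f' (c * x + d)"])
      (auto intro: smooth_alg.scale smooth_alg.affine[OF f'(1)])
qed

lemma smooth_alg_smooth:
  assumes "f \<in> smooth_alg"
  shows "(deriv ^^ n) f differentiable (at t)"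
proof -
  have "(deriv ^^ n) f \<in> smooth_alg"
  proof (induction n)
    case (Suc n)
    then obtain f' where f': "f' \<in> smooth_alg" "\<And>x. ((deriv ^^ n) f has_real_derivative f' x) (at x)"
      using smooth_alg_deriv by blast
    then have "(deriv ^^ Suc n) f = f'" by (auto intro: DERIV_imp_deriv)
    with f' show ?case by simp
  qed (use assms in simp)
  then show ?thesis using smooth_alg_deriv real_differentiable_def by blast
qed

text \<open>The cut-off functions are combinations of \<open>step\<close>, which is defined as an
  integral; it is their derivatives, combinations of \<open>bump\<close>, that are shown to lie in
  the algebra.\<close>

lemma antiderivative_smooth:
  assumes "f \<in> smooth_alg" "\<And>x. (F has_real_derivative f x) (at x)"
  shows "(deriv ^^ n) F differentiable (at t)"
proof (cases n)
  case 0
  then show ?thesis using assms(2) real_differentiable_def by auto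
next
  case (Suc m)
  have "deriv F = f" using assms(2) by (auto intro: DERIV_imp_deriv)
  then show ?thesis using smooth_alg_smooth[OF assms(1)] Suc by (simp add: funpow_Suc_right del: funpow.simps)
qed

definition bump :: "real \<Rightarrow> real" where
  "bump x = flat 1 x * flat 1 (1 - x)"

lemma bump_smooth: "bump \<in> smooth_alg"
proof -
  have "(\<lambda>x. flat 1 ((- 1) * x + 1)) \<in> smooth_alg" by (rule smooth_alg.affine[OF smooth_alg.flat])
  from smooth_alg.mult[OF smooth_alg.flat[of 1] this] show ?thesis
    by (simp add: bump_def[abs_def] algebra_simps)
qed

lemma bump_bounds: "0 \<le> bump x" "x \<le> 0 \<or> 1 \<le> x \<Longrightarrow> bump x = 0" "0 < x \<Longrightarrow> x < 1 \<Longrightarrow> 0 < bump x"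
  by (auto simp: bump_def flat_def)

lemma continuous_on_bump: "continuous_on S bump"
  using smooth_alg_deriv[OF bump_smooth] DERIV_isCont continuous_at_imp_continuous_on by blast

text \<open>A smooth ramp across [0,1] from 0 to \<open>step 1\<close>. It is not normalised; the
  factor \<open>step 1\<close> cancels at the end of \<open>weak_derivative_scalar\<close>. The
  lower limit -1 makes every x >= 0 interior to the interval on which the integral is
  differentiated.\<close>

definition step :: "real \<Rightarrow> real" where
  "step x = integral {-1..x} bump"

lemma step_nonpos: "x \<le> 0 \<Longrightarrow> step x = 0"
  using integral_cong[of "{-1..x}" bump "\<lambda>_. 0"] by (simp add: step_def bump_bounds)

lemma step_has_derivative: "(step has_real_derivative bump x) (at x)"
proof (cases "x < 0")
  case True
  have "((\<lambda>x. 0) has_real_derivative bump x) (at x)" using True by (simp add: bump_bounds)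
  then show ?thesis
    by (rule has_field_derivative_transform_within_open[of _ _ _ "{..<0}"]) (use True in \<open>auto simp: step_nonpos\<close>)
next
  case False
  have "((\<lambda>x. integral {-1..x} bump) has_real_derivative bump x) (at x within {-1..x+1})"
    by (rule integral_has_real_derivative[OF continuous_on_bump]) (use False in auto)
  moreover have "at x within {-1..x+1} = at x"
    by (rule at_within_interior) (use False in auto)
  ultimately show ?thesis by (simp add: step_def[abs_def])
qed

lemma step_ge_1: "1 \<le> x \<Longrightarrow> step x = step 1"
proof -
  assume x: "1 \<le> x"
  have "integral {-1..1} bump + integral {1..x} bump = integral {-1..x} bump"
    by (rule Henstock_Kurzweil_Integration.integral_combine)
      (use x in \<open>auto intro!: integrable_continuous_interval continuous_on_bump\<close>)
  moreover have "integral {1..x} bump = 0"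
    using integral_cong[of "{1..x}" bump "\<lambda>_. 0"] by (simp add: bump_bounds)
  ultimately show ?thesis by (simp add: step_def)
qed

lemma mono_step: "x \<le> y \<Longrightarrow> step x \<le> step y"
  using DERIV_nonneg_imp_nondecreasing[of x y step] step_has_derivative bump_bounds(1) by blast

lemma step_1_pos: "0 < step 1"
proof -
  have "step (1/4) < step (3/4)"
  proof (rule DERIV_pos_imp_increasing[of "1/4" "3/4" step])
    fix x :: real assume "1/4 \<le> x" "x \<le> 3/4"
    then show "\<exists>y. (step has_real_derivative y) (at x) \<and> 0 < y"
      using step_has_derivative bump_bounds(3)[of x] by (intro exI[of _ "bump x"]) auto
  qed auto
  then show ?thesis using mono_step[of "3/4" 1] mono_step[of 0 "1/4"] step_nonpos[of 0] by simp
qed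

lemma step_bounds: "0 \<le> step x" "step x \<le> step 1"
  using mono_step[of 0 x] mono_step[of x 1] step_nonpos[of x] step_nonpos[of 0] step_ge_1[of x]
  by (cases "x \<le> 0"; cases "x \<le> 1"; auto simp: step_1_pos less_imp_le)+

lemma bump_integral: "integrable lborel bump" "(LINT x|lborel. bump x) = step 1"
proof -
  have "set_integrable lborel {-1..1} bump"
    by (rule borel_integrable_atLeastAtMost'[OF continuous_on_bump])
  moreover have "(\<lambda>x. indicator {-1..1} x *\<^sub>R bump x) = bump"
  proof
    show "indicator {-1..1} x *\<^sub>R bump x = bump x" for x
      by (cases "x \<le> 0 \<or> 1 \<le> x") (auto simp: indicator_def bump_bounds)
  qed
  ultimately show "integrable lborel bump" "(LINT x|lborel. bump x) = step 1"
    using set_borel_integral_eq_integral(2)[of "{-1..1}" bump]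
    by (simp_all add: set_integrable_def set_lebesgue_integral_def step_def)
qed

lemma borel_measurable_time: "f \<in> borel_measurable borel \<Longrightarrow> f \<in> borel_measurable (time_measure T)"
  by (intro measurable_restrict_space1 measurable_completion) simp

text \<open>Substituting r = a + e n * y turns the integral into that of bump y * \<psi> (a + e n *
  y), which is dominated by B * bump y. The limit is \<psi> a times the integral of
  \<open>bump\<close>.\<close>

lemma bump_mollify:
  fixes \<psi> :: "real \<Rightarrow> real"
  assumes \<psi>: "continuous_on UNIV \<psi>" "\<And>r. \<bar>\<psi> r\<bar> \<le> B" and e: "\<And>n. 0 < e n" "e \<longlonglongrightarrow> 0"
  shows "integrable lborel (\<lambda>r. bump ((r - a) / e n) / e n * \<psi> r)"
    and "(\<lambda>n. LINT r|lborel. bump ((r - a) / e n) / e n * \<psi> r) \<longlonglongrightarrow> step 1 * \<psi> a"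
proof -
  have [measurable]: "bump \<in> borel_measurable borel" "\<psi> \<in> borel_measurable borel"
    using borel_measurable_continuous_onI continuous_on_bump \<psi>(1) by blast+
  have int: "integrable lborel (\<lambda>y. bump y * \<psi> (a + e n * y))" for n
  proof (rule Bochner_Integration.integrable_bound)
    show "integrable lborel (\<lambda>y. B * bump y)" using bump_integral(1) by auto
    show "AE y in lborel. norm (bump y * \<psi> (a + e n * y)) \<le> norm (B * bump y)"
    proof (intro AE_I2)
      fix y
      have "bump y * \<bar>\<psi> (a + e n * y)\<bar> \<le> bump y * B"
        by (intro mult_left_mono \<psi>(2) bump_bounds(1))
      also have "\<dots> \<le> \<bar>B * bump y\<bar>" by (simp add: mult.commute)
      finally show "norm (bump y * \<psi> (a + e n * y)) \<le> norm (B * bump y)"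
        using bump_bounds(1)[of y] by (simp add: abs_mult)
    qed
  qed measurable
  have en: "e n \<noteq> 0" for n using e(1)[of n] by simp
  have "integrable lborel (\<lambda>r. bump (- a / e n + 1 / e n * r) * \<psi> (a + e n * (- a / e n + 1 / e n * r)))"
    using lborel_integrable_real_affine[OF int[of n], of "1 / e n" "- a / e n"] en[of n] by simp
  moreover have "- a / e n + 1 / e n * r = (r - a) / e n" "a + e n * ((r - a) / e n) = r" for r
    using en[of n] by (simp_all add: field_simps)
  ultimately have "integrable lborel (\<lambda>r. bump ((r - a) / e n) * \<psi> r / e n)"
    by (intro integrable_divide) simp
  then show "integrable lborel (\<lambda>r. bump ((r - a) / e n) / e n * \<psi> r)" by simp
  have eq: "(LINT r|lborel. bump ((r - a) / e n) / e n * \<psi> r) = (LINT y|lborel. bump y * \<psi> (a + e n * y))" for n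
    using lborel_integral_real_affine[of "e n" "\<lambda>r. bump ((r - a) / e n) / e n * \<psi> r" a] en[of n] e(1)[of n]
    by (simp add: field_simps flip: integral_mult_right_zero)
  have "(\<lambda>n. LINT y|lborel. bump y * \<psi> (a + e n * y)) \<longlonglongrightarrow> (LINT y|lborel. bump y * \<psi> a)"
  proof (rule integral_dominated_convergence)
    show "integrable lborel (\<lambda>y. B * bump y)" using bump_integral(1) by auto
    show "AE y in lborel. (\<lambda>n. bump y * \<psi> (a + e n * y)) \<longlonglongrightarrow> bump y * \<psi> a"
    proof (intro AE_I2 tendsto_mult tendsto_const)
      fix y
      have "(\<lambda>n. a + e n * y) \<longlonglongrightarrow> a + 0 * y" by (intro tendsto_intros e(2))
      then have lim: "(\<lambda>n. a + e n * y) \<longlonglongrightarrow> a" by simp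
      have "isCont \<psi> a" using \<psi>(1) by (simp add: continuous_on_eq_continuous_at)
      from isCont_tendsto_compose[OF this lim] show "(\<lambda>n. \<psi> (a + e n * y)) \<longlonglongrightarrow> \<psi> a" .
    qed
    show "AE y in lborel. norm (bump y * \<psi> (a + e n * y)) \<le> B * bump y" for n
      using bump_bounds(1) mult_left_mono[OF \<psi>(2) bump_bounds(1)]
      by (intro AE_I2) (simp add: abs_mult mult.commute)
  qed measurable
  then show "(\<lambda>n. LINT r|lborel. bump ((r - a) / e n) / e n * \<psi> r) \<longlonglongrightarrow> step 1 * \<psi> a"
    unfolding eq by (simp add: bump_integral)
qed

text \<open>The test functions are smooth plateaus that rise just after s and fall just after t.
  Their derivatives concentrate at s and t and produce the point values of \<psi>; the plateaus
  themselves converge boundedly to \<open>step 1\<close> times the indicator of (s,t].\<close>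

lemma weak_derivative_scalar:
  fixes \<psi> \<gamma> :: "real \<Rightarrow> real"
  assumes \<psi>: "continuous_on {0..T} \<psi>" and \<gamma>: "integrable (time_measure T) \<gamma>"
    and weak: "\<And>\<phi>. test_function T \<phi> \<Longrightarrow>
      (LINT t|time_measure T. deriv \<phi> t * \<psi> t) = - (LINT t|time_measure T. \<phi> t * \<gamma> t)"
    and st: "0 < s" "s < t" "t < T"
  shows "\<psi> t - \<psi> s = (LINT r|time_measure T. indicator {s..t} r * \<gamma> r)"
proof -
  \<comment> \<open>The factor (T - t) / 2 keeps the end t + e n of the falling edge inside
    (0,T).\<close>
  define e where "e n = (T - t) / 2 * (1 / real (Suc n))" for n
  have e_pos: "0 < e n" for n using st by (simp add: e_def)
  have "e \<longlonglongrightarrow> (T - t) / 2 * 0"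
    unfolding e_def by (intro tendsto_mult tendsto_const LIMSEQ_Suc[OF lim_1_over_n])
  then have e_0: "e \<longlonglongrightarrow> 0" by simp
  have e_le: "t + e n < T" for n
  proof -
    have "e n \<le> (T - t) / 2 * 1" unfolding e_def by (intro mult_left_mono) (use st in auto)
    then show ?thesis using st by (simp add: field_simps)
  qed
  define \<phi> where "\<phi> n r = step ((r - s) / e n) - step ((r - t) / e n)" for n r
  define \<phi>' where "\<phi>' n r = bump ((r - s) / e n) / e n - bump ((r - t) / e n) / e n" for n r
  have deriv: "(\<phi> n has_real_derivative \<phi>' n r) (at r)" for n r
  proof -
    have "((\<lambda>r. step ((r - a) / e n)) has_real_derivative bump ((r - a) / e n) * (1 / e n)) (at r)" for a
      by (rule DERIV_chain2[OF step_has_derivative]) (use e_pos[of n] in \<open>auto intro!: derivative_eq_intros\<close>)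
    from DERIV_diff[OF this[of s] this[of t]] show ?thesis
      by (simp add: \<phi>_def[abs_def] \<phi>'_def)
  qed
  have smooth: "\<phi>' n \<in> smooth_alg" for n
  proof -
    have "(\<lambda>r. (1 / e n) * bump ((1 / e n) * r + (- s / e n)) + (- 1 / e n) * bump ((1 / e n) * r + (- t / e n))) \<in> smooth_alg"
      by (intro smooth_alg.add smooth_alg.scale smooth_alg.affine bump_smooth)
    then show ?thesis using e_pos[of n] by (simp add: \<phi>'_def[abs_def] diff_divide_distrib)
  qed
  have deriv_eq: "deriv (\<phi> n) = \<phi>' n" for n using deriv by (auto intro: DERIV_imp_deriv)
  have below: "(r - a) / e n \<le> 0" if "r \<le> a" for r a n
    using that e_pos[of n] by (simp add: divide_le_0_iff)
  have above: "1 \<le> (r - a) / e n" if "a + e n \<le> r" for r a n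
    using that e_pos[of n] by (simp add: le_divide_eq)
  have supp: "\<phi> n r = 0" if "r \<notin> {s..t + e n}" for n r
  proof (cases "r < s")
    case True
    then show ?thesis using below[of r s n] below[of r t n] st by (simp add: \<phi>_def step_nonpos)
  next
    case False
    then have "1 \<le> (r - s) / e n" "1 \<le> (r - t) / e n"
      using that above[of s n r] above[of t n r] st by auto
    then show ?thesis by (simp add: \<phi>_def step_ge_1[of "(r - a) / e n" for a])
  qed
  have supp': "\<phi>' n r = 0" if "\<not> (0 < r \<and> r < T)" for n r
  proof (cases "0 < r")
    case False
    then show ?thesis using below[of r s n] below[of r t n] st by (simp add: \<phi>'_def bump_bounds)
  next
    case True
    then show ?thesis using that above[of s n r] above[of t n r] st e_le[of n]
      by (simp add: \<phi>'_def bump_bounds)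
  qed
  have test: "test_function T (\<phi> n)" for n
    unfolding test_function_def
    using antiderivative_smooth[OF smooth deriv] supp[of _ n] st e_le[of n] by blast
  have bump_m: "bump \<in> borel_measurable borel"
    by (rule borel_measurable_continuous_onI[OF continuous_on_bump])
  have step_m: "step \<in> borel_measurable borel"
    by (rule borel_measurable_continuous_onI) (use step_has_derivative DERIV_isCont continuous_at_imp_continuous_on in blast)
  note [measurable] = bump_m step_m
  \<comment> \<open>Continued by constants beyond [0,T], since mollification is stated for bounded
    continuous functions on the line.\<close>
  define \<psi>' where "\<psi>' r = \<psi> (max 0 (min T r))" for r
  have cont: "continuous_on UNIV \<psi>'"
    unfolding \<psi>'_def by (rule continuous_on_compose2[OF \<psi>]) (use st in \<open>auto intro!: continuous_intros\<close>)
  then have [measurable]: "\<psi>' \<in> borel_measurable borel" by (rule borel_measurable_continuous_onI)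
  have "bounded (\<psi> ` {0..T})" by (intro compact_imp_bounded compact_continuous_image \<psi>) simp
  then obtain B where "\<forall>x\<in>\<psi> ` {0..T}. norm x \<le> B" unfolding bounded_iff by blast
  then have B: "\<bar>\<psi> r\<bar> \<le> B" if "r \<in> {0..T}" for r using that by simp
  have B': "\<bar>\<psi>' r\<bar> \<le> B" for r unfolding \<psi>'_def by (rule B) (use st in auto)
  note moll = bump_mollify[OF cont B' e_pos e_0]
  have "(LINT r|time_measure T. \<phi>' n r * \<psi> r)
      = (LINT r|lborel. bump ((r - s) / e n) / e n * \<psi>' r) - (LINT r|lborel. bump ((r - t) / e n) / e n * \<psi>' r)" for n
  proof -
    have [measurable]: "\<phi>' n \<in> borel_measurable borel" unfolding \<phi>'_def by measurable
    have eq: "\<phi>' n r * \<psi>' r = \<phi>' n r * \<psi> r" if "r \<in> space (time_measure T)" for r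
      using that by (simp add: \<psi>'_def)
    have "(\<lambda>r. \<phi>' n r * \<psi>' r) \<in> borel_measurable (time_measure T)"
      by (rule borel_measurable_time) measurable
    then have "(\<lambda>r. \<phi>' n r * \<psi> r) \<in> borel_measurable (time_measure T)"
      by (rule measurable_cong[THEN iffD1, rotated]) (rule eq)
    then have "(LINT r|time_measure T. \<phi>' n r * \<psi> r) = (LINT r|lborel. \<phi>' n r * \<psi>' r)"
    proof (rule time_integral(2))
      show "(\<lambda>r. \<phi>' n r * \<psi>' r) \<in> borel_measurable borel" by measurable
    qed (auto simp: supp' \<psi>'_def)
    also have "\<dots> = (LINT r|lborel. bump ((r - s) / e n) / e n * \<psi>' r - bump ((r - t) / e n) / e n * \<psi>' r)"
      by (simp add: \<phi>'_def left_diff_distrib)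
    also have "\<dots> = (LINT r|lborel. bump ((r - s) / e n) / e n * \<psi>' r) - (LINT r|lborel. bump ((r - t) / e n) / e n * \<psi>' r)"
      by (rule Bochner_Integration.integral_diff[OF moll(1) moll(1)])
    finally show ?thesis .
  qed
  moreover have "(\<lambda>n. (LINT r|lborel. bump ((r - s) / e n) / e n * \<psi>' r) - (LINT r|lborel. bump ((r - t) / e n) / e n * \<psi>' r))
      \<longlonglongrightarrow> step 1 * \<psi>' s - step 1 * \<psi>' t"
    by (intro tendsto_diff moll(2))
  ultimately have "(\<lambda>n. LINT r|time_measure T. \<phi>' n r * \<psi> r) \<longlonglongrightarrow> step 1 * \<psi>' s - step 1 * \<psi>' t"
    by presburger
  then have lhs: "(\<lambda>n. LINT r|time_measure T. \<phi>' n r * \<psi> r) \<longlonglongrightarrow> step 1 * (\<psi> s - \<psi> t)"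
    using st by (simp add: \<psi>'_def right_diff_distrib)
  have \<phi>_bound: "\<bar>\<phi> n r\<bar> \<le> step 1" for n r
    using step_bounds[of "(r - s) / e n"] step_bounds[of "(r - t) / e n"] by (simp add: \<phi>_def abs_le_iff)
  have \<phi>_lim: "(\<lambda>n. \<phi> n r) \<longlonglongrightarrow> step 1 * indicator {s<..t} r" for r
  proof -
    have step_lim: "(\<lambda>n. step ((r - a) / e n)) \<longlonglongrightarrow> (if a < r then step 1 else 0)" for a
    proof (cases "a < r")
      case True
      then have "\<forall>\<^sub>F n in sequentially. e n < r - a" using order_tendstoD(2)[OF e_0] by simp
      then have "\<forall>\<^sub>F n in sequentially. step ((r - a) / e n) = step 1"
        by eventually_elim (rule step_ge_1, use e_pos in \<open>simp add: le_divide_eq less_imp_le\<close>)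
      then show ?thesis using True by (simp add: tendsto_eventually)
    next
      case False
      then have "step ((r - a) / e n) = 0" for n
        using e_pos[of n] by (intro step_nonpos) (simp add: divide_le_0_iff)
      then show ?thesis using False by simp
    qed
    have "(\<lambda>n. \<phi> n r) \<longlonglongrightarrow> (if s < r then step 1 else 0) - (if t < r then step 1 else 0)"
      unfolding \<phi>_def by (intro tendsto_diff step_lim)
    also have "(if s < r then step 1 else 0) - (if t < r then step 1 else 0) = step 1 * indicator {s<..t} r"
      using st by (auto simp: indicator_def)
    finally show ?thesis .
  qed
  have [measurable]: "\<phi> n \<in> borel_measurable (time_measure T)" for n
    by (rule borel_measurable_time) (unfold \<phi>_def, measurable)
  have [measurable]: "\<gamma> \<in> borel_measurable (time_measure T)" using \<gamma> by auto
  have ind: "(indicator S :: real \<Rightarrow> real) \<in> borel_measurable (time_measure T)" if "S \<in> sets borel" for S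
    by (rule borel_measurable_time) (use that in measurable)
  note [measurable] = ind[of "{s<..t}", simplified] ind[of "{s..t}", simplified]
  have "(\<lambda>n. LINT r|time_measure T. \<phi> n r * \<gamma> r) \<longlonglongrightarrow> (LINT r|time_measure T. step 1 * indicator {s<..t} r * \<gamma> r)"
  proof (rule integral_dominated_convergence)
    show "integrable (time_measure T) (\<lambda>r. step 1 * \<bar>\<gamma> r\<bar>)" using \<gamma> by auto
    show "AE r in time_measure T. (\<lambda>n. \<phi> n r * \<gamma> r) \<longlonglongrightarrow> step 1 * indicator {s<..t} r * \<gamma> r"
      by (intro AE_I2 tendsto_mult \<phi>_lim tendsto_const)
    show "AE r in time_measure T. norm (\<phi> n r * \<gamma> r) \<le> step 1 * \<bar>\<gamma> r\<bar>" for n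
      using \<phi>_bound by (auto simp: abs_mult intro!: mult_right_mono)
  qed measurable
  also have "(LINT r|time_measure T. step 1 * indicator {s<..t} r * \<gamma> r)
      = step 1 * (LINT r|time_measure T. indicator {s<..t} r * \<gamma> r)" by (simp add: mult.assoc)
  also have "(LINT r|time_measure T. indicator {s<..t} r * \<gamma> r) = (LINT r|time_measure T. indicator {s..t} r * \<gamma> r)"
  proof (rule integral_cong_AE)
    have "AE r in lborel. r \<noteq> s" by (rule AE_lborel_singleton)
    then have "AE r in time_measure T. r \<noteq> s" unfolding AE_time_measure by eventually_elim simp
    then show "AE r in time_measure T. indicator {s<..t} r * \<gamma> r = indicator {s..t} r * \<gamma> r"
      by eventually_elim (auto simp: indicator_def)
  qed measurable
  finally have rhs: "(\<lambda>n. - (LINT r|time_measure T. \<phi> n r * \<gamma> r))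
      \<longlonglongrightarrow> - (step 1 * (LINT r|time_measure T. indicator {s..t} r * \<gamma> r))" by (rule tendsto_minus)
  have "(LINT r|time_measure T. \<phi>' n r * \<psi> r) = - (LINT r|time_measure T. \<phi> n r * \<gamma> r)" for n
    using weak[OF test[of n]] unfolding deriv_eq .
  from rhs[folded this] have "step 1 * (\<psi> s - \<psi> t) = - (step 1 * (LINT r|time_measure T. indicator {s..t} r * \<gamma> r))"
    by (rule LIMSEQ_unique[OF lhs])
  then have "step 1 * (\<psi> t - \<psi> s) = step 1 * (LINT r|time_measure T. indicator {s..t} r * \<gamma> r)"
    by (simp add: right_diff_distrib)
  then show ?thesis using step_1_pos by simp
qed

section \<open>The energy identity\<close>

lemma to_dual_apply: "to_dual emb v w = emb v \<bullet> emb w"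
  by (simp add: to_dual_def)

lemma test_spaceD:
  assumes "(x, g, xH) \<in> test_space emb T W"
  shows "x \<in> L2 T W" "g \<in> L2 T UNIV" "weak_derivative emb T W x g" "continuous_on {0..T} xH"
    "AE t in time_measure T. xH t = emb (x t)" "xH T = 0"
  using assms by (auto simp: test_space_def)

lemma borel_measurable_apply_L2:
  fixes g :: "real \<Rightarrow> 'v::{real_inner,banach,second_countable_topology} \<Rightarrow>\<^sub>L real"
  assumes "g \<in> borel_measurable M" "x \<in> borel_measurable M"
  shows "(\<lambda>t. g t (x t)) \<in> borel_measurable M"
proof -
  note [measurable] = borel_measurable_riesz[OF assms(1)] assms(2)
  have "(\<lambda>t. x t \<bullet> riesz (g t)) \<in> borel_measurable M" by measurable
  then show ?thesis by (simp add: riesz)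
qed

lemma integrable_apply_L2:
  fixes g :: "real \<Rightarrow> 'v::{real_inner,banach,second_countable_topology} \<Rightarrow>\<^sub>L real"
  assumes "g \<in> L2 T UNIV" "x \<in> L2 T UNIV"
  shows "integrable (time_measure T) (\<lambda>t. g t (x t))"
    and "(LINT t|time_measure T. g t (x t)) = l2_of T x \<bullet> l2_of T (\<lambda>t. riesz (g t))"
  using l2_of_inner[OF assms(2) L2_riesz[OF assms(1)]] by (simp_all add: riesz)

lemma finite_time_measure: "finite_measure (time_measure T)"
proof (rule finite_measureI)
  have "emeasure lborel {0<..<T} \<noteq> \<infinity>" by (cases "0 \<le> T") auto
  then show "emeasure (time_measure T) (space (time_measure T)) \<noteq> \<infinity>"
    by (simp add: emeasure_restrict_space)
qed

lemma L2_const: "(\<lambda>t. w) \<in> L2 T UNIV"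
  using finite_measure.integrable_const[OF finite_time_measure, of T "(norm w)\<^sup>2"] by (simp add: L2_def)

text \<open>The scalar lemma for t -> xH t \<bullet> emb w. Replacing emb (x t) by its continuous
  representative is what gives sense to values at s and t.\<close>

lemma weak_derivative_integral:
  fixes emb :: "'v::{real_inner,banach,second_countable_topology} \<Rightarrow>\<^sub>L 'h::{real_inner,banach,second_countable_topology}"
  assumes X: "(x, g, xH) \<in> test_space emb T W" and w: "w \<in> W" and st: "0 < s" "s < t" "t < T"
  shows "(xH t - xH s) \<bullet> emb w = (LINT r|time_measure T. indicator {s..t} r * g r w)"
proof -
  note x = test_spaceD[OF X]
  note [measurable] = L2D(1)[OF x(1)]
  have cont: "continuous_on {0..T} (\<lambda>r. xH r \<bullet> emb w)" by (intro continuous_intros x(4))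
  have m: "(\<lambda>r. xH r \<bullet> emb w) \<in> borel_measurable (time_measure T)"
    by (rule continuous_imp_measurable_on_sets_lebesgue[OF continuous_on_subset[OF cont]]) auto
  have "xH t \<bullet> emb w - xH s \<bullet> emb w = (LINT r|time_measure T. indicator {s..t} r * g r w)"
  proof (rule weak_derivative_scalar[OF cont integrable_apply_L2(1)[OF x(2) L2_const] _ st])
    fix \<phi> assume \<phi>: "test_function T \<phi>"
    then have "(LINT t|time_measure T. deriv \<phi> t * (emb (x t) \<bullet> emb w)) = - (LINT t|time_measure T. \<phi> t * g t w)"
      using x(3) w by (auto simp: weak_derivative_def to_dual_apply)
    moreover have "(LINT t|time_measure T. deriv \<phi> t * (xH t \<bullet> emb w))
        = (LINT t|time_measure T. deriv \<phi> t * (emb (x t) \<bullet> emb w))"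
    proof (rule integral_cong_AE)
      have "(deriv ^^ 1) \<phi> differentiable (at t)" for t using \<phi> unfolding test_function_def by blast
      then have "continuous_on UNIV (deriv \<phi>)"
        by (intro continuous_at_imp_continuous_on ballI differentiable_imp_continuous_within) simp
      then have [measurable]: "deriv \<phi> \<in> borel_measurable (time_measure T)"
        by (intro borel_measurable_time borel_measurable_continuous_onI)
      have [measurable]: "(\<lambda>t. emb (x t)) \<in> borel_measurable (time_measure T)"
        by (rule borel_measurable_continuous_on[OF _ L2D(1)[OF x(1)]]) (intro continuous_intros)
      note [measurable] = m
      show "(\<lambda>t. deriv \<phi> t * (xH t \<bullet> emb w)) \<in> borel_measurable (time_measure T)" by measurable
      show "(\<lambda>t. deriv \<phi> t * (emb (x t) \<bullet> emb w)) \<in> borel_measurable (time_measure T)" by measurable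
      show "AE t in time_measure T. deriv \<phi> t * (xH t \<bullet> emb w) = deriv \<phi> t * (emb (x t) \<bullet> emb w)"
        using x(5) by eventually_elim simp
    qed
    ultimately show "(LINT t|time_measure T. deriv \<phi> t * (xH t \<bullet> emb w)) = - (LINT t|time_measure T. \<phi> t * g t w)"
      by simp
  qed
  then show ?thesis by (simp add: inner_diff_left)
qed

section \<open>Steklov averages of the pairing\<close>

lift_definition restrict_l2 :: "real \<Rightarrow> real \<Rightarrow> 'v l2 \<Rightarrow> 'v::{real_inner,banach,second_countable_topology} l2"
  is "\<lambda>a b f t. indicator {a..b} t *\<^sub>R f t"
proof -
  fix a b :: real and f h :: "real \<Rightarrow> 'v"
  have *: "sq_integrable (\<lambda>t. indicator {a..b} t *\<^sub>R f t)" if "sq_integrable f" for f :: "real \<Rightarrow> 'v"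
    unfolding sq_integrable_def
  proof
    note [measurable] = sq_integrableD(1)[OF that]
    show "(\<lambda>t. indicator {a..b} t *\<^sub>R f t) \<in> borel_measurable borel" by measurable
    show "integrable lborel (\<lambda>t. (norm (indicator {a..b} t *\<^sub>R f t))\<^sup>2)"
      by (rule Bochner_Integration.integrable_bound[OF sq_integrableD(2)[OF that]])
        (auto simp: indicator_def)
  qed
  assume "l2_rel f h"
  then show "l2_rel (\<lambda>t. indicator {a..b} t *\<^sub>R f t) (\<lambda>t. indicator {a..b} t *\<^sub>R h t)"
    by (auto simp: l2_rel_def intro!: * elim: AE_mp)
qed

lemma restrict_l2_inner: "restrict_l2 a b x \<bullet> y = x \<bullet> restrict_l2 a b y"
  by transfer (simp add: mult.commute)

lemma restrict_l2_idem: "restrict_l2 a b (restrict_l2 a b x) = restrict_l2 a b x"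
proof -
  obtain f where f: "sq_integrable f" "x = abs_l2 f" by (rule l2_cases)
  have "l2_rel f f" using f by (simp add: l2_rel_def)
  moreover have "l2_rel (\<lambda>t. indicator {a..b} t *\<^sub>R f t) (\<lambda>t. indicator {a..b} t *\<^sub>R f t)"
    using restrict_l2.rsp calculation by (auto simp: rel_fun_def)
  moreover have "(\<lambda>t. indicator {a..b} t *\<^sub>R indicator {a..b} t *\<^sub>R f t) = (\<lambda>t. indicator {a..b} t *\<^sub>R f t)"
    by (auto simp: indicator_def)
  ultimately show ?thesis using f by (simp add: restrict_l2.abs_eq)
qed

lemma norm_restrict_l2_le: "norm (restrict_l2 a b x) \<le> norm x"
proof -
  have "(norm (restrict_l2 a b x))\<^sup>2 = x \<bullet> restrict_l2 a b x"
    by (simp add: power2_norm_eq_inner restrict_l2_inner restrict_l2_idem)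
  also have "\<dots> \<le> norm x * norm (restrict_l2 a b x)" by (rule norm_cauchy_schwarz)
  finally show ?thesis
    by (cases "restrict_l2 a b x = 0") (auto simp: power2_eq_square)
qed

text \<open>Fubini for the averaged pairing. The integrand is dominated by |G (t + r)|^2 on the
  first interval plus |w t|^2 on the second, and translation invariance makes the r-integral of the
  former independent of t.\<close>

lemma double_step_integral:
  fixes G w :: "real \<Rightarrow> 'v::{real_inner,banach,second_countable_topology}"
  assumes G: "sq_integrable G" and w: "sq_integrable w"
  shows "integrable lborel (\<lambda>t. indicator {a..b} t * (LINT r|lborel. indicator {0..d} r * (G (t + r) \<bullet> w t)))"
    and "integrable lborel (\<lambda>r. indicator {0..d} r * (LINT t|lborel. indicator {a..b} t * (G (t + r) \<bullet> w t)))"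
    and "(LINT t|lborel. indicator {a..b} t * (LINT r|lborel. indicator {0..d} r * (G (t + r) \<bullet> w t)))
      = (LINT r|lborel. indicator {0..d} r * (LINT t|lborel. indicator {a..b} t * (G (t + r) \<bullet> w t)))"
proof -
  note [measurable] = sq_integrableD(1)[OF G] sq_integrableD(1)[OF w]
  let ?F = "\<lambda>t r. indicator {a..b} t * (indicator {0..d} r * (G (t + r) \<bullet> w t)) :: real"
  have [measurable]: "case_prod ?F \<in> borel_measurable (lborel \<Otimes>\<^sub>M lborel)" by measurable
  have shift: "(\<integral>\<^sup>+r. ennreal ((norm (G (t + r)))\<^sup>2) \<partial>lborel) = ennreal ((norm (abs_l2 G))\<^sup>2)" for t
    using nn_integral_l2[OF sq_integrable_shift[OF G, of t]] norm_shift_l2[of t "abs_l2 G"]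
    by (simp add: shift_l2_abs G add.commute)
  have "(\<integral>\<^sup>+z. ennreal (norm (case_prod ?F z)) \<partial>(lborel \<Otimes>\<^sub>M lborel)) = (\<integral>\<^sup>+t. \<integral>\<^sup>+r. ennreal (norm (?F t r)) \<partial>lborel \<partial>lborel)"
    by (subst lborel.nn_integral_fst[symmetric]) auto
  also have "\<dots> \<le> (\<integral>\<^sup>+t. indicator {a..b} t * ennreal ((norm (abs_l2 G))\<^sup>2) + ennreal \<bar>d\<bar> * ennreal ((norm (w t))\<^sup>2) \<partial>lborel)"
  proof (rule nn_integral_mono)
    fix t
    have "(\<integral>\<^sup>+r. ennreal (norm (?F t r)) \<partial>lborel)
        \<le> (\<integral>\<^sup>+r. indicator {a..b} t * ennreal ((norm (G (t + r)))\<^sup>2) + indicator {0..d} r * ennreal ((norm (w t))\<^sup>2) \<partial>lborel)"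
    proof (rule nn_integral_mono)
      fix r
      show "ennreal (norm (?F t r)) \<le> indicator {a..b} t * ennreal ((norm (G (t + r)))\<^sup>2) + indicator {0..d} r * ennreal ((norm (w t))\<^sup>2)"
        using abs_inner_le_sq[of "G (t + r)" "w t"]
        by (auto simp: indicator_def ennreal_plus[symmetric] abs_mult simp del: ennreal_plus intro!: ennreal_leI)
    qed
    also have "\<dots> = indicator {a..b} t * ennreal ((norm (abs_l2 G))\<^sup>2) + (\<integral>\<^sup>+r. indicator {0..d} r * ennreal ((norm (w t))\<^sup>2) \<partial>lborel)"
      by (subst nn_integral_add) (auto simp: nn_integral_cmult shift)
    also have "(\<integral>\<^sup>+r. indicator {0..d} r * ennreal ((norm (w t))\<^sup>2) \<partial>lborel) \<le> ennreal \<bar>d\<bar> * ennreal ((norm (w t))\<^sup>2)"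
      by (subst nn_integral_multc) (auto simp: emeasure_lborel_Icc_eq intro!: mult_right_mono ennreal_leI)
    finally show "(\<integral>\<^sup>+r. ennreal (norm (?F t r)) \<partial>lborel)
        \<le> indicator {a..b} t * ennreal ((norm (abs_l2 G))\<^sup>2) + ennreal \<bar>d\<bar> * ennreal ((norm (w t))\<^sup>2)"
      by (simp add: add_left_mono)
  qed
  also have "\<dots> = emeasure lborel {a..b} * ennreal ((norm (abs_l2 G))\<^sup>2) + ennreal \<bar>d\<bar> * ennreal ((norm (abs_l2 w))\<^sup>2)"
    by (subst nn_integral_add) (auto simp: nn_integral_cmult nn_integral_multc nn_integral_l2[OF w])
  also have "\<dots> < \<infinity>" by (auto simp: emeasure_lborel_Icc_eq ennreal_mult_less_top)
  finally have int: "integrable (lborel \<Otimes>\<^sub>M lborel) (case_prod ?F)"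
    by (intro integrableI_bounded) auto
  have 1: "(LINT r|lborel. ?F t r) = indicator {a..b} t * (LINT r|lborel. indicator {0..d} r * (G (t + r) \<bullet> w t))" for t
    by simp
  have 2: "(LINT t|lborel. ?F t r) = indicator {0..d} r * (LINT t|lborel. indicator {a..b} t * (G (t + r) \<bullet> w t))" for r
    by (simp add: mult.left_commute flip: integral_mult_right_zero)
  show "integrable lborel (\<lambda>t. indicator {a..b} t * (LINT r|lborel. indicator {0..d} r * (G (t + r) \<bullet> w t)))"
    using lborel_pair.integrable_fst'[OF int] by (simp add: 1)
  show "integrable lborel (\<lambda>r. indicator {0..d} r * (LINT t|lborel. indicator {a..b} t * (G (t + r) \<bullet> w t)))"
    using lborel_pair.integrable_snd[OF int] by (simp add: 2)
  show "(LINT t|lborel. indicator {a..b} t * (LINT r|lborel. indicator {0..d} r * (G (t + r) \<bullet> w t)))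
      = (LINT r|lborel. indicator {0..d} r * (LINT t|lborel. indicator {a..b} t * (G (t + r) \<bullet> w t)))"
    using lborel_pair.Fubini_integral[OF int] by (simp only: 1 2)
qed

lemma shift_l2_0: "shift_l2 0 x = x"
  by transfer (simp add: l2_rel_def)

text \<open>After the integrals are exchanged, the inner one is an inner product of translates of G
  and x by at most d, with limit twice the pairing because x (t + d) + x t tends to 2 x t. Dividing
  by d averages it over r in [0,d].\<close>

lemma steklov_limit:
  fixes G x :: "real \<Rightarrow> 'v::{real_inner,banach,second_countable_topology}"
  assumes G: "sq_integrable G" and x: "sq_integrable x"
  shows "((\<lambda>d. (LINT t|lborel. indicator {a..b} t *
      (LINT r|lborel. indicator {0..d} r * (G (t + r) \<bullet> (x (t + d) + x t)))) / d)
    \<longlongrightarrow> 2 * (LINT t|lborel. indicator {a..b} t * (G t \<bullet> x t))) (at_right 0)"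
proof -
  define X \<Gamma> where "X = abs_l2 x" and "\<Gamma> = abs_l2 G"
  define R :: "'v l2 \<Rightarrow> 'v l2" where "R = restrict_l2 a b"
  define w where "w d t = x (t + d) + x t" for d t
  define K where "K d r = (LINT t|lborel. indicator {a..b} t * (G (t + r) \<bullet> w d t))" for d r
  define K0 where "K0 = (LINT t|lborel. indicator {a..b} t * (G t \<bullet> x t))"
  have w: "sq_integrable (w d)" for d
    unfolding w_def by (intro sq_integrable_add sq_integrable_shift x)
  have wd: "abs_l2 (w d) = shift_l2 d X + X" for d
    unfolding w_def X_def using x
    by (simp add: shift_l2_abs plus_l2.abs_eq l2_rel_def sq_integrable_shift)
  have inner_R: "R (abs_l2 f) \<bullet> abs_l2 h = (LINT t|lborel. indicator {a..b} t * (f t \<bullet> h t))"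
    if "sq_integrable f" "sq_integrable h" for f h
    using that restrict_l2.rsp[THEN rel_funD, THEN rel_funD, THEN rel_funD, OF refl refl, of f f a b]
    by (simp add: R_def restrict_l2.abs_eq inner_l2.abs_eq l2_rel_def)
  have K: "K d r = R (shift_l2 r \<Gamma>) \<bullet> (shift_l2 d X + X)" for d r
    unfolding K_def \<Gamma>_def wd[symmetric] shift_l2_abs[OF G]
    by (rule inner_R[symmetric]) (auto intro: sq_integrable_shift G w)
  have K0: "K0 = R \<Gamma> \<bullet> X" unfolding K0_def \<Gamma>_def X_def by (rule inner_R[symmetric, OF G x])
  have R_le: "\<bar>R u \<bullet> v\<bar> \<le> norm u * norm v" for u v
    using Cauchy_Schwarz_ineq2[of "R u" v]
      mult_right_mono[OF norm_restrict_l2_le[of a b u] norm_ge_zero[of v]]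
    by (simp add: R_def)
  have R_sym: "R u \<bullet> v = u \<bullet> R v" for u v unfolding R_def by (rule restrict_l2_inner)
  have R_diff: "R (u - v) \<bullet> z = R u \<bullet> z - R v \<bullet> z" for u v z by (simp add: R_sym inner_diff_left)
  have K_close: "\<bar>K d r - 2 * K0\<bar> \<le> norm (shift_l2 r \<Gamma> - \<Gamma>) * (2 * norm X) + norm \<Gamma> * norm (shift_l2 d X - X)" for d r
  proof -
    have "K d r - 2 * K0 = R (shift_l2 r \<Gamma> - \<Gamma>) \<bullet> (shift_l2 d X + X) + R \<Gamma> \<bullet> (shift_l2 d X - X)"
      unfolding K K0 by (simp add: R_diff inner_simps)
    also have "\<bar>\<dots>\<bar> \<le> norm (shift_l2 r \<Gamma> - \<Gamma>) * norm (shift_l2 d X + X) + norm \<Gamma> * norm (shift_l2 d X - X)"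
      using R_le[of "shift_l2 r \<Gamma> - \<Gamma>" "shift_l2 d X + X"] R_le[of \<Gamma> "shift_l2 d X - X"] by linarith
    also have "norm (shift_l2 d X + X) \<le> 2 * norm X"
      using norm_triangle_ineq[of "shift_l2 d X" X] by (simp add: norm_shift_l2)
    finally show ?thesis by (simp add: mult_left_mono)
  qed
  let ?I = "\<lambda>d. LINT t|lborel. indicator {a..b} t * (LINT r|lborel. indicator {0..d} r * (G (t + r) \<bullet> w d t))"
  have "((\<lambda>d. ?I d / d) \<longlongrightarrow> 2 * K0) (at_right 0)"
  proof (rule tendstoI)
    fix e :: real assume e: "e > 0"
    have "((\<lambda>s. norm (shift_l2 s \<Gamma> - \<Gamma>) * (2 * norm X)) \<longlongrightarrow> norm (\<Gamma> - \<Gamma>) * (2 * norm X)) (at 0)"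
      by (intro tendsto_intros shift_l2_tendsto)
    then have "\<forall>\<^sub>F s in at 0. norm (shift_l2 s \<Gamma> - \<Gamma>) * (2 * norm X) < e / 4"
      using e by (intro order_tendstoD(2)) auto
    moreover have "((\<lambda>s. norm \<Gamma> * norm (shift_l2 s X - X)) \<longlongrightarrow> norm \<Gamma> * norm (X - X)) (at 0)"
      by (intro tendsto_intros shift_l2_tendsto)
    then have "\<forall>\<^sub>F s in at 0. norm \<Gamma> * norm (shift_l2 s X - X) < e / 4"
      using e by (intro order_tendstoD(2)) auto
    ultimately have "\<forall>\<^sub>F s in at 0. norm (shift_l2 s \<Gamma> - \<Gamma>) * (2 * norm X) < e / 4 \<and> norm \<Gamma> * norm (shift_l2 s X - X) < e / 4"
      by eventually_elim simp
    then obtain \<eta> where \<eta>: "\<eta> > 0" "\<And>s. s \<noteq> 0 \<Longrightarrow> \<bar>s\<bar> < \<eta> \<Longrightarrow>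
        norm (shift_l2 s \<Gamma> - \<Gamma>) * (2 * norm X) < e / 4 \<and> norm \<Gamma> * norm (shift_l2 s X - X) < e / 4"
      by (auto simp: eventually_at dist_real_def)
    show "\<forall>\<^sub>F d in at_right 0. dist (?I d / d) (2 * K0) < e"
      unfolding eventually_at_right_field
    proof (intro exI[of _ \<eta>] conjI allI impI \<eta>(1))
      fix d :: real assume d: "0 < d" "d < \<eta>"
      \<comment> \<open>Uniform in r, because both translations involved, by r and by d, are shorter
        than \<eta>.\<close>
      have close: "\<bar>K d r - 2 * K0\<bar> \<le> e / 2" if "r \<in> {0..d}" for r
      proof -
        have "norm (shift_l2 r \<Gamma> - \<Gamma>) * (2 * norm X) \<le> e / 4"
          using \<eta>(2)[of r] that d e by (cases "r = 0") (auto simp: shift_l2_0)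
        then show ?thesis using K_close[of d r] \<eta>(2)[of d] d by simp
      qed
      have int1: "integrable lborel (\<lambda>r. indicator {0..d} r * K d r)"
        unfolding K_def by (rule double_step_integral(2)[OF G w])
      have int2: "integrable lborel (\<lambda>r. indicator {0..d} r * (2 * K0))"
        by (intro integrable_mult_left integrable_indicator_Icc)
      have "?I d = (LINT r|lborel. indicator {0..d} r * K d r)"
        unfolding K_def by (rule double_step_integral(3)[OF G w])
      moreover have "d * (2 * K0) = (LINT r|lborel. indicator {0..d} r * (2 * K0))"
        using d by simp
      ultimately have "?I d - d * (2 * K0) = (LINT r|lborel. indicator {0..d} r * (K d r - 2 * K0))"
        using Bochner_Integration.integral_diff[OF int1 int2] by (simp add: right_diff_distrib)
      also have "\<bar>\<dots>\<bar> \<le> (LINT r|lborel. indicator {0..d} r * (e / 2))"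
      proof (rule integral_abs_bound_integral)
        show "integrable lborel (\<lambda>r. indicator {0..d} r * (K d r - 2 * K0))"
          using Bochner_Integration.integrable_diff[OF int1 int2] by (simp add: right_diff_distrib)
        show "integrable lborel (\<lambda>r. indicator {0..d} r * (e / 2))"
          by (intro integrable_mult_left integrable_indicator_Icc)
        show "\<bar>indicator {0..d} r * (K d r - 2 * K0)\<bar> \<le> indicator {0..d} r * (e / 2)" for r
          using close[of r] by (cases "r \<in> {0..d}") (simp_all del: atLeastAtMost_iff)
      qed
      also have "\<dots> = d * (e / 2)" using d by simp
      finally have "\<bar>?I d - d * (2 * K0)\<bar> \<le> d * (e / 2)" .
      then have "\<bar>?I d / d - 2 * K0\<bar> \<le> e / 2" using d by (simp add: field_simps abs_le_iff)
      then show "dist (?I d / d) (2 * K0) < e" using e by (simp add: dist_real_def)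
    qed
  qed
  then show ?thesis by (simp add: w_def K0_def)
qed

text \<open>xH need not be differentiable in H. Instead, the increment of |xH|^2 over a step d
  equals (xH (t + d) - xH t) \<bullet> emb (x' (t + d) + x' t), where for almost every t the sum
  lies in W and may be tested against the weak derivative. Integrating over t in [a,b], dividing by
  d and letting d tend to 0 gives the two sides of the identity.\<close>

lemma energy_identity_interior:
  fixes emb :: "'v::{real_inner,banach,second_countable_topology} \<Rightarrow>\<^sub>L 'h::{real_inner,banach,second_countable_topology}"
  assumes X: "(x, g, xH) \<in> test_space emb T W" and W: "subspace W" and ab: "0 < a" "a < b" "b < T"
    and G: "sq_integrable G" "AE t in lborel. G t = (if 0 < t \<and> t < T then riesz (g t) else 0)"
    and x': "sq_integrable x'" "AE t in lborel. x' t = (if 0 < t \<and> t < T then x t else 0)"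
  shows "(norm (xH b))\<^sup>2 - (norm (xH a))\<^sup>2 = 2 * (LINT t|lborel. indicator {a..b} t * (G t \<bullet> x' t))"
proof -
  note x = test_spaceD[OF X]
  note [measurable] = sq_integrableD(1)[OF G(1)] sq_integrableD(1)[OF x'(1)]
  define q where "q t = (norm (xH t))\<^sup>2" for t
  \<comment> \<open>The integral of q (t + d) - q t over [a,b] is the increment of Q over [b, b + d]
    minus that over [a, a + d]; divided by d they tend to q b and q a.\<close>
  define Q where "Q t = integral {0..t} q" for t
  have q_cont: "continuous_on {0..T} q" unfolding q_def by (intro continuous_intros x(4))
  have Q_deriv: "(Q has_real_derivative q t) (at t)" if "0 < t" "t < T" for t
  proof -
    have "(Q has_real_derivative q t) (at t within {0..T})"
      unfolding Q_def by (rule integral_has_real_derivative[OF q_cont]) (use that in auto)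
    moreover have "at t within {0..T} = at t" by (rule at_within_interior) (use that in auto)
    ultimately show ?thesis by simp
  qed
  let ?J = "\<lambda>d t. LINT r|lborel. indicator {0..d} r * (G (t + r) \<bullet> (x' (t + d) + x' t))"
  have J: "(LINT t|lborel. indicator {a..b} t * ?J d t) = (Q (b + d) - Q b) - (Q (a + d) - Q a)"
    if d: "0 < d" "b + d < T" for d
  proof -
    have "AE t in lborel. 0 < t \<and> t < T \<longrightarrow> xH t = emb (x t)" using x(5) by (simp add: AE_time_measure)
    moreover have "AE t in lborel. 0 < t \<and> t < T \<longrightarrow> x t \<in> W" using L2D(3)[OF x(1)] by (simp add: AE_time_measure)
    ultimately have good: "AE t in lborel. 0 < t \<and> t < T \<longrightarrow> xH t = emb (x' t) \<and> x' t \<in> W"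
      using x'(2) by eventually_elim simp
    have eq: "AE t in lborel. indicator {a..b} t * ?J d t = indicator {a..b} t * (q (t + d) - q t)"
      using good AE_lborel_shift[OF good, of d]
    proof eventually_elim
      fix t
      assume t: "0 < t \<and> t < T \<longrightarrow> xH t = emb (x' t) \<and> x' t \<in> W"
        and td: "0 < t + d \<and> t + d < T \<longrightarrow> xH (t + d) = emb (x' (t + d)) \<and> x' (t + d) \<in> W"
      show "indicator {a..b} t * ?J d t = indicator {a..b} t * (q (t + d) - q t)"
      proof (cases "t \<in> {a..b}")
        case True
        then have t0: "0 < t" "t < T" "t + d < T" using ab d by auto
        let ?w = "x' (t + d) + x' t"
        have wW: "?w \<in> W" using t td t0 d by (intro subspace_add[OF W]) auto
        have "q (t + d) - q t = (xH (t + d) - xH t) \<bullet> emb ?w"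
          using t td t0 d by (simp add: q_def power2_norm_eq_inner blinfun.add_right inner_simps inner_commute)
        also have "\<dots> = (LINT r|time_measure T. indicator {t..t + d} r * g r ?w)"
          using weak_derivative_integral[OF X wW t0(1) _ t0(3)] d by simp
        also have "\<dots> = (LINT r|lborel. indicator {t..t + d} r * (G r \<bullet> ?w))"
        proof (rule time_integral(2))
          have "(\<lambda>r. g r ?w) \<in> borel_measurable (time_measure T)"
            using borel_measurable_apply_L2[OF L2D(1)[OF x(2)], of "\<lambda>_. ?w"] by simp
          moreover have "(indicator {t..t + d} :: real \<Rightarrow> real) \<in> borel_measurable (time_measure T)"
            by (rule borel_measurable_time) measurable
          ultimately show "(\<lambda>r. indicator {t..t + d} r * g r ?w) \<in> borel_measurable (time_measure T)"
            by (rule borel_measurable_times[rotated])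
          show "(\<lambda>r. indicator {t..t + d} r * (G r \<bullet> ?w)) \<in> borel_measurable borel" by measurable
          show "AE r in lborel. indicator {t..t + d} r * (G r \<bullet> ?w)
              = (if 0 < r \<and> r < T then indicator {t..t + d} r * g r ?w else 0)"
            using G(2) by eventually_elim (auto simp: inner_commute[of "riesz _"] riesz)
        qed
        also have "\<dots> = (LINT r|lborel. indicator {t..t + d} (t + r) * (G (t + r) \<bullet> ?w))"
          using lborel_integral_real_affine[of 1 "\<lambda>r. indicator {t..t + d} r * (G r \<bullet> ?w)" t] by simp
        also have "\<dots> = ?J d t"
          by (intro Bochner_Integration.integral_cong) (auto simp: indicator_def)
        finally show ?thesis by simp
      qed simp
    qed
    have cont: "continuous_on {a..b} (\<lambda>t. q (t + d) - q t)"
      by (intro continuous_intros continuous_on_compose2[OF q_cont]) (use ab d in auto)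
    have "(LINT t|lborel. indicator {a..b} t * ?J d t) = (LINT t|lborel. indicator {a..b} t * (q (t + d) - q t))"
    proof (rule integral_cong_AE[OF _ _ eq])
      show "(\<lambda>t. indicator {a..b} t * ?J d t) \<in> borel_measurable lborel"
        using double_step_integral(1)[OF G(1) sq_integrable_add[OF sq_integrable_shift[OF x'(1)] x'(1)]] by blast
      show "(\<lambda>t. indicator {a..b} t * (q (t + d) - q t)) \<in> borel_measurable lborel"
        using borel_integrable_atLeastAtMost'[OF cont] by (auto simp: set_integrable_def)
    qed
    also have "\<dots> = (Q (b + d) - Q b) - (Q (a + d) - Q a)"
    proof -
      have "(LINT t|lborel. indicator {a..b} t *\<^sub>R (q (t + d) - q t)) = (Q (b + d) - Q b) - (Q (a + d) - Q a)"
      proof (rule integral_FTC_atLeastAtMost[OF _ _ cont])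
        fix t assume t: "a \<le> t" "t \<le> b"
        have "((\<lambda>t. Q (t + d) - Q t) has_real_derivative q (t + d) - q t) (at t)"
          by (intro DERIV_diff Q_deriv) (use t ab d in \<open>auto intro!: DERIV_shift[THEN iffD1] Q_deriv\<close>)
        then show "((\<lambda>t. Q (t + d) - Q t) has_vector_derivative q (t + d) - q t) (at t within {a..b})"
          using has_real_derivative_iff_has_vector_derivative has_vector_derivative_at_within by blast
      qed (use ab in auto)
      then show ?thesis by simp
    qed
    finally show ?thesis .
  qed
  have "((\<lambda>d. (Q (b + d) - Q b) / d - (Q (a + d) - Q a) / d) \<longlongrightarrow> q b - q a) (at_right 0)"
  proof (rule tendsto_diff)
    show "((\<lambda>d. (Q (b + d) - Q b) / d) \<longlongrightarrow> q b) (at_right 0)"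
      using Q_deriv[of b] ab by (auto simp: DERIV_def intro: filterlim_mono[OF _ order_refl at_le])
    show "((\<lambda>d. (Q (a + d) - Q a) / d) \<longlongrightarrow> q a) (at_right 0)"
      using Q_deriv[of a] ab by (auto simp: DERIV_def intro: filterlim_mono[OF _ order_refl at_le])
  qed
  then have "((\<lambda>d. (LINT t|lborel. indicator {a..b} t * ?J d t) / d) \<longlongrightarrow> q b - q a) (at_right 0)"
  proof (rule Lim_transform_eventually)
    show "\<forall>\<^sub>F d in at_right 0. (Q (b + d) - Q b) / d - (Q (a + d) - Q a) / d = (LINT t|lborel. indicator {a..b} t * ?J d t) / d"
      unfolding eventually_at_right_field
      by (intro exI[of _ "T - b"]) (use ab J in \<open>auto simp: diff_divide_distrib\<close>)
  qed
  from tendsto_unique[OF _ this steklov_limit[OF G(1) x'(1)]]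
  show ?thesis by (simp add: q_def)
qed

text \<open>|xH t|^2 minus twice the integrated pairing up to t is continuous on [0,T] and constant
  on the open interval, hence constant up to both endpoints.\<close>

lemma energy_identity:
  fixes emb :: "'v::{real_inner,banach,second_countable_topology} \<Rightarrow>\<^sub>L 'h::{real_inner,banach,second_countable_topology}"
  assumes X: "(x, g, xH) \<in> test_space emb T W" and W: "subspace W" and T: "0 < T"
    and ab: "0 \<le> a" "a \<le> b" "b \<le> T"
  shows "(norm (xH b))\<^sup>2 - (norm (xH a))\<^sup>2 = 2 * (LINT t|time_measure T. indicator {a..b} t * g t (x t))"
proof -
  note x = test_spaceD[OF X]
  obtain G where G: "sq_integrable G" "AE t in lborel. G t = (if 0 < t \<and> t < T then riesz (g t) else 0)"
    by (rule l2_of_rep[OF L2_riesz[OF x(2)]])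
  obtain x' where x': "sq_integrable x'" "AE t in lborel. x' t = (if 0 < t \<and> t < T then x t else 0)"
    by (rule l2_of_rep[OF x(1)])
  note [measurable] = sq_integrableD(1)[OF G(1)] sq_integrableD(1)[OF x'(1)]
  define h where "h t = G t \<bullet> x' t" for t
  have h: "integrable lborel h" unfolding h_def by (rule integrable_inner[OF G(1) x'(1)])
  have hset: "set_integrable lborel {u..v} h" for u v
    unfolding set_integrable_def by (rule integrable_mult_indicator[OF _ h]) auto
  have hint: "h integrable_on {u..v}" for u v by (rule set_borel_integral_eq_integral(1)[OF hset])
  have hI: "(LINT t|lborel. indicator {u..v} t * h t) = integral {u..v} h" for u v
    using set_borel_integral_eq_integral(2)[OF hset] by (simp add: set_lebesgue_integral_def)
  define D where "D t = (norm (xH t))\<^sup>2 - 2 * integral {0..t} h" for t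
  have D_cont: "continuous_on {0..T} D"
    unfolding D_def by (intro continuous_intros x(4) indefinite_integral_continuous_1 hint)
  have combine: "integral {0..u} h + integral {u..v} h = integral {0..v} h" if "0 \<le> u" "u \<le> v" for u v
    by (rule Henstock_Kurzweil_Integration.integral_combine[OF that hint])
  have D_less: "D u = D v" if "0 < u" "u < v" "v < T" for u v
    using energy_identity_interior[OF X W that G x'] combine[of u v] that hI[of u v] by (simp add: D_def h_def)
  have D_int: "D u = D (T / 2)" if "u \<in> {0<..<T}" for u
  proof -
    consider "u < T / 2" | "u = T / 2" | "T / 2 < u" by linarith
    then show ?thesis
    proof cases
      case 1
      show ?thesis by (rule D_less) (use 1 that T in auto)
    next
      case 2
      then show ?thesis by (simp only:)
    next
      case 3
      show ?thesis by (rule D_less[symmetric]) (use 3 that T in auto)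
    qed
  qed
  have D_const: "D u = D (T / 2)" if "u \<in> {0..T}" for u
  proof -
    have cl: "closure {0<..<T} = {0..T}" using T by simp
    show ?thesis
      by (rule continuous_constant_on_closure[of "{0<..<T}" D "D (T / 2)" u, unfolded cl, OF D_cont D_int that])
  qed
  have "D b = D a" using D_const[of a] D_const[of b] ab by simp
  then have "(norm (xH b))\<^sup>2 - (norm (xH a))\<^sup>2 = 2 * integral {a..b} h"
    using combine[of a b] ab by (simp add: D_def)
  also have "integral {a..b} h = (LINT t|time_measure T. indicator {a..b} t * g t (x t))"
    unfolding hI[symmetric]
  proof (rule time_integral(2)[symmetric])
    have "(indicator {a..b} :: real \<Rightarrow> real) \<in> borel_measurable (time_measure T)"
      by (rule borel_measurable_time) measurable
    then show "(\<lambda>t. indicator {a..b} t * g t (x t)) \<in> borel_measurable (time_measure T)"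
      by (rule borel_measurable_times) (rule borel_measurable_apply_L2[OF L2D(1)[OF x(2)] L2D(1)[OF x(1)]])
    show "(\<lambda>t. indicator {a..b} t * h t) \<in> borel_measurable borel" unfolding h_def by measurable
    show "AE t in lborel. indicator {a..b} t * h t = (if 0 < t \<and> t < T then indicator {a..b} t * g t (x t) else 0)"
      using G(2) x'(2) by eventually_elim (auto simp: h_def inner_commute[of "riesz _"] riesz)
  qed
  finally show ?thesis .
qed

lemma test_space_energy:
  fixes emb :: "'v::{real_inner,banach,second_countable_topology} \<Rightarrow>\<^sub>L 'h::{real_inner,banach,second_countable_topology}"
  assumes X: "(x, g, xH) \<in> test_space emb T W" and W: "subspace W" and T: "0 < T"
  shows "- (LINT t|time_measure T. g t (x t)) = (norm (xH 0))\<^sup>2 / 2"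
proof -
  have "(LINT t|time_measure T. indicator {0..T} t * g t (x t)) = (LINT t|time_measure T. g t (x t))"
    by (rule Bochner_Integration.integral_cong) auto
  then show ?thesis
    using energy_identity[OF X W T, of 0 T] test_spaceD(6)[OF X] T by simp
qed

section \<open>Integrability exponents\<close>

text \<open>The norm part of \<open>in_Lp\<close>, separated from strong measurability so that it
  can be estimated for real functions on the probability space. It is meant for nonnegative
  X.\<close>

definition Lp_bounded :: "'w measure \<Rightarrow> ennreal \<Rightarrow> ('w \<Rightarrow> real) \<Rightarrow> bool" where
  "Lp_bounded M p X \<longleftrightarrow> (if p = \<infinity> then \<exists>C. AE \<omega> in M. X \<omega> \<le> C
     else (\<integral>\<^sup>+\<omega>. ennreal (X \<omega> powr enn2real p) \<partial>M) < \<infinity>)"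

lemma Lp_bounded_mono:
  assumes Y: "Lp_bounded M p Y" and X: "AE \<omega> in M. 0 \<le> X \<omega> \<and> X \<omega> \<le> Y \<omega>"
  shows "Lp_bounded M p X"
proof (cases "p = \<infinity>")
  case True
  then obtain C where "AE \<omega> in M. Y \<omega> \<le> C" using Y by (auto simp: Lp_bounded_def)
  then have "AE \<omega> in M. X \<omega> \<le> C" using X by eventually_elim simp
  then show ?thesis using True by (auto simp: Lp_bounded_def)
next
  case False
  have "(\<integral>\<^sup>+\<omega>. ennreal (X \<omega> powr enn2real p) \<partial>M) \<le> (\<integral>\<^sup>+\<omega>. ennreal (Y \<omega> powr enn2real p) \<partial>M)"
    by (rule nn_integral_mono_AE, use X in eventually_elim) (auto intro!: ennreal_leI powr_mono2)
  with False Y show ?thesis by (auto simp: Lp_bounded_def)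
qed

lemma Lp_bounded_cmult:
  assumes "Lp_bounded M p X" "0 \<le> c" "\<And>\<omega>. 0 \<le> X \<omega>" and [measurable]: "X \<in> borel_measurable M"
  shows "Lp_bounded M p (\<lambda>\<omega>. c * X \<omega>)"
proof (cases "p = \<infinity>")
  case True
  then obtain C where "AE \<omega> in M. X \<omega> \<le> C" using assms by (auto simp: Lp_bounded_def)
  then have "AE \<omega> in M. c * X \<omega> \<le> c * C" by eventually_elim (rule mult_left_mono[OF _ assms(2)])
  then show ?thesis using True by (auto simp: Lp_bounded_def)
next
  case False
  have "(\<integral>\<^sup>+\<omega>. ennreal ((c * X \<omega>) powr enn2real p) \<partial>M)
      = ennreal (c powr enn2real p) * (\<integral>\<^sup>+\<omega>. ennreal (X \<omega> powr enn2real p) \<partial>M)"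
    using assms(2,3) by (subst nn_integral_cmult[symmetric]) (auto simp: powr_mult ennreal_mult)
  with False assms(1) show ?thesis by (simp add: Lp_bounded_def ennreal_mult_less_top)
qed

lemma Lp_bounded_add:
  assumes X: "Lp_bounded M p X" and Y: "Lp_bounded M p Y"
    and nonneg: "\<And>\<omega>. 0 \<le> X \<omega>" "\<And>\<omega>. 0 \<le> Y \<omega>"
    and m: "X \<in> borel_measurable M" "Y \<in> borel_measurable M"
  shows "Lp_bounded M p (\<lambda>\<omega>. X \<omega> + Y \<omega>)"
proof (cases "p = \<infinity>")
  case True
  then obtain C D where "AE \<omega> in M. X \<omega> \<le> C" "AE \<omega> in M. Y \<omega> \<le> D"
    using X Y by (auto simp: Lp_bounded_def)
  then have "AE \<omega> in M. X \<omega> + Y \<omega> \<le> C + D" by eventually_elim simp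
  then show ?thesis using True by (auto simp: Lp_bounded_def)
next
  case False
  note [measurable] = m
  let ?r = "enn2real p"
  have X2: "Lp_bounded M p (\<lambda>\<omega>. 2 * X \<omega>)" and Y2: "Lp_bounded M p (\<lambda>\<omega>. 2 * Y \<omega>)"
    by (intro Lp_bounded_cmult X Y nonneg m; simp)+
  \<comment> \<open>A sum is at most twice its larger term. This works for every exponent and avoids
    the triangle inequality of the p-norm.\<close>
  have le: "(X \<omega> + Y \<omega>) powr ?r \<le> (2 * X \<omega>) powr ?r + (2 * Y \<omega>) powr ?r" for \<omega>
  proof (cases "X \<omega> \<le> Y \<omega>")
    case True
    then have "(X \<omega> + Y \<omega>) powr ?r \<le> (2 * Y \<omega>) powr ?r" by (intro powr_mono2) (use nonneg in auto)
    then show ?thesis using powr_ge_zero[of "2 * X \<omega>" ?r] by linarith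
  next
    case False
    then have "(X \<omega> + Y \<omega>) powr ?r \<le> (2 * X \<omega>) powr ?r" by (intro powr_mono2) (use nonneg in auto)
    then show ?thesis using powr_ge_zero[of "2 * Y \<omega>" ?r] by linarith
  qed
  have "(\<integral>\<^sup>+\<omega>. ennreal ((X \<omega> + Y \<omega>) powr ?r) \<partial>M)
      \<le> (\<integral>\<^sup>+\<omega>. ennreal ((2 * X \<omega>) powr ?r) + ennreal ((2 * Y \<omega>) powr ?r) \<partial>M)"
    using le by (intro nn_integral_mono) (simp add: ennreal_leI flip: ennreal_plus)
  also have "\<dots> = (\<integral>\<^sup>+\<omega>. ennreal ((2 * X \<omega>) powr ?r) \<partial>M) + (\<integral>\<^sup>+\<omega>. ennreal ((2 * Y \<omega>) powr ?r) \<partial>M)"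
    by (rule nn_integral_add) auto
  also have "\<dots> < \<infinity>" using False X2 Y2 by (simp add: Lp_bounded_def)
  finally show ?thesis using False by (simp add: Lp_bounded_def)
qed

lemma powr_le_one_plus:
  fixes y :: real
  assumes "0 \<le> y" "0 \<le> r" "r \<le> s"
  shows "y powr r \<le> 1 + y powr s"
proof (cases "y \<le> 1")
  case True
  then have "y powr r \<le> 1" using assms by (intro powr_le1) auto
  then show ?thesis using powr_ge_zero[of y s] by linarith
next
  case False
  then have "y powr r \<le> y powr s" using assms by (intro powr_mono) auto
  then show ?thesis by simp
qed

text \<open>On a probability space the bound y^r <= 1 + y^s has a finite integral. The lemma brings
  both terms of the final bound to the common exponent p.\<close>

lemma (in prob_space) Lp_bounded_exponent_mono:
  assumes X: "Lp_bounded M s X" and le: "r \<le> s"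
    and nonneg: "\<And>\<omega>. 0 \<le> X \<omega>" and m: "X \<in> borel_measurable M"
  shows "Lp_bounded M r X"
proof (cases "r = \<infinity>")
  case True
  then show ?thesis using X le by (simp add: top_unique)
next
  case r: False
  note [measurable] = m
  show ?thesis
  proof (cases "s = \<infinity>")
    case True
    then obtain C where C: "AE \<omega> in M. X \<omega> \<le> C" using X by (auto simp: Lp_bounded_def)
    have "(\<integral>\<^sup>+\<omega>. ennreal (X \<omega> powr enn2real r) \<partial>M) \<le> (\<integral>\<^sup>+\<omega>. ennreal (\<bar>C\<bar> powr enn2real r) \<partial>M)"
      by (rule nn_integral_mono_AE, use C in eventually_elim) (use nonneg in \<open>auto intro!: ennreal_leI powr_mono2\<close>)
    also have "\<dots> < \<infinity>" by (simp add: emeasure_space_1)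
    finally show ?thesis using r by (simp add: Lp_bounded_def)
  next
    case False
    then have "enn2real r \<le> enn2real s" using le by (intro enn2real_mono) (auto simp: less_top)
    then have "X \<omega> powr enn2real r \<le> 1 + X \<omega> powr enn2real s" for \<omega>
      by (intro powr_le_one_plus nonneg) auto
    then have "(\<integral>\<^sup>+\<omega>. ennreal (X \<omega> powr enn2real r) \<partial>M) \<le> (\<integral>\<^sup>+\<omega>. 1 + ennreal (X \<omega> powr enn2real s) \<partial>M)"
      by (intro nn_integral_mono) (simp add: ennreal_leI flip: ennreal_plus ennreal_1)
    also have "\<dots> = 1 + (\<integral>\<^sup>+\<omega>. ennreal (X \<omega> powr enn2real s) \<partial>M)"
      by (subst nn_integral_add) (auto simp: emeasure_space_1)
    also have "\<dots> < \<infinity>" using X False by (simp add: Lp_bounded_def)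
    finally show ?thesis using r by (simp add: Lp_bounded_def)
  qed
qed

text \<open>A pointwise substitute for the Hoelder inequality. With m the larger of x^a and y^b, x
  <= m^(1/a) and y <= m^(1/b), and 1/a + 1/b is the reciprocal of the exponent on the left.\<close>

lemma powr_mult_le_harmonic:
  fixes x y a b :: real
  assumes "0 \<le> x" "0 \<le> y" "0 < a" "0 < b"
  shows "(x * y) powr (a * b / (a + b)) \<le> x powr a + y powr b"
proof (cases "x = 0 \<or> y = 0")
  case True
  then show ?thesis using assms by auto
next
  case False
  then have pos: "0 < x" "0 < y" using assms by auto
  define m where "m = max (x powr a) (y powr b)"
  have m: "0 < m" using pos by (simp add: m_def less_max_iff_disj)
  have "x = (x powr a) powr (1 / a)" using pos assms by (simp add: powr_powr)
  also have "\<dots> \<le> m powr (1 / a)" using pos assms by (intro powr_mono2) (auto simp: m_def)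
  finally have 1: "x \<le> m powr (1 / a)" .
  have "y = (y powr b) powr (1 / b)" using pos assms by (simp add: powr_powr)
  also have "\<dots> \<le> m powr (1 / b)" using pos assms by (intro powr_mono2) (auto simp: m_def)
  finally have 2: "y \<le> m powr (1 / b)" .
  have "x * y \<le> m powr (1 / a) * m powr (1 / b)" using 1 2 pos by (intro mult_mono) auto
  also have "\<dots> = m powr (1 / a + 1 / b)" by (simp add: powr_add)
  finally have "(x * y) powr (a * b / (a + b)) \<le> (m powr (1 / a + 1 / b)) powr (a * b / (a + b))"
    using pos assms by (intro powr_mono2) auto
  also have "\<dots> = m powr ((1 / a + 1 / b) * (a * b / (a + b)))" by (simp add: powr_powr)
  also have "(1 / a + 1 / b) * (a * b / (a + b)) = 1"
  proof -
    have "1 / a + 1 / b = (a + b) / (a * b)" using assms by (simp add: field_simps)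
    then show ?thesis using assms by simp
  qed
  finally have "(x * y) powr (a * b / (a + b)) \<le> m" using m by simp
  also have "m \<le> x powr a + y powr b" by (simp add: m_def)
  finally show ?thesis .
qed

lemma Lp_bounded_mult_infinity:
  assumes X: "Lp_bounded M \<infinity> X" and Y: "Lp_bounded M p Y"
    and nonneg: "\<And>\<omega>. 0 \<le> X \<omega>" "\<And>\<omega>. 0 \<le> Y \<omega>" and m: "Y \<in> borel_measurable M"
  shows "Lp_bounded M p (\<lambda>\<omega>. X \<omega> * Y \<omega>)"
proof -
  obtain C where C: "AE \<omega> in M. X \<omega> \<le> C" using X by (auto simp: Lp_bounded_def)
  have "Lp_bounded M p (\<lambda>\<omega>. \<bar>C\<bar> * Y \<omega>)" by (rule Lp_bounded_cmult[OF Y _ nonneg(2) m]) simp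
  then show ?thesis
  proof (rule Lp_bounded_mono)
    show "AE \<omega> in M. 0 \<le> X \<omega> * Y \<omega> \<and> X \<omega> * Y \<omega> \<le> \<bar>C\<bar> * Y \<omega>"
      using C
    proof eventually_elim
      fix \<omega> assume "X \<omega> \<le> C"
      then have "X \<omega> * Y \<omega> \<le> \<bar>C\<bar> * Y \<omega>" by (intro mult_right_mono nonneg) simp
      then show "0 \<le> X \<omega> * Y \<omega> \<and> X \<omega> * Y \<omega> \<le> \<bar>C\<bar> * Y \<omega>" using nonneg by simp
    qed
  qed
qed

lemma Lp_bounded_mult:
  assumes X: "Lp_bounded M a X" and Y: "Lp_bounded M b Y" and ab: "1 \<le> a" "1 \<le> b"
    and nonneg: "\<And>\<omega>. 0 \<le> X \<omega>" "\<And>\<omega>. 0 \<le> Y \<omega>"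
    and m: "X \<in> borel_measurable M" "Y \<in> borel_measurable M"
  shows "Lp_bounded M (harmonic_exponent a b) (\<lambda>\<omega>. X \<omega> * Y \<omega>)"
proof -
  consider "a = \<infinity>" | "a \<noteq> \<infinity>" "b = \<infinity>" | "a \<noteq> \<infinity>" "b \<noteq> \<infinity>" by blast
  then show ?thesis
  proof cases
    case 1
    then show ?thesis using Lp_bounded_mult_infinity[OF _ Y nonneg m(2)] X by (simp add: harmonic_exponent_def)
  next
    case 2
    then show ?thesis using Lp_bounded_mult_infinity[OF _ X nonneg(2,1) m(1)] Y
      by (simp add: harmonic_exponent_def mult.commute)
  next
    case 3
    note [measurable] = m
    obtain a' where a': "a = ennreal a'" "0 \<le> a'" using 3(1) by (cases a) auto
    obtain b' where b': "b = ennreal b'" "0 \<le> b'" using 3(2) by (cases b) auto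
    have ge1: "1 \<le> a'" "1 \<le> b'" using ab a' b' by auto
    define r where "r = a' * b' / (a' + b')"
    have h: "harmonic_exponent a b = ennreal r"
      using a' b' ge1 by (simp add: harmonic_exponent_def r_def divide_ennreal flip: ennreal_mult ennreal_plus)
    have r: "0 \<le> r" using ge1 by (simp add: r_def)
    have "(\<integral>\<^sup>+\<omega>. ennreal ((X \<omega> * Y \<omega>) powr r) \<partial>M)
        \<le> (\<integral>\<^sup>+\<omega>. ennreal (X \<omega> powr a') + ennreal (Y \<omega> powr b') \<partial>M)"
      unfolding r_def
      by (intro nn_integral_mono)
        (use powr_mult_le_harmonic[OF nonneg] ge1 in \<open>simp add: ennreal_leI flip: ennreal_plus\<close>)
    also have "\<dots> = (\<integral>\<^sup>+\<omega>. ennreal (X \<omega> powr a') \<partial>M) + (\<integral>\<^sup>+\<omega>. ennreal (Y \<omega> powr b') \<partial>M)"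
      by (rule nn_integral_add) auto
    also have "\<dots> < \<infinity>" using X Y a' b' by (simp add: Lp_bounded_def)
    finally show ?thesis using r by (simp add: Lp_bounded_def h)
  qed
qed

text \<open>Applied to the inverse of Amin, whose square root multiplies |u0| in the bound.\<close>

lemma Lp_bounded_sqrt:
  assumes X: "Lp_bounded M c X" and nonneg: "\<And>\<omega>. 0 \<le> X \<omega>"
  shows "Lp_bounded M (2 * c) (\<lambda>\<omega>. sqrt (X \<omega>))"
proof (cases "c = \<infinity>")
  case True
  then obtain C where "AE \<omega> in M. X \<omega> \<le> C" using X by (auto simp: Lp_bounded_def)
  then have "AE \<omega> in M. sqrt (X \<omega>) \<le> sqrt C" by eventually_elim (rule real_sqrt_le_mono)
  then have "\<exists>D. AE \<omega> in M. sqrt (X \<omega>) \<le> D" by blast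
  then show ?thesis using True by (simp add: Lp_bounded_def ennreal_mult_top)
next
  case False
  then obtain c' where c': "c = ennreal c'" "0 \<le> c'" by (cases c) auto
  have 2: "2 * c = ennreal (2 * c')" using c' by (simp add: ennreal_mult)
  have "sqrt (X \<omega>) powr (2 * c') = X \<omega> powr c'" for \<omega>
    using nonneg[of \<omega>] by (simp add: powr_half_sqrt[symmetric] powr_powr)
  then show ?thesis using X c' unfolding Lp_bounded_def 2 by simp
qed

section \<open>Measurability of the solution\<close>

lemma countable_dense_subset:
  fixes P :: "'a::{metric_space,second_countable_topology} set"
  obtains Q where "countable Q" "Q \<subseteq> P" "P \<subseteq> closure Q"
proof -
  obtain B :: "'a set set" where B: "countable B" "topological_basis B" using ex_countable_basis by blast
  define Q where "Q = (\<lambda>b. SOME x. x \<in> b \<inter> P) ` {b \<in> B. b \<inter> P \<noteq> {}}"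
  have some: "(SOME x. x \<in> b \<inter> P) \<in> b \<inter> P" if "b \<inter> P \<noteq> {}" for b
    by (rule someI_ex) (use that in blast)
  have "P \<subseteq> closure Q"
  proof
    fix x assume x: "x \<in> P"
    show "x \<in> closure Q" unfolding closure_approachable
    proof (intro allI impI)
      fix e :: real assume "e > 0"
      then obtain b where b: "b \<in> B" "x \<in> b" "b \<subseteq> ball x e"
        using topological_basisE[OF B(2) open_ball, of x x e] by auto
      then have "b \<inter> P \<noteq> {}" using x by blast
      from some[OF this] b this show "\<exists>y\<in>Q. dist y x < e"
        unfolding Q_def by (intro bexI[of _ "SOME x. x \<in> b \<inter> P"]) (auto simp: dist_commute)
    qed
  qed
  moreover have "countable Q" unfolding Q_def by (intro countable_image countable_subset[OF _ B(1)]) auto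
  moreover have "Q \<subseteq> P" unfolding Q_def using some by auto
  ultimately show ?thesis using that by blast
qed

text \<open>The supremum over D is the dual norm of k on S, because D is dense in S; continuity of
  the dual norm in k lets K0 stand for K. With D and K0 countable this describes sublevel sets of
  the norm by countably many conditions. \<open>ennreal\<close> gives every supremum a value and
  matches the measurability of countable suprema; d = 0 contributes 0.\<close>

lemma norm_le_iff_countable_dual:
  fixes S K D K0 :: "'a::{real_inner,banach} set"
  assumes S: "closed S" "subspace S" and K: "subspace K"
    and total: "\<And>z. z \<in> S \<Longrightarrow> (\<And>k. k \<in> K \<Longrightarrow> z \<bullet> k = 0) \<Longrightarrow> z = 0"
    and D: "D \<subseteq> S" "S \<subseteq> closure D" and K0: "K0 \<subseteq> K" "K \<subseteq> closure K0"
    and y: "y \<in> S" and r: "0 \<le> r"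
  shows "norm y \<le> r \<longleftrightarrow>
    (\<forall>k\<in>K0. ennreal \<bar>y \<bullet> k\<bar> \<le> ennreal r * (SUP d\<in>D. ennreal (\<bar>d \<bullet> k\<bar> / norm d)))"
proof -
  define N where "N k = (SUP d\<in>D. ennreal (\<bar>d \<bullet> k\<bar> / norm d))" for k
  have N_le: "N k \<le> ennreal c" if "\<And>z. z \<in> S \<Longrightarrow> \<bar>z \<bullet> k\<bar> \<le> c * norm z" "0 \<le> c" for k c
    unfolding N_def
  proof (rule SUP_least)
    fix d assume "d \<in> D"
    then have "\<bar>d \<bullet> k\<bar> / norm d \<le> c"
      using that D(1) by (cases "d = 0") (auto simp: pos_divide_le_eq)
    then show "ennreal (\<bar>d \<bullet> k\<bar> / norm d) \<le> ennreal c" by (rule ennreal_leI)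
  qed
  have N_real: "\<exists>n\<ge>0. N k = ennreal n" for k
  proof -
    have "N k \<le> ennreal (norm k)"
      by (rule N_le) (use Cauchy_Schwarz_ineq2 in \<open>auto simp: mult.commute\<close>)
    then have "N k \<noteq> \<infinity>" by (auto simp: top_unique)
    then show ?thesis by (cases "N k") auto
  qed
  then obtain n where n: "\<And>k. 0 \<le> n k" "\<And>k. N k = ennreal (n k)" by metis
  have dual: "\<bar>z \<bullet> k\<bar> \<le> n k * norm z" if "z \<in> S" for z k
  proof -
    have "D \<subseteq> {z. \<bar>z \<bullet> k\<bar> \<le> n k * norm z}"
    proof (intro subsetI CollectI)
      fix d assume d: "d \<in> D"
      have "ennreal (\<bar>d \<bullet> k\<bar> / norm d) \<le> ennreal (n k)"
        unfolding n(2)[symmetric] N_def by (rule SUP_upper[OF d])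
      then have "\<bar>d \<bullet> k\<bar> / norm d \<le> n k" using n(1) by (simp add: ennreal_le_iff)
      then show "\<bar>d \<bullet> k\<bar> \<le> n k * norm d" by (cases "d = 0") (auto simp: pos_divide_le_eq)
    qed
    moreover have "closed {z. \<bar>z \<bullet> k\<bar> \<le> n k * norm z}" by (intro closed_Collect_le continuous_intros)
    ultimately have "closure D \<subseteq> {z. \<bar>z \<bullet> k\<bar> \<le> n k * norm z}" by (rule closure_minimal)
    then show ?thesis using that D(2) by blast
  qed
  have iff: "ennreal \<bar>y \<bullet> k\<bar> \<le> ennreal r * N k \<longleftrightarrow> \<bar>y \<bullet> k\<bar> \<le> r * n k" for k
    using r n by (simp add: ennreal_mult[symmetric] ennreal_le_iff)
  have "norm y \<le> r \<longleftrightarrow> (\<forall>k\<in>K0. \<bar>y \<bullet> k\<bar> \<le> r * n k)"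
  proof
    assume "norm y \<le> r"
    show "\<forall>k\<in>K0. \<bar>y \<bullet> k\<bar> \<le> r * n k"
    proof
      fix k
      have "\<bar>y \<bullet> k\<bar> \<le> n k * norm y" by (rule dual[OF y])
      also have "\<dots> \<le> n k * r" by (rule mult_left_mono[OF \<open>norm y \<le> r\<close> n(1)])
      finally show "\<bar>y \<bullet> k\<bar> \<le> r * n k" by (simp add: mult.commute)
    qed
  next
    assume R: "\<forall>k\<in>K0. \<bar>y \<bullet> k\<bar> \<le> r * n k"
    show "norm y \<le> r"
    proof (rule norm_le_dual_on_subspace[OF S K total y])
      fix k c assume k: "k \<in> K" and c: "0 \<le> c" and bound: "\<And>z. z \<in> S \<Longrightarrow> z \<bullet> k \<le> c * norm z"
      have bound': "\<bar>z \<bullet> k\<bar> \<le> c * norm z" if "z \<in> S" for z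
        using bound[OF that] bound[of "- z"] subspace_neg[OF S(2) that] by (simp add: abs_le_iff)
      obtain a where a: "\<And>j. a j \<in> K0" "a \<longlonglongrightarrow> k" using K0(2) k by (auto simp: closure_sequential subset_iff)
      \<comment> \<open>The dual norm is 1-Lipschitz in the functional, so the conditions for K0
        pass to limits in K.\<close>
      have "n (a j) \<le> c + norm (a j - k)" for j
      proof -
        have "N (a j) \<le> ennreal (c + norm (a j - k))"
        proof (rule N_le)
          fix z assume "z \<in> S"
          have "\<bar>z \<bullet> a j\<bar> \<le> \<bar>z \<bullet> k\<bar> + \<bar>z \<bullet> (a j - k)\<bar>" by (simp add: inner_diff_right)
          also have "\<dots> \<le> c * norm z + norm z * norm (a j - k)"
            by (intro add_mono bound'[OF \<open>z \<in> S\<close>] Cauchy_Schwarz_ineq2)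
          finally show "\<bar>z \<bullet> a j\<bar> \<le> (c + norm (a j - k)) * norm z" by (simp add: algebra_simps)
        qed (use c in simp)
        then show ?thesis using c unfolding n(2) by (subst (asm) ennreal_le_iff) auto
      qed
      then have "r * n (a j) \<le> r * (c + norm (a j - k))" for j using r by (intro mult_left_mono)
      then have le: "y \<bullet> a j \<le> r * (c + norm (a j - k))" for j
        using R a(1)[of j] by (meson abs_le_D1 order_trans)
      have "(\<lambda>j. y \<bullet> a j) \<longlonglongrightarrow> y \<bullet> k" by (intro tendsto_intros a(2))
      moreover have "(\<lambda>j. r * (c + norm (a j - k))) \<longlonglongrightarrow> r * (c + norm (k - k))"
        by (intro tendsto_intros a(2))
      ultimately have "y \<bullet> k \<le> r * (c + norm (k - k))" by (rule LIMSEQ_le) (use le in blast)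
      then show "y \<bullet> k \<le> r * c" by simp
    qed auto
  qed
  then show ?thesis unfolding N_def[symmetric] iff .
qed

text \<open>The simple functions take the value of \<open>D\<close> nearest to \<open>u \<omega>\<close> among the first \<open>n\<close> elements.\<close>

lemma in_LpI_countable_dense:
  assumes D: "countable D" "D \<noteq> {}" "D \<subseteq> S"
    and \<rho>: "\<And>d. d \<in> D \<Longrightarrow> \<rho> d \<in> borel_measurable M"
    and u: "AE \<omega> in M. u \<omega> \<in> S \<and> (\<forall>d\<in>D. nrm (u \<omega> - d) = \<rho> d \<omega> \<and> 0 \<le> \<rho> d \<omega>) \<and> (\<forall>e>0. \<exists>d\<in>D. \<rho> d \<omega> < e)"
    and p: "Lp_bounded M p (\<lambda>\<omega>. nrm (u \<omega>))"
  shows "in_Lp M p S nrm u"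
proof -
  define d where "d = from_nat_into D"
  have d: "d i \<in> D" for i unfolding d_def using D(2) by (rule from_nat_into)
  note [measurable] = \<rho>[OF d]
  \<comment> \<open>Taking the least minimizing index breaks ties measurably, since membership is
    decided by comparing measurable functions.\<close>
  define j where "j n \<omega> = (LEAST i. i \<le> n \<and> (\<forall>k\<le>n. \<rho> (d i) \<omega> \<le> \<rho> (d k) \<omega>))" for n :: nat and \<omega>
  have j: "j n \<omega> \<le> n \<and> (\<forall>k\<le>n. \<rho> (d (j n \<omega>)) \<omega> \<le> \<rho> (d k) \<omega>)" for n \<omega>
  proof -
    let ?R = "(\<lambda>i. \<rho> (d i) \<omega>) ` {..n}"
    have "Min ?R \<in> ?R" by (intro Min_in) auto
    then obtain i where i: "i \<in> {..n}" "Min ?R = \<rho> (d i) \<omega>" by (rule imageE)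
    moreover have "Min ?R \<le> \<rho> (d k) \<omega>" if "k \<le> n" for k using that by (intro Min_le) auto
    ultimately have "i \<le> n \<and> (\<forall>k\<le>n. \<rho> (d i) \<omega> \<le> \<rho> (d k) \<omega>)" by simp
    then show ?thesis unfolding j_def by (rule LeastI)
  qed
  have "simple_function M (j n)" for n
  proof -
    have "j n \<in> measurable M (count_space UNIV)" unfolding j_def by measurable
    moreover have "finite (j n ` space M)" by (rule finite_subset[of _ "{..n}"]) (use j in auto)
    ultimately show ?thesis by (simp add: simple_function_eq_measurable)
  qed
  then have "simple_function M (d \<circ> j n)" for n by (rule simple_function_compose)
  moreover have "(d \<circ> j n) ` space M \<subseteq> S" for n using d D(3) by auto
  moreover have "AE \<omega> in M. u \<omega> \<in> S \<and> (\<lambda>n. nrm (u \<omega> - (d \<circ> j n) \<omega>)) \<longlonglongrightarrow> 0"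
    using u
  proof eventually_elim
    fix \<omega>
    assume w: "u \<omega> \<in> S \<and> (\<forall>d\<in>D. nrm (u \<omega> - d) = \<rho> d \<omega> \<and> 0 \<le> \<rho> d \<omega>) \<and> (\<forall>e>0. \<exists>d\<in>D. \<rho> d \<omega> < e)"
    have "(\<lambda>n. nrm (u \<omega> - (d \<circ> j n) \<omega>)) \<longlonglongrightarrow> 0"
    proof (rule LIMSEQ_I)
      fix e :: real assume "0 < e"
      then obtain c where c: "c \<in> D" "\<rho> c \<omega> < e" using w by blast
      then obtain i where i: "c = d i" unfolding d_def using from_nat_into_surj[OF D(1)] by metis
      have "norm (nrm (u \<omega> - (d \<circ> j n) \<omega>) - 0) < e" if "n \<ge> i" for n
      proof -
        have "\<rho> (d (j n \<omega>)) \<omega> \<le> \<rho> (d i) \<omega>" using j[of n \<omega>] that by blast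
        then show ?thesis using w d[of "j n \<omega>"] c i by simp
      qed
      then show "\<exists>n0. \<forall>n\<ge>n0. norm (nrm (u \<omega> - (d \<circ> j n) \<omega>) - 0) < e" by blast
    qed
    with w show "u \<omega> \<in> S \<and> (\<lambda>n. nrm (u \<omega> - (d \<circ> j n) \<omega>)) \<longlonglongrightarrow> 0" by blast
  qed
  moreover have "if p = \<infinity> then \<exists>C. AE \<omega> in M. nrm (u \<omega>) \<le> C
      else (\<integral>\<^sup>+\<omega>. ennreal (nrm (u \<omega>) powr enn2real p) \<partial>M) < \<infinity>"
    using p by (simp add: Lp_bounded_def)
  ultimately show ?thesis unfolding in_Lp_def by (intro conjI exI[of _ "\<lambda>n. d \<circ> j n"]) auto
qed

text \<open>This is where completeness enters: the solution is controlled only for almost every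
  \<omega>, and on the exceptional null set every subset is measurable.\<close>

lemma (in complete_measure) measurable_if_AE_iff:
  assumes "AE \<omega> in M. P \<omega> \<longleftrightarrow> Q \<omega>" and Q: "{\<omega> \<in> space M. Q \<omega>} \<in> sets M"
  shows "{\<omega> \<in> space M. P \<omega>} \<in> sets M"
proof -
  obtain N where N: "N \<in> null_sets M" "{\<omega> \<in> space M. \<not> (P \<omega> \<longleftrightarrow> Q \<omega>)} \<subseteq> N"
    using assms(1) by (auto simp: eventually_ae_filter)
  have "{\<omega> \<in> space M. P \<omega>} \<inter> N \<in> sets M" by (rule complete[OF _ N(1)]) blast
  moreover have "{\<omega> \<in> space M. Q \<omega>} - N \<in> sets M" using Q N(1) by (intro sets.Diff) auto
  ultimately have "({\<omega> \<in> space M. Q \<omega>} - N) \<union> ({\<omega> \<in> space M. P \<omega>} \<inter> N) \<in> sets M"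
    by (intro sets.Un)
  also have "({\<omega> \<in> space M. Q \<omega>} - N) \<union> ({\<omega> \<in> space M. P \<omega>} \<inter> N) = {\<omega> \<in> space M. P \<omega>}"
    using N(2) by auto
  finally show ?thesis .
qed

section \<open>The variational problem\<close>

text \<open>Integrability of the data is recorded as bounds on norms; measurability in \<omega>
  comes from progressive measurability of A and f and from Borel measurability of u0 and Amin. The
  exponent p is given through its two upper bounds.\<close>

locale parabolic_problem = prob_space M + complete_measure M
  for M :: "'w measure" +
  fixes F :: "real \<Rightarrow> 'w measure" and T :: real
    and emb :: "'v::{real_inner,banach,second_countable_topology} \<Rightarrow>\<^sub>L
                'h::{real_inner,banach,second_countable_topology}"
    and A :: "real \<Rightarrow> 'w \<Rightarrow> 'v \<Rightarrow>\<^sub>L 'v \<Rightarrow>\<^sub>L real"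
    and Amin Amax :: "'w \<Rightarrow> real"
    and f :: "real \<Rightarrow> 'w \<Rightarrow> 'v \<Rightarrow>\<^sub>L real"
    and u0 :: "'w \<Rightarrow> 'h"
    and \<alpha> \<beta> \<gamma> p :: ennreal
  assumes T: "0 < T" and filtration: "normal_filtration M T F"
    and A_meas: "progressively_measurable_op T F A"
    and Amin_meas [measurable]: "Amin \<in> borel_measurable M"
    and A_pos: "AE \<omega> in M. 0 < Amin \<omega> \<and> 0 < Amax \<omega>"
    and A_bound: "AE \<omega> in M. \<forall>t\<in>{0..T}. \<forall>v w. \<bar>A t \<omega> v w\<bar> \<le> Amax \<omega> * norm v * norm w"
    and A_coercive: "AE \<omega> in M. \<forall>t\<in>{0..T}. \<forall>v. Amin \<omega> * (norm v)\<^sup>2 \<le> A t \<omega> v v"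
    and A_sym: "AE \<omega> in M. \<forall>t\<in>{0..T}. \<forall>v w. A t \<omega> v w = A t \<omega> w v"
    and f_meas: "progressively_measurable T F f"
    and f_L2: "AE \<omega> in M. (\<lambda>t. f t \<omega>) \<in> L2 T UNIV"
    and u0_meas [measurable]: "u0 \<in> borel_measurable M"
    and exponents: "1 \<le> \<alpha>" "1 \<le> \<beta>" "1 \<le> \<gamma>"
    and f_Lp: "Lp_bounded M \<alpha> (\<lambda>\<omega>. L2_norm T (\<lambda>t. f t \<omega>))"
    and u0_Lp: "Lp_bounded M \<beta> (\<lambda>\<omega>. norm (u0 \<omega>))"
    and Amin_Lp: "Lp_bounded M \<gamma> (\<lambda>\<omega>. norm (inverse (Amin \<omega>)))"
    and p_le: "p \<le> harmonic_exponent \<alpha> \<gamma>" "p \<le> harmonic_exponent \<beta> (2 * \<gamma>)"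
begin

text \<open>Progressive measurability is read at the final time T, where it is joint measurability
  on [0,T] with respect to F T; then F T is enlarged to M.\<close>

lemma progressive_measurable:
  assumes "progressively_measurable T F X"
  shows "(\<lambda>z. X (snd z) (fst z)) \<in> borel_measurable (M \<Otimes>\<^sub>M time_measure T)"
proof -
  have sub: "subalgebra M (F T)" using filtration T by (auto simp: normal_filtration_def)
  have "(\<lambda>(s, \<omega>). X s \<omega>) \<in> borel_measurable (restrict_space borel {0..T} \<Otimes>\<^sub>M F T)"
    using assms T by (auto simp: progressively_measurable_def)
  moreover have "(\<lambda>t. t) \<in> measurable (time_measure T) (restrict_space borel {0..T})"
    by (rule measurable_restrict_space3) (auto intro: measurable_completion)
  moreover have "(\<lambda>\<omega>. \<omega>) \<in> measurable M (F T)"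
    by (rule measurable_from_subalg[OF sub]) simp
  then have "(\<lambda>z. (snd z, fst z)) \<in> measurable (M \<Otimes>\<^sub>M time_measure T) (restrict_space borel {0..T} \<Otimes>\<^sub>M F T)"
    by (intro measurable_Pair measurable_compose[OF measurable_snd] measurable_compose[OF measurable_fst] calculation(2))
  ultimately show ?thesis using measurable_compose by fastforce
qed

text \<open>A is measurable only after application to a fixed vector. For simple x this suffices on
  each of the finitely many level sets, and boundedness of \<open>A t \<omega>\<close> carries it to
  the limit.\<close>

lemma A_apply_measurable:
  assumes x: "x \<in> borel_measurable (time_measure T)"
  shows "(\<lambda>z. A (snd z) (fst z) (x (snd z))) \<in> borel_measurable (M \<Otimes>\<^sub>M time_measure T)"
proof -
  obtain s where s: "\<And>i. simple_function (time_measure T) (s i)"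
    and lim: "\<And>t. t \<in> space (time_measure T) \<Longrightarrow> (\<lambda>i. s i t) \<longlonglongrightarrow> x t"
    using borel_measurable_implies_sequence_metric[OF x, of 0] by blast
  show ?thesis
  proof (rule borel_measurable_LIMSEQ_metric)
    fix i
    let ?I = "s i ` space (time_measure T)"
    have fin: "finite ?I" using s(1) by (rule simple_functionD)
    have "s i \<in> measurable (time_measure T) (count_space ?I)"
      using simple_functionD(2)[OF s, of i] fin
      by (subst measurable_count_space_eq_countable) (auto intro: countable_finite)
    then have "(\<lambda>z. s i (snd z)) \<in> measurable (M \<Otimes>\<^sub>M time_measure T) (count_space ?I)"
      by (rule measurable_compose[OF measurable_snd])
    moreover have "(\<lambda>z. A (snd z) (fst z) v) \<in> borel_measurable (M \<Otimes>\<^sub>M time_measure T)" for v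
      using progressive_measurable[of "\<lambda>t \<omega>. A t \<omega> v"] A_meas by (simp add: progressively_measurable_op_def)
    ultimately show "(\<lambda>z. A (snd z) (fst z) (s i (snd z))) \<in> borel_measurable (M \<Otimes>\<^sub>M time_measure T)"
      using countable_finite[OF fin]
      by (intro measurable_compose_countable'[where f="\<lambda>v z. A (snd z) (fst z) v" and g="\<lambda>z. s i (snd z)"])
  next
    fix z assume "z \<in> space (M \<Otimes>\<^sub>M time_measure T)"
    then have "snd z \<in> space (time_measure T)" by (simp add: space_pair_measure mem_Times_iff)
    then show "(\<lambda>i. A (snd z) (fst z) (s i (snd z))) \<longlonglongrightarrow> A (snd z) (fst z) (x (snd z))"
      by (intro blinfun.tendsto tendsto_const lim)
  qed
qed

lemma sigma_finite_time: "sigma_finite_measure (time_measure T)"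
  using finite_time_measure[of T] by (simp add: finite_measure.axioms)

text \<open>For almost every \<open>\<omega>\<close>, \<open>B_\<omega>\<close> is represented in \<open>L\<^sup>2((0,T);V)\<close> by \<open>rep\<close>; self-adjointness of
  \<open>A\<close> moves the operator onto the test function.\<close>

definition Ax :: "'w \<Rightarrow> (real \<Rightarrow> 'v) \<Rightarrow> real \<Rightarrow> 'v" where
  "Ax \<omega> x = (\<lambda>t. riesz (A t \<omega> (x t)))"

definition rep :: "'w \<Rightarrow> (real \<Rightarrow> 'v) \<Rightarrow> (real \<Rightarrow> 'v \<Rightarrow>\<^sub>L real) \<Rightarrow> 'v l2" where
  "rep \<omega> x g = l2_of T (Ax \<omega> x) - l2_of T (\<lambda>t. riesz (g t))"

text \<open>The pairing with \<open>rep\<close> as a plain integral, defined for every \<omega>. Its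
  measurability in \<omega> follows from joint measurability of the integrand, which the
  class-valued \<open>rep\<close> does not display.\<close>

definition B_sym :: "(real \<Rightarrow> 'v) \<Rightarrow> (real \<Rightarrow> 'v) \<Rightarrow> (real \<Rightarrow> 'v \<Rightarrow>\<^sub>L real) \<Rightarrow> 'w \<Rightarrow> real" where
  "B_sym z x g \<omega> = (LINT t|time_measure T. z t \<bullet> (Ax \<omega> x t - riesz (g t)))"

text \<open>The almost sure conditions under which \<open>rep\<close> represents B. Coercivity is
  kept apart and enters through the stability condition. Membership in the space gives access to
  sections of jointly measurable functions.\<close>

definition good :: "'w \<Rightarrow> bool" where
  "good \<omega> \<longleftrightarrow> \<omega> \<in> space M \<and> 0 < Amin \<omega> \<and> 0 < Amax \<omega> \<and> (\<lambda>t. f t \<omega>) \<in> L2 T UNIV \<and>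
    (\<forall>t\<in>{0..T}. \<forall>v w. \<bar>A t \<omega> v w\<bar> \<le> Amax \<omega> * norm v * norm w \<and> A t \<omega> v w = A t \<omega> w v)"

lemma AE_good: "AE \<omega> in M. good \<omega>"
  using A_pos A_bound A_sym f_L2 AE_space by eventually_elim (auto simp: good_def)

lemma time_mem: "t \<in> space (time_measure T) \<Longrightarrow> t \<in> {0..T}"
  by auto

lemma Ax_joint_measurable:
  assumes "x \<in> borel_measurable (time_measure T)"
  shows "(\<lambda>z. Ax (fst z) x (snd z)) \<in> borel_measurable (M \<Otimes>\<^sub>M time_measure T)"
  unfolding Ax_def by (rule borel_measurable_riesz[OF A_apply_measurable[OF assms]])

lemma Ax_bound:
  assumes "good \<omega>" "t \<in> {0..T}"
  shows "norm (Ax \<omega> x t) \<le> Amax \<omega> * norm (x t)"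
  unfolding Ax_def riesz
proof (rule norm_blinfun_bound)
  show "0 \<le> Amax \<omega> * norm (x t)" using assms by (auto simp: good_def)
  have "\<bar>A t \<omega> (x t) v\<bar> \<le> Amax \<omega> * norm (x t) * norm v" for v using assms unfolding good_def by blast
  then show "norm (A t \<omega> (x t) v) \<le> Amax \<omega> * norm (x t) * norm v" for v by simp
qed

lemma Ax_L2:
  assumes \<omega>: "good \<omega>" and x: "x \<in> L2 T UNIV"
  shows "Ax \<omega> x \<in> L2 T UNIV" "norm (l2_of T (Ax \<omega> x)) \<le> Amax \<omega> * norm (l2_of T x)"
proof -
  have "(\<lambda>t. Ax (fst (\<omega>, t)) x (snd (\<omega>, t))) \<in> borel_measurable (time_measure T)"
    using \<omega> by (intro measurable_compose[OF measurable_Pair1' Ax_joint_measurable[OF L2D(1)[OF x]]])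
      (simp add: good_def)
  then have [measurable]: "Ax \<omega> x \<in> borel_measurable (time_measure T)" by simp
  have int: "integrable (time_measure T) (\<lambda>t. (Amax \<omega>)\<^sup>2 * (norm (x t))\<^sup>2)" using L2D(2)[OF x] by auto
  have le: "(norm (Ax \<omega> x t))\<^sup>2 \<le> (Amax \<omega>)\<^sup>2 * (norm (x t))\<^sup>2" if "t \<in> space (time_measure T)" for t
    using power_mono[OF Ax_bound[OF \<omega> time_mem[OF that], of x], of 2] by (simp add: power_mult_distrib)
  have int': "integrable (time_measure T) (\<lambda>t. (norm (Ax \<omega> x t))\<^sup>2)"
    by (rule Bochner_Integration.integrable_bound[OF int]) (use le in \<open>auto intro!: AE_I2\<close>)
  then show L2: "Ax \<omega> x \<in> L2 T UNIV" by (simp add: L2_def)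
  have "(L2_norm T (Ax \<omega> x))\<^sup>2 \<le> (LINT t|time_measure T. (Amax \<omega>)\<^sup>2 * (norm (x t))\<^sup>2)"
    using integral_mono[OF int' int le] unfolding L2_norm_def by (subst real_sqrt_pow2) auto
  also have "\<dots> = (Amax \<omega> * L2_norm T x)\<^sup>2"
    unfolding L2_norm_def power_mult_distrib by (subst real_sqrt_pow2) auto
  finally have "L2_norm T (Ax \<omega> x) \<le> Amax \<omega> * L2_norm T x"
    by (rule power2_le_imp_le) (use \<omega> in \<open>auto simp: good_def L2_norm_def\<close>)
  then show "norm (l2_of T (Ax \<omega> x)) \<le> Amax \<omega> * norm (l2_of T x)"
    by (simp add: norm_l2_of L2 x)
qed

lemma Ax_add: "Ax \<omega> (\<lambda>t. x t + y t) = (\<lambda>t. Ax \<omega> x t + Ax \<omega> y t)"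
  by (simp add: Ax_def blinfun.add_right riesz_add)

lemma Ax_scaleR: "Ax \<omega> (\<lambda>t. c *\<^sub>R x t) = (\<lambda>t. c *\<^sub>R Ax \<omega> x t)"
  by (simp add: Ax_def blinfun.scaleR_right riesz_scaleR)

lemma B_star_eq:
  assumes \<omega>: "good \<omega>" and z: "z \<in> L2 T UNIV" and x: "x \<in> L2 T UNIV" and g: "g \<in> L2 T UNIV"
  shows "B_star T (\<lambda>t. A t \<omega>) z x g = l2_of T z \<bullet> rep \<omega> x g" "B_sym z x g \<omega> = l2_of T z \<bullet> rep \<omega> x g"
proof -
  have rep: "rep \<omega> x g = l2_of T (\<lambda>t. Ax \<omega> x t - riesz (g t))"
    unfolding rep_def by (rule l2_of_diff[symmetric, OF Ax_L2(1)[OF \<omega> x] L2_riesz[OF g]])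
  show 1: "B_sym z x g \<omega> = l2_of T z \<bullet> rep \<omega> x g"
    unfolding rep B_sym_def
    by (rule l2_of_inner(1)[symmetric, OF z L2_diff[OF Ax_L2(1)[OF \<omega> x] L2_riesz[OF g]]]) simp
  have "B_star T (\<lambda>t. A t \<omega>) z x g = B_sym z x g \<omega>"
    unfolding B_star_def B_sym_def
  proof (rule Bochner_Integration.integral_cong[OF refl])
    fix t assume "t \<in> space (time_measure T)"
    then have "A t \<omega> (z t) (x t) = A t \<omega> (x t) (z t)" using \<omega> time_mem unfolding good_def by blast
    then show "- g t (z t) + A t \<omega> (z t) (x t) = z t \<bullet> (Ax \<omega> x t - riesz (g t))"
      by (simp add: inner_diff_right Ax_def riesz)
  qed
  with 1 show "B_star T (\<lambda>t. A t \<omega>) z x g = l2_of T z \<bullet> rep \<omega> x g" by simp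
qed

lemma B_sym_measurable:
  assumes "z \<in> borel_measurable (time_measure T)" "x \<in> borel_measurable (time_measure T)"
    and "g \<in> borel_measurable (time_measure T)"
  shows "B_sym z x g \<in> borel_measurable M"
proof -
  interpret time: sigma_finite_measure "time_measure T" by (rule sigma_finite_time)
  note [measurable] = Ax_joint_measurable[OF assms(2)] assms(1) borel_measurable_riesz[OF assms(3)]
  have "(\<lambda>\<omega>. LINT t|time_measure T. z t \<bullet> (Ax \<omega> x t - riesz (g t))) \<in> borel_measurable M"
    by (rule time.borel_measurable_lebesgue_integral) (simp add: split_beta')
  then show ?thesis by (simp add: B_sym_def[abs_def])
qed

lemma F_load_measurable:
  assumes "x \<in> borel_measurable (time_measure T)"
  shows "(\<lambda>\<omega>. F_load T (\<lambda>t. f t \<omega>) (u0 \<omega>) x xH) \<in> borel_measurable M"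
proof -
  interpret time: sigma_finite_measure "time_measure T" by (rule sigma_finite_time)
  note [measurable] = borel_measurable_riesz[OF progressive_measurable[OF f_meas]] assms
  have "(\<lambda>\<omega>. LINT t|time_measure T. x t \<bullet> riesz (f t \<omega>)) \<in> borel_measurable M"
    by (rule time.borel_measurable_lebesgue_integral) (simp add: split_beta')
  then have [measurable]: "(\<lambda>\<omega>. LINT t|time_measure T. f t \<omega> (x t)) \<in> borel_measurable M" by (simp add: riesz)
  show ?thesis unfolding F_load_def by measurable
qed

lemma f_norm_measurable: "(\<lambda>\<omega>. L2_norm T (\<lambda>t. f t \<omega>)) \<in> borel_measurable M"
proof -
  interpret time: sigma_finite_measure "time_measure T" by (rule sigma_finite_time)
  note [measurable] = borel_measurable_riesz[OF progressive_measurable[OF f_meas]]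
  have "(\<lambda>\<omega>. LINT t|time_measure T. (norm (riesz (f t \<omega>)))\<^sup>2) \<in> borel_measurable M"
    by (rule time.borel_measurable_lebesgue_integral) (simp add: split_beta')
  then show ?thesis unfolding L2_norm_def riesz by measurable
qed

text \<open>Writing \<open>norm (inverse (Amin \<omega>))\<close> keeps both terms nonnegative for
  every \<omega>, as the lemmas on \<open>Lp_bounded\<close> demand, also where Amin fails to be
  positive.\<close>

definition bound :: "real \<Rightarrow> 'w \<Rightarrow> real" where
  "bound C \<omega> = C * (L2_norm T (\<lambda>t. f t \<omega>) * norm (inverse (Amin \<omega>)))
     + sqrt 2 * (norm (u0 \<omega>) * sqrt (norm (inverse (Amin \<omega>))))"

lemma bound_Lp:
  assumes "0 \<le> C"
  shows "Lp_bounded M p (bound C)"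
proof -
  note [measurable] = f_norm_measurable
  have n: "0 \<le> L2_norm T y" for y :: "real \<Rightarrow> 'v \<Rightarrow>\<^sub>L real" by (simp add: L2_norm_def)
  have m: "(\<lambda>\<omega>. norm (inverse (Amin \<omega>))) \<in> borel_measurable M"
    "(\<lambda>\<omega>. sqrt (norm (inverse (Amin \<omega>)))) \<in> borel_measurable M" "(\<lambda>\<omega>. norm (u0 \<omega>)) \<in> borel_measurable M"
    by measurable
  have "1 * 1 \<le> 2 * \<gamma>" by (rule mult_mono) (use exponents in auto)
  then have "1 \<le> 2 * \<gamma>" by simp
  from Lp_bounded_mult[OF u0_Lp Lp_bounded_sqrt[OF Amin_Lp] exponents(2) this _ _ m(3) m(2)]
  have "Lp_bounded M (harmonic_exponent \<beta> (2 * \<gamma>)) (\<lambda>\<omega>. norm (u0 \<omega>) * sqrt (norm (inverse (Amin \<omega>))))" by simp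
  then have 2: "Lp_bounded M p (\<lambda>\<omega>. norm (u0 \<omega>) * sqrt (norm (inverse (Amin \<omega>))))"
    by (rule Lp_bounded_exponent_mono[OF _ p_le(2)]) (auto intro: m)
  from Lp_bounded_mult[OF f_Lp Amin_Lp exponents(1,3) n _ f_norm_measurable m(1)]
  have "Lp_bounded M (harmonic_exponent \<alpha> \<gamma>) (\<lambda>\<omega>. L2_norm T (\<lambda>t. f t \<omega>) * norm (inverse (Amin \<omega>)))" by simp
  then have 1: "Lp_bounded M p (\<lambda>\<omega>. L2_norm T (\<lambda>t. f t \<omega>) * norm (inverse (Amin \<omega>)))"
    by (rule Lp_bounded_exponent_mono[OF _ p_le(1)]) (auto intro: m simp: n)
  show ?thesis unfolding bound_def
    by (intro Lp_bounded_add Lp_bounded_cmult 1 2 mult_nonneg_nonneg assms n) auto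
qed

lemma rep_add:
  assumes "good \<omega>" "x \<in> L2 T UNIV" "g \<in> L2 T UNIV" "x' \<in> L2 T UNIV" "g' \<in> L2 T UNIV"
  shows "rep \<omega> (\<lambda>t. x t + x' t) (\<lambda>t. g t + g' t) = rep \<omega> x g + rep \<omega> x' g'"
  using assms by (simp add: rep_def Ax_add riesz_add l2_of_add Ax_L2(1) L2_riesz)

lemma rep_scaleR:
  assumes "good \<omega>" "x \<in> L2 T UNIV" "g \<in> L2 T UNIV"
  shows "rep \<omega> (\<lambda>t. c *\<^sub>R x t) (\<lambda>t. c *\<^sub>R g t) = c *\<^sub>R rep \<omega> x g"
  using assms by (simp add: rep_def Ax_scaleR riesz_scaleR l2_of_scaleR Ax_L2(1) L2_riesz scaleR_diff_right)

text \<open>\<open>rep\<close> is Lipschitz in the classes of x and g, with a constant depending on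
  \<omega>. Hence one countable set of test functions, dense independently of \<omega>, has a dense
  image for each good \<omega>.\<close>

lemma rep_dist:
  assumes \<omega>: "good \<omega>" and x: "x \<in> L2 T UNIV" "x' \<in> L2 T UNIV"
  shows "norm (rep \<omega> x g - rep \<omega> x' g') \<le> Amax \<omega> * norm (l2_of T x - l2_of T x')
    + norm (l2_of T (\<lambda>t. riesz (g t)) - l2_of T (\<lambda>t. riesz (g' t)))"
proof -
  have d: "(\<lambda>t. x t - x' t) \<in> L2 T UNIV" using x by (intro L2_diff) auto
  have "Ax \<omega> (\<lambda>t. x t - x' t) = (\<lambda>t. Ax \<omega> x t - Ax \<omega> x' t)"
    by (simp add: Ax_def blinfun.diff_right riesz_diff)
  then have "l2_of T (Ax \<omega> x) - l2_of T (Ax \<omega> x') = l2_of T (Ax \<omega> (\<lambda>t. x t - x' t))"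
    using \<omega> x by (simp add: l2_of_diff Ax_L2(1))
  then have "norm (l2_of T (Ax \<omega> x) - l2_of T (Ax \<omega> x')) \<le> Amax \<omega> * norm (l2_of T x - l2_of T x')"
    using Ax_L2(2)[OF \<omega> d] x by (simp add: l2_of_diff)
  moreover have "rep \<omega> x g - rep \<omega> x' g' = (l2_of T (Ax \<omega> x) - l2_of T (Ax \<omega> x'))
      - (l2_of T (\<lambda>t. riesz (g t)) - l2_of T (\<lambda>t. riesz (g' t)))"
    by (simp add: rep_def)
  ultimately show ?thesis
    using norm_triangle_ineq4[of "l2_of T (Ax \<omega> x) - l2_of T (Ax \<omega> x')"
      "l2_of T (\<lambda>t. riesz (g t)) - l2_of T (\<lambda>t. riesz (g' t))"] by simp
qed

text \<open>Here c bounds the test functional on the trial space, z and x are the norms of a trial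
  and a test function, and h is that of x(0). From m z^2 <= c z follows z <= c / m, and then h^2 <=
  2 c z <= 2 c^2 / m. The left side of the conclusion majorizes F(x).\<close>

lemma coercive_bound:
  fixes a b c m z h C :: real
  assumes "0 < m" "0 \<le> c" "0 \<le> z" "0 \<le> h" "0 \<le> a" "0 \<le> b" "0 \<le> C"
    and energy: "h\<^sup>2 / 2 + m * z\<^sup>2 \<le> c * z" and x: "x \<le> C * z"
  shows "a * x + b * h \<le> (C * (a * (inverse m)) + sqrt 2 * (b * sqrt (inverse m))) * c"
proof -
  have z: "z \<le> c * inverse m"
  proof (cases "z = 0")
    case False
    have "m * z\<^sup>2 \<le> c * z" using energy zero_le_power2[of h] by linarith
    then have "m * z * z \<le> c * z" by (simp add: power2_eq_square mult.assoc)
    then have "m * z \<le> c" using False assms by (simp add: mult_le_cancel_right)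
    then show ?thesis using assms by (simp add: field_simps)
  qed (use assms in simp)
  have "0 \<le> m * z\<^sup>2" using assms by simp
  then have "h\<^sup>2 \<le> 2 * (c * z)" using energy by linarith
  also have "\<dots> \<le> 2 * (c * (c * inverse m))" using z assms by (intro mult_left_mono) auto
  also have "\<dots> = (sqrt 2 * sqrt (inverse m) * c)\<^sup>2"
    unfolding power_mult_distrib using assms by (simp add: power2_eq_square[of c])
  finally have h: "h \<le> sqrt 2 * sqrt (inverse m) * c"
    by (rule power2_le_imp_le) (use assms in auto)
  have "a * x \<le> a * (C * (c * inverse m))"
    by (rule mult_left_mono[OF order_trans[OF x mult_left_mono[OF z]]]) (use assms in auto)
  moreover have "b * h \<le> b * (sqrt 2 * sqrt (inverse m) * c)" by (rule mult_left_mono[OF h]) (use assms in auto)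
  ultimately show ?thesis by (simp add: algebra_simps)
qed

text \<open>Trial and Test are abstract so that all three problems become instances, and they do not
  vary with \<omega>, which allows countable dense choices common to all \<omega>.
  \<open>stable\<close> provides, for each test function, a trial function on which B is large;
  existence and uniqueness come from the hypothesis on u.\<close>

theorem solution_in_Lp:
  fixes Trial :: "(real \<Rightarrow> 'v) set"
    and Test :: "((real \<Rightarrow> 'v) \<times> (real \<Rightarrow> 'v \<Rightarrow>\<^sub>L real) \<times> (real \<Rightarrow> 'h)) set"
  assumes Trial: "Trial \<subseteq> L2 T UNIV" "Trial \<noteq> {}"
      "\<And>y z. y \<in> Trial \<Longrightarrow> z \<in> Trial \<Longrightarrow> (\<lambda>t. y t + z t) \<in> Trial"
      "\<And>c y. y \<in> Trial \<Longrightarrow> (\<lambda>t. c *\<^sub>R y t) \<in> Trial" "closed (l2_of T ` Trial)"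
    and Test: "\<And>x g xH. (x, g, xH) \<in> Test \<Longrightarrow> x \<in> L2 T UNIV \<and> g \<in> L2 T UNIV" "Test \<noteq> {}"
      "\<And>x g xH x' g' xH'. (x, g, xH) \<in> Test \<Longrightarrow> (x', g', xH') \<in> Test \<Longrightarrow>
         (\<lambda>t. x t + x' t, \<lambda>t. g t + g' t, \<lambda>t. xH t + xH' t) \<in> Test"
      "\<And>c x g xH. (x, g, xH) \<in> Test \<Longrightarrow> (\<lambda>t. c *\<^sub>R x t, \<lambda>t. c *\<^sub>R g t, \<lambda>t. c *\<^sub>R xH t) \<in> Test"
    and C: "0 \<le> C"
    and stable: "AE \<omega> in M. \<forall>(x, g, xH)\<in>Test. \<exists>z\<in>Trial.
      (norm (xH 0))\<^sup>2 / 2 + Amin \<omega> * (L2_norm T z)\<^sup>2 \<le> B_star T (\<lambda>t. A t \<omega>) z x g \<and>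
      L2_norm T x \<le> C * L2_norm T z"
    and u: "AE \<omega> in M. unique_solution T (\<lambda>t. A t \<omega>) (\<lambda>t. f t \<omega>) (u0 \<omega>) Trial Test (u \<omega>)"
  shows "in_Lp M p (L2 T UNIV) (L2_norm T) u"
proof -
  define S where "S = l2_of T ` Trial"
  have S: "closed S" "subspace S" unfolding S_def by (rule Trial(5), rule subspace_l2_of[OF Trial(1-4)])
  define K where "K \<omega> = (\<lambda>(x, g, xH). rep \<omega> x g) ` Test" for \<omega>
  define ok where "ok \<omega> \<longleftrightarrow> good \<omega> \<and>
    unique_solution T (\<lambda>t. A t \<omega>) (\<lambda>t. f t \<omega>) (u0 \<omega>) Trial Test (u \<omega>)" for \<omega>
  have AE_ok: "AE \<omega> in M. ok \<omega>" using AE_good u by eventually_elim (simp add: ok_def)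
  have K: "subspace (K \<omega>)" if \<omega>: "good \<omega>" for \<omega>
  proof (rule subspaceI)
    obtain \<phi> where "\<phi> \<in> Test" using Test(2) by blast
    then obtain x g xH where *: "(x, g, xH) \<in> Test" by (cases \<phi>) blast
    have "rep \<omega> (\<lambda>t. 0 *\<^sub>R x t) (\<lambda>t. 0 *\<^sub>R g t) \<in> K \<omega>"
      unfolding K_def by (rule image_eqI[OF _ Test(4)[OF *, of 0]]) simp
    then show "0 \<in> K \<omega>" using rep_scaleR[OF \<omega>, of x g 0] Test(1)[OF *] by simp
  next
    fix a b assume "a \<in> K \<omega>" "b \<in> K \<omega>"
    then obtain x g xH x' g' xH' where *: "(x, g, xH) \<in> Test" "a = rep \<omega> x g"
      "(x', g', xH') \<in> Test" "b = rep \<omega> x' g'" by (auto simp: K_def)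
    have "a + b = rep \<omega> (\<lambda>t. x t + x' t) (\<lambda>t. g t + g' t)"
      using rep_add[OF \<omega>] Test(1)[OF *(1)] Test(1)[OF *(3)] * by simp
    then show "a + b \<in> K \<omega>" unfolding K_def by (intro image_eqI[OF _ Test(3)[OF *(1,3)]]) simp
  next
    fix c a assume "a \<in> K \<omega>"
    then obtain x g xH where *: "(x, g, xH) \<in> Test" "a = rep \<omega> x g" by (auto simp: K_def)
    have "c *\<^sub>R a = rep \<omega> (\<lambda>t. c *\<^sub>R x t) (\<lambda>t. c *\<^sub>R g t)"
      using rep_scaleR[OF \<omega>] Test(1)[OF *(1)] * by simp
    then show "c *\<^sub>R a \<in> K \<omega>" unfolding K_def by (intro image_eqI[OF _ Test(4)[OF *(1)]]) simp
  qed
  have solD: "u \<omega> \<in> Trial"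
    "\<And>x g xH. (x, g, xH) \<in> Test \<Longrightarrow> l2_of T (u \<omega>) \<bullet> rep \<omega> x g = F_load T (\<lambda>t. f t \<omega>) (u0 \<omega>) x xH"
    "\<And>z. z \<in> Trial \<Longrightarrow> (\<And>x g xH. (x, g, xH) \<in> Test \<Longrightarrow>
        l2_of T z \<bullet> rep \<omega> x g = F_load T (\<lambda>t. f t \<omega>) (u0 \<omega>) x xH) \<Longrightarrow> l2_of T z = l2_of T (u \<omega>)"
    if "ok \<omega>" for \<omega>
  proof -
    have \<omega>: "good \<omega>" and sol: "unique_solution T (\<lambda>t. A t \<omega>) (\<lambda>t. f t \<omega>) (u0 \<omega>) Trial Test (u \<omega>)"
      using that by (auto simp: ok_def)
    show uT: "u \<omega> \<in> Trial" using sol by (simp add: unique_solution_def Let_def)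
    have eq: "B_star T (\<lambda>t. A t \<omega>) z x g = l2_of T z \<bullet> rep \<omega> x g" if "z \<in> Trial" "(x, g, xH) \<in> Test" for z x g xH
      using B_star_eq(1)[OF \<omega>] Test(1)[OF that(2)] Trial(1) that(1) by blast
    show "l2_of T (u \<omega>) \<bullet> rep \<omega> x g = F_load T (\<lambda>t. f t \<omega>) (u0 \<omega>) x xH" if "(x, g, xH) \<in> Test" for x g xH
      using sol that eq[OF uT that] by (auto simp: unique_solution_def Let_def)
    fix z assume z: "z \<in> Trial"
      and zeq: "\<And>x g xH. (x, g, xH) \<in> Test \<Longrightarrow> l2_of T z \<bullet> rep \<omega> x g = F_load T (\<lambda>t. f t \<omega>) (u0 \<omega>) x xH"
    have "\<forall>(x, g, xH)\<in>Test. B_star T (\<lambda>t. A t \<omega>) z x g = F_load T (\<lambda>t. f t \<omega>) (u0 \<omega>) x xH"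
      using eq[OF z] zeq by auto
    then have "AE t in time_measure T. z t = u \<omega> t" using sol z by (simp add: unique_solution_def Let_def)
    then show "l2_of T z = l2_of T (u \<omega>)" using z uT Trial(1) by (subst l2_of_eq_iff) auto
  qed
  \<comment> \<open>Uniqueness in linear form: adding to u \<omega> a trial function orthogonal to K
    \<omega> gives another solution, so its class is 0.\<close>
  have total: "z = 0" if \<omega>: "ok \<omega>" and z: "z \<in> S" and orth: "\<And>k. k \<in> K \<omega> \<Longrightarrow> z \<bullet> k = 0" for \<omega> z
  proof -
    obtain y where y: "y \<in> Trial" "z = l2_of T y" using z by (auto simp: S_def)
    have add: "l2_of T (\<lambda>t. u \<omega> t + y t) = l2_of T (u \<omega>) + z"
      using l2_of_add Trial(1) solD(1)[OF \<omega>] y by blast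
    have "l2_of T (\<lambda>t. u \<omega> t + y t) = l2_of T (u \<omega>)"
    proof (rule solD(3)[OF \<omega> Trial(3)[OF solD(1)[OF \<omega>] y(1)]])
      fix x g xH assume *: "(x, g, xH) \<in> Test"
      then have "rep \<omega> x g \<in> K \<omega>" unfolding K_def by (intro image_eqI[OF _ *]) simp
      then show "l2_of T (\<lambda>t. u \<omega> t + y t) \<bullet> rep \<omega> x g = F_load T (\<lambda>t. f t \<omega>) (u0 \<omega>) x xH"
        using solD(2)[OF \<omega> *] orth by (simp add: add inner_add_left)
    qed
    then show ?thesis using add by simp
  qed
  have u_bound: "AE \<omega> in M. 0 \<le> L2_norm T (u \<omega>) \<and> L2_norm T (u \<omega>) \<le> bound C \<omega>"
    using AE_ok stable
  proof eventually_elim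
    fix \<omega> assume \<omega>: "ok \<omega>"
      and st: "\<forall>(x, g, xH)\<in>Test. \<exists>z\<in>Trial. (norm (xH 0))\<^sup>2 / 2 + Amin \<omega> * (L2_norm T z)\<^sup>2
        \<le> B_star T (\<lambda>t. A t \<omega>) z x g \<and> L2_norm T x \<le> C * L2_norm T z"
    have g: "good \<omega>" using \<omega> by (simp add: ok_def)
    have uS: "l2_of T (u \<omega>) \<in> S" unfolding S_def using solD(1)[OF \<omega>] by blast
    have "norm (l2_of T (u \<omega>)) \<le> bound C \<omega>"
    proof (rule norm_le_dual_on_subspace[OF S K[OF g] total[OF \<omega>] uS])
      fix k c assume "k \<in> K \<omega>" and c: "0 \<le> c" and le: "\<And>z. z \<in> S \<Longrightarrow> z \<bullet> k \<le> c * norm z"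
      then obtain x g xH where *: "(x, g, xH) \<in> Test" "k = rep \<omega> x g" by (auto simp: K_def)
      obtain z where z: "z \<in> Trial" "L2_norm T x \<le> C * L2_norm T z"
        "(norm (xH 0))\<^sup>2 / 2 + Amin \<omega> * (L2_norm T z)\<^sup>2 \<le> B_star T (\<lambda>t. A t \<omega>) z x g"
        using st *(1) by blast
      have L2: "x \<in> L2 T UNIV" "g \<in> L2 T UNIV" "z \<in> L2 T UNIV" using Test(1)[OF *(1)] Trial(1) z(1) by auto
      have f: "(\<lambda>t. f t \<omega>) \<in> L2 T UNIV" using \<open>good \<omega>\<close> by (simp add: good_def)
      have "B_star T (\<lambda>t. A t \<omega>) z x g \<le> c * L2_norm T z"
        using le[of "l2_of T z"] z(1) by (simp add: S_def B_star_eq(1)[OF \<open>good \<omega>\<close> L2(3,1,2)] *(2) norm_l2_of L2)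
      then have energy: "(norm (xH 0))\<^sup>2 / 2 + Amin \<omega> * (L2_norm T z)\<^sup>2 \<le> c * L2_norm T z"
        using z(3) by linarith
      have m: "0 < Amin \<omega>" using \<open>good \<omega>\<close> by (simp add: good_def)
      have n: "0 \<le> L2_norm T y" for y :: "real \<Rightarrow> 'b::real_normed_vector" by (simp add: L2_norm_def)
      have "l2_of T (u \<omega>) \<bullet> k = l2_of T x \<bullet> l2_of T (\<lambda>t. riesz (f t \<omega>)) + u0 \<omega> \<bullet> xH 0"
        using solD(2)[OF \<omega> *(1)] *(2) integrable_apply_L2(2)[OF f L2(1)] by (simp add: F_load_def)
      also have "\<dots> \<le> norm (l2_of T x) * norm (l2_of T (\<lambda>t. riesz (f t \<omega>))) + norm (u0 \<omega>) * norm (xH 0)"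
        by (intro add_mono norm_cauchy_schwarz)
      also have "\<dots> = L2_norm T (\<lambda>t. f t \<omega>) * L2_norm T x + norm (u0 \<omega>) * norm (xH 0)"
        using L2(1) L2_riesz[OF f] by (simp add: norm_l2_of L2_norm_riesz mult.commute)
      also have "\<dots> \<le> bound C \<omega> * c"
        using coercive_bound[OF m c n norm_ge_zero n norm_ge_zero C energy z(2)] m by (simp add: bound_def)
      finally show "l2_of T (u \<omega>) \<bullet> k \<le> bound C \<omega> * c" .
    qed
    then show "0 \<le> L2_norm T (u \<omega>) \<and> L2_norm T (u \<omega>) \<le> bound C \<omega>"
      using norm_l2_of[of "u \<omega>" T] solD(1)[OF \<omega>] Trial(1) by (auto simp: L2_norm_def)
  qed
  obtain Q where Q: "countable Q" "Q \<subseteq> S" "S \<subseteq> closure Q" by (rule countable_dense_subset)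
  then obtain D where D: "countable D" "D \<subseteq> Trial" "Q = l2_of T ` D"
    unfolding S_def using countable_subset_image by metis
  \<comment> \<open>The data of a test function on which \<open>rep\<close> depends, placed in a
    separable metric space that does not involve \<omega>.\<close>
  define enc where "enc = (\<lambda>(x :: real \<Rightarrow> 'v, g, xH :: real \<Rightarrow> 'h). (l2_of T x, l2_of T (\<lambda>t. riesz (g t :: 'v \<Rightarrow>\<^sub>L real))))"
  obtain R where R: "countable R" "R \<subseteq> enc ` Test" "enc ` Test \<subseteq> closure R" by (rule countable_dense_subset)
  then obtain \<Phi> where \<Phi>: "countable \<Phi>" "\<Phi> \<subseteq> Test" "R = enc ` \<Phi>"
    using countable_subset_image by metis
  have K_dense: "K \<omega> \<subseteq> closure ((\<lambda>(x, g, xH). rep \<omega> x g) ` \<Phi>)" if \<omega>: "good \<omega>" for \<omega>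
  proof
    fix k assume "k \<in> K \<omega>"
    then obtain x g xH where *: "(x, g, xH) \<in> Test" "k = rep \<omega> x g" by (auto simp: K_def)
    show "k \<in> closure ((\<lambda>(x, g, xH). rep \<omega> x g) ` \<Phi>)"
      unfolding closure_approachable
    proof (intro allI impI)
      fix e :: real assume e: "e > 0"
      have Am: "0 < Amax \<omega>" using \<omega> by (simp add: good_def)
      \<comment> \<open>Makes the estimate Amax \<omega> * d + d of \<open>rep_dist\<close> equal to
        e.\<close>
      define d where "d = e / (Amax \<omega> + 1)"
      have d: "d > 0" using e Am by (simp add: d_def)
      have "enc (x, g, xH) \<in> closure R" using R(3) *(1) by blast
      then obtain r where "r \<in> R" "dist r (enc (x, g, xH)) < d" using d unfolding closure_approachable by blast
      then obtain x' g' xH' where **: "(x', g', xH') \<in> \<Phi>" "dist (enc (x', g', xH')) (enc (x, g, xH)) < d"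
        unfolding \<Phi>(3) by auto
      have "dist (l2_of T x') (l2_of T x) < d"
        "dist (l2_of T (\<lambda>t. riesz (g' t))) (l2_of T (\<lambda>t. riesz (g t))) < d"
        using **(2) dist_fst_le[of "enc (x', g', xH')" "enc (x, g, xH)"] dist_snd_le[of "enc (x', g', xH')" "enc (x, g, xH)"]
        by (auto simp: enc_def)
      moreover have "x \<in> L2 T UNIV" "x' \<in> L2 T UNIV" using Test(1) *(1) **(1) \<Phi>(2) by blast+
      ultimately have "norm (rep \<omega> x' g' - rep \<omega> x g) < Amax \<omega> * d + d"
        using rep_dist[OF \<omega>, of x' x g' g] mult_strict_left_mono[OF _ Am, of "norm (l2_of T x' - l2_of T x)" d]
        by (simp add: dist_norm)
      also have "Amax \<omega> * d + d = (Amax \<omega> + 1) * d" by (simp add: distrib_right)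
      also have "\<dots> = e" using Am by (simp add: d_def)
      finally show "\<exists>y\<in>(\<lambda>(x, g, xH). rep \<omega> x g) ` \<Phi>. dist y k < e"
        using **(1) *(2) by (intro bexI[OF _ image_eqI[OF _ **(1)]]) (auto simp: dist_norm)
    qed
  qed
  define \<rho> where "\<rho> d \<omega> = norm (l2_of T (u \<omega>) - l2_of T d)" for d \<omega>
  \<comment> \<open>Sublevel sets are described, for almost every \<omega>, by countably many
    conditions on measurable functions.\<close>
  have \<rho>: "\<rho> d \<in> borel_measurable M" if d: "d \<in> D" for d
    unfolding borel_measurable_iff_le
  proof
    fix r
    show "{\<omega> \<in> space M. \<rho> d \<omega> \<le> r} \<in> sets M"
    proof (cases "0 \<le> r")
      case False
      then have "{\<omega> \<in> space M. \<rho> d \<omega> \<le> r} = {}"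
        unfolding \<rho>_def by (auto dest: order_trans[OF norm_ge_zero])
      then show ?thesis by (simp only: sets.empty_sets)
    next
      case True
      \<comment> \<open>The solution has disappeared from this condition: tested with \<phi> it
        equals \<open>F_load\<close>. The supremum runs over the fixed countable set D.\<close>
      define E where "E \<phi> \<omega> \<longleftrightarrow> (case \<phi> of (x, g, xH) \<Rightarrow>
        ennreal \<bar>F_load T (\<lambda>t. f t \<omega>) (u0 \<omega>) x xH - B_sym d x g \<omega>\<bar>
          \<le> ennreal r * (SUP z\<in>D. ennreal (\<bar>B_sym z x g \<omega>\<bar> / norm (l2_of T z))))" for \<phi> \<omega>
      show ?thesis
      proof (rule measurable_if_AE_iff)
        show "{\<omega> \<in> space M. \<forall>\<phi>\<in>\<Phi>. E \<phi> \<omega>} \<in> sets M"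
        proof -
          have "{\<omega> \<in> space M. E \<phi> \<omega>} \<in> sets M" if "\<phi> \<in> \<Phi>" for \<phi>
          proof -
            obtain x g xH where \<phi>: "\<phi> = (x, g, xH)" by (cases \<phi>)
            have "(x, g, xH) \<in> Test" using that \<phi> \<Phi>(2) by blast
            then have xg: "x \<in> borel_measurable (time_measure T)" "g \<in> borel_measurable (time_measure T)"
              using Test(1)[of x g xH] L2D(1) by auto
            have B [measurable]: "B_sym z x g \<in> borel_measurable M" if "z \<in> D" for z
            proof -
              have "z \<in> L2 T UNIV" using that D(2) Trial(1) by blast
              from B_sym_measurable[OF L2D(1)[OF this] xg] show ?thesis .
            qed
            note [measurable] = F_load_measurable[OF xg(1), of xH] B[OF d]
            have "(\<lambda>\<omega>. SUP z\<in>D. ennreal (\<bar>B_sym z x g \<omega>\<bar> / norm (l2_of T z))) \<in> borel_measurable M"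
              by (rule borel_measurable_SUP[OF D(1)]) measurable
            note [measurable] = this
            show ?thesis unfolding E_def \<phi> prod.case by measurable
          qed
          then have "space M - (\<Union>\<phi>\<in>\<Phi>. space M - {\<omega> \<in> space M. E \<phi> \<omega>}) \<in> sets M"
            by (intro sets.Diff sets.countable_UN''[OF \<Phi>(1)]) auto
          also have "space M - (\<Union>\<phi>\<in>\<Phi>. space M - {\<omega> \<in> space M. E \<phi> \<omega>}) = {\<omega> \<in> space M. \<forall>\<phi>\<in>\<Phi>. E \<phi> \<omega>}"
            by auto
          finally show ?thesis .
        qed
        show "AE \<omega> in M. \<rho> d \<omega> \<le> r \<longleftrightarrow> (\<forall>\<phi>\<in>\<Phi>. E \<phi> \<omega>)"
          using AE_ok
        proof eventually_elim
          fix \<omega> assume \<omega>: "ok \<omega>"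
          then have g: "good \<omega>" by (simp add: ok_def)
          have yS: "l2_of T (u \<omega>) - l2_of T d \<in> S"
            using solD(1)[OF \<omega>] d D(2) by (intro subspace_diff[OF S(2)]) (auto simp: S_def)
          have K0: "(\<lambda>(x, g, xH). rep \<omega> x g) ` \<Phi> \<subseteq> K \<omega>" unfolding K_def using \<Phi>(2) by blast
          have QS: "l2_of T ` D \<subseteq> S" "S \<subseteq> closure (l2_of T ` D)" using Q D by auto
          define h where "h = (\<lambda>(x, g, xH :: real \<Rightarrow> 'h). rep \<omega> x g)"
          define P where "P k \<longleftrightarrow> ennreal \<bar>(l2_of T (u \<omega>) - l2_of T d) \<bullet> k\<bar>
              \<le> ennreal r * (SUP z\<in>l2_of T ` D. ennreal (\<bar>z \<bullet> k\<bar> / norm z))" for k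
          have iff: "\<rho> d \<omega> \<le> r \<longleftrightarrow> (\<forall>k\<in>h ` \<Phi>. P k)"
            unfolding \<rho>_def P_def h_def
            by (rule norm_le_iff_countable_dual[OF S K[OF g] total[OF \<omega>] QS K0 K_dense[OF g] yS True])
          have "P (h \<phi>) \<longleftrightarrow> E \<phi> \<omega>" if "\<phi> \<in> \<Phi>" for \<phi>
          proof -
            obtain x g xH where \<phi>: "\<phi> = (x, g, xH)" by (cases \<phi>)
            with that have T': "(x, g, xH) \<in> Test" using \<Phi>(2) by blast
            have B: "B_sym z x g \<omega> = l2_of T z \<bullet> rep \<omega> x g" if "z \<in> D" for z
              using B_star_eq(2)[OF \<open>good \<omega>\<close>] Test(1)[OF T'] that D(2) Trial(1) by blast
            have "(SUP z\<in>D. ennreal (\<bar>B_sym z x g \<omega>\<bar> / norm (l2_of T z)))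
                = (SUP z\<in>l2_of T ` D. ennreal (\<bar>z \<bullet> rep \<omega> x g\<bar> / norm z))"
              unfolding image_image by (rule SUP_cong) (simp_all add: B)
            then show ?thesis
              by (simp add: P_def h_def E_def \<phi> B[OF d] inner_diff_left solD(2)[OF \<omega> T'])
          qed
          then show "\<rho> d \<omega> \<le> r \<longleftrightarrow> (\<forall>\<phi>\<in>\<Phi>. E \<phi> \<omega>)" unfolding iff by blast
        qed
      qed
    qed
  qed
  have D_ne: "D \<noteq> {}" using Q(3) D(3) Trial(2) by (auto simp: S_def)
  show ?thesis
  proof (rule in_LpI_countable_dense[OF D(1) D_ne _ \<rho>])
    show "D \<subseteq> L2 T UNIV" using D(2) Trial(1) by blast
    show "Lp_bounded M p (\<lambda>\<omega>. L2_norm T (u \<omega>))"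
      by (rule Lp_bounded_mono[OF bound_Lp[OF C] u_bound])
    show "AE \<omega> in M. u \<omega> \<in> L2 T UNIV \<and> (\<forall>d\<in>D. L2_norm T (u \<omega> - d) = \<rho> d \<omega> \<and> 0 \<le> \<rho> d \<omega>)
        \<and> (\<forall>e>0. \<exists>d\<in>D. \<rho> d \<omega> < e)"
      using AE_ok
    proof eventually_elim
      fix \<omega> assume \<omega>: "ok \<omega>"
      have uL: "u \<omega> \<in> L2 T UNIV" using solD(1)[OF \<omega>] Trial(1) by blast
      have 1: "L2_norm T (u \<omega> - d) = \<rho> d \<omega>" if "d \<in> D" for d
      proof -
        have dL: "d \<in> L2 T UNIV" using that D(2) Trial(1) by blast
        then show ?thesis
          unfolding \<rho>_def l2_of_diff[OF uL dL, symmetric] fun_diff_def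
          by (rule norm_l2_of[OF L2_diff[OF uL _ subspace_UNIV], symmetric])
      qed
      have 2: "\<exists>d\<in>D. \<rho> d \<omega> < e" if "e > 0" for e
      proof -
        have "l2_of T (u \<omega>) \<in> closure (l2_of T ` D)" using Q(3) D(3) solD(1)[OF \<omega>] by (auto simp: S_def)
        from closure_approachable[THEN iffD1, rule_format, OF this that]
        obtain d where "d \<in> D" "dist (l2_of T d) (l2_of T (u \<omega>)) < e" by blast
        then show ?thesis by (auto simp: \<rho>_def dist_norm norm_minus_commute intro!: bexI[of _ d])
      qed
      show "u \<omega> \<in> L2 T UNIV \<and> (\<forall>d\<in>D. L2_norm T (u \<omega> - d) = \<rho> d \<omega> \<and> 0 \<le> \<rho> d \<omega>)
        \<and> (\<forall>e>0. \<exists>d\<in>D. \<rho> d \<omega> < e)" using uL 1 2 by (simp add: \<rho>_def)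
    qed
  qed
qed

end

section \<open>Linear structure of the test spaces\<close>

lemma dual_of_riesz: "blinfun_inner_right (riesz f) = (f :: 'v::{real_inner,banach} \<Rightarrow>\<^sub>L real)"
  by (rule blinfun_eqI) (simp add: inner_commute[of "riesz f"] riesz)

lemma borel_measurable_dual_iff:
  fixes g :: "'a \<Rightarrow> 'v::{real_inner,banach,second_countable_topology} \<Rightarrow>\<^sub>L real"
  shows "g \<in> borel_measurable M \<longleftrightarrow> (\<lambda>t. riesz (g t)) \<in> borel_measurable M"
proof
  assume "(\<lambda>t. riesz (g t)) \<in> borel_measurable M"
  then have "(\<lambda>t. blinfun_inner_right (riesz (g t))) \<in> borel_measurable M"
    by (rule borel_measurable_continuous_on[rotated])
      (intro linear_continuous_on bounded_linear_blinfun_inner_right)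
  then show "g \<in> borel_measurable M" by (simp add: dual_of_riesz)
qed (rule borel_measurable_riesz)

text \<open>The closure properties of \<open>L2\<close> are proved for values in an inner product
  space; this transfers them to the derivatives, whose values are functionals.\<close>

lemma L2_dual_iff:
  fixes g :: "real \<Rightarrow> 'v::{real_inner,banach,second_countable_topology} \<Rightarrow>\<^sub>L real"
  shows "g \<in> L2 T UNIV \<longleftrightarrow> (\<lambda>t. riesz (g t)) \<in> L2 T UNIV"
  by (simp add: L2_def borel_measurable_dual_iff[of g] riesz)

lemma L2_dual_add:
  fixes g :: "real \<Rightarrow> 'v::{real_inner,banach,second_countable_topology} \<Rightarrow>\<^sub>L real"
  assumes "g \<in> L2 T UNIV" "g' \<in> L2 T UNIV"
  shows "(\<lambda>t. g t + g' t) \<in> L2 T UNIV"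
  using assms L2_add[of "\<lambda>t. riesz (g t)" T UNIV "\<lambda>t. riesz (g' t)"] by (simp add: L2_dual_iff riesz_add)

lemma L2_dual_scaleR:
  fixes g :: "real \<Rightarrow> 'v::{real_inner,banach,second_countable_topology} \<Rightarrow>\<^sub>L real"
  assumes "g \<in> L2 T UNIV"
  shows "(\<lambda>t. c *\<^sub>R g t) \<in> L2 T UNIV"
  using assms L2_scaleR[of "\<lambda>t. riesz (g t)" T UNIV c] by (simp add: L2_dual_iff riesz_scaleR)

lemma integrable_continuous_mult:
  fixes \<phi> h :: "real \<Rightarrow> real"
  assumes \<phi>: "continuous_on UNIV \<phi>" and h: "integrable (time_measure T) h"
  shows "integrable (time_measure T) (\<lambda>t. \<phi> t * h t)"
proof -
  have "bounded (\<phi> ` {0..T})"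
    by (intro compact_imp_bounded compact_continuous_image continuous_on_subset[OF \<phi>]) auto
  then obtain B where "\<forall>x\<in>\<phi> ` {0..T}. norm x \<le> B" unfolding bounded_iff by blast
  then have B: "\<bar>\<phi> t\<bar> \<le> B" if "t \<in> {0..T}" for t using that by simp
  have m: "\<phi> \<in> borel_measurable (time_measure T)"
    by (intro borel_measurable_time borel_measurable_continuous_onI \<phi>)
  show ?thesis
  proof (rule Bochner_Integration.integrable_bound)
    show "integrable (time_measure T) (\<lambda>t. B * h t)" using h by auto
    show "(\<lambda>t. \<phi> t * h t) \<in> borel_measurable (time_measure T)"
      using m h by (intro borel_measurable_times) auto
    show "AE t in time_measure T. norm (\<phi> t * h t) \<le> norm (B * h t)"
    proof (rule AE_I2)
      fix t assume "t \<in> space (time_measure T)"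
      then have "\<bar>\<phi> t\<bar> \<le> \<bar>B\<bar>" using B[of t] by simp
      then show "norm (\<phi> t * h t) \<le> norm (B * h t)" by (simp add: abs_mult mult_right_mono)
    qed
  qed
qed

lemma test_function_continuous:
  assumes "test_function T \<phi>"
  shows "continuous_on UNIV \<phi>" "continuous_on UNIV (deriv \<phi>)"
proof -
  have "(deriv ^^ n) \<phi> differentiable (at t)" for n t using assms unfolding test_function_def by blast
  from this[of 0] this[of 1] show "continuous_on UNIV \<phi>" "continuous_on UNIV (deriv \<phi>)"
    by (auto intro!: continuous_at_imp_continuous_on differentiable_imp_continuous_within)
qed

lemma integrable_to_dual:
  fixes emb :: "'v::{real_inner,banach,second_countable_topology} \<Rightarrow>\<^sub>L 'h::real_inner"
  assumes "x \<in> L2 T UNIV"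
  shows "integrable (time_measure T) (\<lambda>t. to_dual emb (x t) w)"
  using l2_of_inner(2)[OF assms L2_const[of "riesz (to_dual emb w)"]]
  by (simp add: riesz to_dual_apply inner_commute)

lemma weak_derivative_add:
  fixes emb :: "'v::{real_inner,banach,second_countable_topology} \<Rightarrow>\<^sub>L 'h::real_inner"
  assumes "x \<in> L2 T UNIV" "g \<in> L2 T UNIV" "x' \<in> L2 T UNIV" "g' \<in> L2 T UNIV"
    and "weak_derivative emb T W x g" "weak_derivative emb T W x' g'"
  shows "weak_derivative emb T W (\<lambda>t. x t + x' t) (\<lambda>t. g t + g' t)"
  unfolding weak_derivative_def
proof (intro allI impI ballI)
  fix \<phi> w assume \<phi>: "test_function T \<phi>" and w: "w \<in> W"
  note c = test_function_continuous[OF \<phi>]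
  note int = integrable_continuous_mult[OF c(2) integrable_to_dual] integrable_continuous_mult[OF c(1) integrable_apply_L2(1)[OF _ L2_const]]
  have "(LINT t|time_measure T. deriv \<phi> t * to_dual emb (x t + x' t) w)
      = (LINT t|time_measure T. deriv \<phi> t * to_dual emb (x t) w) + (LINT t|time_measure T. deriv \<phi> t * to_dual emb (x' t) w)"
    using int(1)[OF assms(1), of emb w] int(1)[OF assms(3), of emb w]
    by (simp add: to_dual_apply blinfun.add_right inner_add_left distrib_left)
  also have "\<dots> = - (LINT t|time_measure T. \<phi> t * g t w) + - (LINT t|time_measure T. \<phi> t * g' t w)"
    unfolding assms(5,6)[unfolded weak_derivative_def, rule_format, OF \<phi> w] ..
  also have "\<dots> = - (LINT t|time_measure T. \<phi> t * (g t + g' t) w)"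
    using int(2)[OF assms(2), of w] int(2)[OF assms(4), of w] by (simp add: blinfun.add_left distrib_left)
  finally show "(LINT t|time_measure T. deriv \<phi> t * to_dual emb (x t + x' t) w)
      = - (LINT t|time_measure T. \<phi> t * (g t + g' t) w)" .
qed

lemma weak_derivative_scaleR:
  fixes emb :: "'v::{real_inner,banach,second_countable_topology} \<Rightarrow>\<^sub>L 'h::real_inner"
  assumes "weak_derivative emb T W x g"
  shows "weak_derivative emb T W (\<lambda>t. c *\<^sub>R x t) (\<lambda>t. c *\<^sub>R g t)"
  unfolding weak_derivative_def
proof (intro allI impI ballI)
  fix \<phi> w assume \<phi>: "test_function T \<phi>" and w: "w \<in> W"
  have "c * (LINT t|time_measure T. deriv \<phi> t * to_dual emb (x t) w) = c * - (LINT t|time_measure T. \<phi> t * g t w)"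
    unfolding assms[unfolded weak_derivative_def, rule_format, OF \<phi> w] ..
  then show "(LINT t|time_measure T. deriv \<phi> t * to_dual emb (c *\<^sub>R x t) w)
      = - (LINT t|time_measure T. \<phi> t * (c *\<^sub>R g t) w)"
    by (simp add: to_dual_apply blinfun.scaleR_right blinfun.scaleR_left mult.left_commute)
qed

lemma test_space_add:
  fixes emb :: "'v::{real_inner,banach,second_countable_topology} \<Rightarrow>\<^sub>L 'h::real_inner"
  assumes X: "(x, g, xH) \<in> test_space emb T W" and X': "(x', g', xH') \<in> test_space emb T W" and W: "subspace W"
  shows "(\<lambda>t. x t + x' t, \<lambda>t. g t + g' t, \<lambda>t. xH t + xH' t) \<in> test_space emb T W"
proof -
  note x = test_spaceD[OF X] and x' = test_spaceD[OF X']
  have "AE t in time_measure T. xH t + xH' t = emb (x t + x' t)"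
    using x(5) x'(5) by eventually_elim (simp add: blinfun.add_right)
  then show ?thesis unfolding test_space_def
    using L2_add[OF x(1) x'(1) W] L2_dual_add[OF x(2) x'(2)] x(6) x'(6)
      weak_derivative_add[OF L2_UNIV[OF x(1)] x(2) L2_UNIV[OF x'(1)] x'(2) x(3) x'(3)]
      continuous_on_add[OF x(4) x'(4)] by simp
qed

lemma test_space_scaleR:
  fixes emb :: "'v::{real_inner,banach,second_countable_topology} \<Rightarrow>\<^sub>L 'h::real_inner"
  assumes X: "(x, g, xH) \<in> test_space emb T W" and W: "subspace W"
  shows "(\<lambda>t. c *\<^sub>R x t, \<lambda>t. c *\<^sub>R g t, \<lambda>t. c *\<^sub>R xH t) \<in> test_space emb T W"
proof -
  note x = test_spaceD[OF X]
  have "AE t in time_measure T. c *\<^sub>R xH t = emb (c *\<^sub>R x t)"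
    using x(5) by eventually_elim (simp add: blinfun.scaleR_right)
  moreover have "continuous_on {0..T} (\<lambda>t. c *\<^sub>R xH t)" by (intro continuous_intros x(4))
  ultimately show ?thesis unfolding test_space_def
    using L2_scaleR[OF x(1) W] L2_dual_scaleR[OF x(2)] x(6) weak_derivative_scaleR[OF x(3)] by simp
qed

lemma test_space_zero:
  fixes emb :: "'v::{real_inner,banach,second_countable_topology} \<Rightarrow>\<^sub>L 'h::real_inner"
  assumes "subspace W"
  shows "(\<lambda>t. 0, \<lambda>t. 0, \<lambda>t. 0) \<in> test_space emb T W"
  using L2_zero[OF assms] by (auto simp: test_space_def weak_derivative_def to_dual_apply L2_def)

context parabolic_problem
begin

lemma integrable_A:
  assumes \<omega>: "good \<omega>" and z: "z \<in> L2 T UNIV" and x: "x \<in> L2 T UNIV"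
  shows "integrable (time_measure T) (\<lambda>t. A t \<omega> (z t) (x t))"
proof -
  have "integrable (time_measure T) (\<lambda>t. x t \<bullet> Ax \<omega> z t)"
    by (rule l2_of_inner(2)[OF x Ax_L2(1)[OF \<omega> z]])
  then show ?thesis by (simp add: Ax_def riesz)
qed

lemma B_star_split:
  assumes "good \<omega>" "z \<in> L2 T UNIV" "x \<in> L2 T UNIV" "g \<in> L2 T UNIV"
  shows "B_star T (\<lambda>t. A t \<omega>) z x g
    = - (LINT t|time_measure T. g t (z t)) + (LINT t|time_measure T. A t \<omega> (z t) (x t))"
  unfolding B_star_def
  using integrable_A[OF assms(1-3)] integrable_apply_L2(1)[OF assms(4,2)] by simp

lemma A_coercive_integral:
  assumes \<omega>: "good \<omega>" and c: "\<forall>t\<in>{0..T}. \<forall>v. Amin \<omega> * (norm v)\<^sup>2 \<le> A t \<omega> v v" and z: "z \<in> L2 T UNIV"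
  shows "Amin \<omega> * (L2_norm T z)\<^sup>2 \<le> (LINT t|time_measure T. A t \<omega> (z t) (z t))"
proof -
  have "Amin \<omega> * (L2_norm T z)\<^sup>2 = (LINT t|time_measure T. Amin \<omega> * (norm (z t))\<^sup>2)"
    unfolding L2_norm_def by (subst real_sqrt_pow2) auto
  also have "\<dots> \<le> (LINT t|time_measure T. A t \<omega> (z t) (z t))"
    by (rule integral_mono[OF _ integrable_A[OF \<omega> z z]]) (use L2D(2)[OF z] c time_mem in auto)
  finally show ?thesis .
qed

text \<open>Serves u with W = UNIV and each semidiscrete solution with W = Vh h. Test functions are
  admissible trial functions here, so the constant of stability is 1.\<close>

lemma semidiscrete_in_Lp:
  assumes W: "subspace W" "closed W"
    and u: "AE \<omega> in M. unique_solution T (\<lambda>t. A t \<omega>) (\<lambda>t. f t \<omega>) (u0 \<omega>) (L2 T W) (test_space emb T W) (u \<omega>)"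
  shows "in_Lp M p (L2 T UNIV) (L2_norm T) u"
proof (rule solution_in_Lp[where Trial="L2 T W" and Test="test_space emb T W" and C=1])
  show "L2 T W \<subseteq> L2 T UNIV" using L2_UNIV by blast
  show "L2 T W \<noteq> {}" using L2_zero[OF W(1)] by blast
  show "test_space emb T W \<noteq> {}" using test_space_zero[OF W(1)] by blast
  show "x \<in> L2 T UNIV \<and> g \<in> L2 T UNIV" if "(x, g, xH) \<in> test_space emb T W" for x g xH
    using test_spaceD(1,2)[OF that] L2_UNIV by blast
  show "AE \<omega> in M. \<forall>(x, g, xH)\<in>test_space emb T W. \<exists>z\<in>L2 T W.
      (norm (xH 0))\<^sup>2 / 2 + Amin \<omega> * (L2_norm T z)\<^sup>2 \<le> B_star T (\<lambda>t. A t \<omega>) z x g \<and> L2_norm T x \<le> 1 * L2_norm T z"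
    using AE_good A_coercive
  proof eventually_elim
    fix \<omega> assume \<omega>: "good \<omega>" and c: "\<forall>t\<in>{0..T}. \<forall>v. Amin \<omega> * (norm v)\<^sup>2 \<le> A t \<omega> v v"
    have "(norm (xH 0))\<^sup>2 / 2 + Amin \<omega> * (L2_norm T x)\<^sup>2 \<le> B_star T (\<lambda>t. A t \<omega>) x x g"
      if X: "(x, g, xH) \<in> test_space emb T W" for x g xH
    proof -
      have L: "x \<in> L2 T UNIV" "g \<in> L2 T UNIV" using test_spaceD(1,2)[OF X] L2_UNIV by blast+
      show ?thesis
        using B_star_split[OF \<omega> L(1,1,2)] test_space_energy[OF X W(1) T] A_coercive_integral[OF \<omega> c L(1)] by simp
    qed
    then show "\<forall>(x, g, xH)\<in>test_space emb T W. \<exists>z\<in>L2 T W.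
      (norm (xH 0))\<^sup>2 / 2 + Amin \<omega> * (L2_norm T z)\<^sup>2 \<le> B_star T (\<lambda>t. A t \<omega>) z x g \<and> L2_norm T x \<le> 1 * L2_norm T z"
      using test_spaceD(1) by fastforce
  qed
qed (use W u in \<open>auto intro: L2_add L2_scaleR closed_l2_of_L2 test_space_add test_space_scaleR\<close>)

end

section \<open>Piecewise polynomials in time\<close>

lemma tensor_space_add:
  assumes "y \<in> tensor_space Q W" "z \<in> tensor_space Q W"
  shows "(\<lambda>t. y t + z t) \<in> tensor_space Q W"
proof -
  obtain m :: nat and \<phi> w where y: "y = (\<lambda>t. \<Sum>j<m. \<phi> j t *\<^sub>R w j)" "\<forall>j<m. \<phi> j \<in> Q \<and> w j \<in> W"
    using assms(1) unfolding tensor_space_def by blast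
  obtain n :: nat and \<psi> v where z: "z = (\<lambda>t. \<Sum>j<n. \<psi> j t *\<^sub>R v j)" "\<forall>j<n. \<psi> j \<in> Q \<and> v j \<in> W"
    using assms(2) unfolding tensor_space_def by blast
  let ?\<phi> = "\<lambda>j. if j < m then \<phi> j else \<psi> (j - m)" and ?w = "\<lambda>j. if j < m then w j else v (j - m)"
  have "(\<Sum>j<m + n. ?\<phi> j t *\<^sub>R ?w j) = y t + z t" for t
  proof -
    have "(\<Sum>j<m + n. ?\<phi> j t *\<^sub>R ?w j) = (\<Sum>j\<in>{0..<m}. ?\<phi> j t *\<^sub>R ?w j) + (\<Sum>j\<in>{m..<m + n}. ?\<phi> j t *\<^sub>R ?w j)"
      unfolding lessThan_atLeast0 by (rule sum.atLeastLessThan_concat[symmetric]) auto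
    also have "(\<Sum>j\<in>{m..<m + n}. ?\<phi> j t *\<^sub>R ?w j) = (\<Sum>j\<in>{0..<n}. \<psi> j t *\<^sub>R v j)"
      using sum.shift_bounds_nat_ivl[of "\<lambda>j. ?\<phi> j t *\<^sub>R ?w j" 0 m n] by (simp add: add.commute)
    finally show ?thesis by (simp add: y z lessThan_atLeast0)
  qed
  moreover have "\<forall>j<m + n. ?\<phi> j \<in> Q \<and> ?w j \<in> W" using y z by auto
  ultimately show ?thesis unfolding tensor_space_def
    by (intro CollectI exI[of _ "m + n"] exI[of _ ?\<phi>] exI[of _ ?w]) auto
qed

lemma tensor_space_scaleR:
  assumes "y \<in> tensor_space Q W" "subspace W"
  shows "(\<lambda>t. c *\<^sub>R y t) \<in> tensor_space Q W"
proof -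
  obtain m :: nat and \<phi> w where y: "y = (\<lambda>t. \<Sum>j<m. \<phi> j t *\<^sub>R w j)" "\<forall>j<m. \<phi> j \<in> Q \<and> w j \<in> W"
    using assms(1) unfolding tensor_space_def by blast
  then show ?thesis unfolding tensor_space_def
    by (intro CollectI exI[of _ m] exI[of _ \<phi>] exI[of _ "\<lambda>j. c *\<^sub>R w j"])
      (auto simp: scaleR_sum_right mult.commute intro: subspace_mul[OF assms(2)])
qed

lemma tensor_space_single: "\<phi> \<in> Q \<Longrightarrow> w \<in> W \<Longrightarrow> (\<lambda>t. \<phi> t *\<^sub>R w) \<in> tensor_space Q W"
  unfolding tensor_space_def
  by (intro CollectI exI[of _ 1] exI[of _ "\<lambda>_. \<phi>"] exI[of _ "\<lambda>_. w"]) auto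

lemma tensor_space_mono: "Q \<subseteq> Q' \<Longrightarrow> tensor_space Q W \<subseteq> tensor_space Q' W"
  unfolding tensor_space_def by blast

lemma L2_sum:
  fixes y :: "'i \<Rightarrow> real \<Rightarrow> 'v::{real_inner,banach,second_countable_topology}"
  assumes "finite I" "\<And>i. i \<in> I \<Longrightarrow> y i \<in> L2 T W" "subspace W"
  shows "(\<lambda>t. \<Sum>i\<in>I. y i t) \<in> L2 T W"
  using assms by (induction I) (auto intro: L2_zero L2_add)

lemma l2_of_sum:
  fixes y :: "'i \<Rightarrow> real \<Rightarrow> 'v::{real_inner,banach,second_countable_topology}"
  assumes "finite I" "\<And>i. i \<in> I \<Longrightarrow> y i \<in> L2 T UNIV"
  shows "l2_of T (\<lambda>t. \<Sum>i\<in>I. y i t) = (\<Sum>i\<in>I. l2_of T (y i))"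
  using assms
proof (induction I)
  case empty
  show ?case using l2_of_scaleR[OF L2_zero[OF subspace_UNIV], of T 0] by simp
next
  case (insert i I)
  have "(\<lambda>t. \<Sum>i\<in>I. y i t) \<in> L2 T UNIV" by (rule L2_sum) (use insert in auto)
  then show ?case using insert l2_of_add[of "y i" T "\<lambda>t. \<Sum>i\<in>I. y i t"] by simp
qed

lemma L2_bounded:
  assumes m: "y \<in> borel_measurable (time_measure T)"
    and B: "\<And>t. t \<in> {0<..<T} \<Longrightarrow> norm (y t) \<le> B" and W: "\<And>t. t \<in> {0<..<T} \<Longrightarrow> y t \<in> W"
  shows "y \<in> L2 T W"
proof -
  note [measurable] = m
  interpret finite_measure "time_measure T" by (rule finite_time_measure)
  have "integrable (time_measure T) (\<lambda>t. (norm (y t))\<^sup>2)"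
    by (rule integrable_const_bound[of _ "B\<^sup>2"]) (use B in \<open>auto intro!: AE_I2 power_mono\<close>)
  moreover have "AE t in time_measure T. y t \<in> W" using W by (intro AE_I2) simp
  ultimately show ?thesis using m by (simp add: L2_def)
qed

text \<open>A null set contains no nonempty open interval, so the zeros are dense in [0,T].\<close>

lemma continuous_AE_zero:
  fixes h :: "real \<Rightarrow> 'a::real_normed_vector"
  assumes h: "continuous_on {0..T} h" and T: "0 < T" and ae: "AE t in time_measure T. h t = 0" and t: "t \<in> {0..T}"
  shows "h t = 0"
proof -
  let ?Z = "{s \<in> {0<..<T}. h s = 0}"
  obtain N where N: "{s \<in> space lborel. \<not> (0 < s \<and> s < T \<longrightarrow> h s = 0)} \<subseteq> N" "emeasure lborel N = 0" "N \<in> sets lborel"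
    using ae unfolding AE_time_measure by (rule AE_E)
  have tZ: "t \<in> closure ?Z"
    unfolding closure_approachable
  proof (intro allI impI)
    fix e :: real assume e: "e > 0"
    define a b where "a = max 0 (t - e)" and "b = min T (t + e)"
    have ab: "a < b" using T t e by (auto simp: a_def b_def)
    have "\<not> {a<..<b} \<subseteq> N"
    proof
      assume "{a<..<b} \<subseteq> N"
      then have "emeasure lborel {a<..<b} \<le> emeasure lborel N" using N(3) by (rule emeasure_mono)
      then show False using N(2) ab by simp
    qed
    then obtain s where s: "s \<in> {a<..<b}" "s \<notin> N" by blast
    then have "s \<in> ?Z" using N(1) by (auto simp: a_def b_def)
    moreover have "dist s t < e" using s by (auto simp: a_def b_def dist_real_def)
    ultimately show "\<exists>y\<in>?Z. dist y t < e" by blast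
  qed
  have "closure ?Z \<subseteq> {0..T}" by (intro closure_minimal) auto
  from continuous_constant_on_closure[OF continuous_on_subset[OF h this] _ tZ, of 0] show ?thesis by simp
qed

text \<open>The integrated form of the weak derivative is known only for interior endpoints. The
  intervals [e n, T - e n] exhaust (0,T), and on each of them the criterion with arbitrary rational
  intervals applies.\<close>

lemma AE_zero_if_interior_integrals_zero:
  fixes h :: "real \<Rightarrow> real"
  assumes T: "0 < T" and h: "integrable (time_measure T) h"
    and zero: "\<And>s t. 0 < s \<Longrightarrow> s < t \<Longrightarrow> t < T \<Longrightarrow> (LINT r|time_measure T. indicator {s..t} r * h r) = 0"
  shows "AE t in time_measure T. h t = 0"
proof -
  have hm: "h \<in> borel_measurable (time_measure T)" using h by auto
  obtain k where k [measurable]: "k \<in> borel_measurable borel"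
    and eq: "AE t in lborel. k t = (if 0 < t \<and> t < T then h t else 0)"
    using time_representative[OF hm] .
  have kint: "integrable lborel k" using time_integral(1)[OF hm k eq] h by simp
  have zero': "(LINT r|lborel. indicator {s..t} r * k r) = 0" if "0 < s" "s < t" "t < T" for s t
  proof -
    have im: "(indicator {s..t} :: real \<Rightarrow> real) \<in> borel_measurable (time_measure T)"
      by (rule borel_measurable_time) measurable
    have "(LINT r|time_measure T. indicator {s..t} r * h r) = (LINT r|lborel. indicator {s..t} r * k r)"
    proof (rule time_integral(2))
      show "(\<lambda>r. indicator {s..t} r * h r) \<in> borel_measurable (time_measure T)"
        by (rule borel_measurable_times[OF im hm])
      show "(\<lambda>r. indicator {s..t} r * k r) \<in> borel_measurable borel" by measurable
      show "AE r in lborel. indicator {s..t} r * k r = (if 0 < r \<and> r < T then indicator {s..t} r * h r else 0)"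
        using eq by eventually_elim simp
    qed
    then show ?thesis using zero[OF that] by simp
  qed
  define e where "e n = T / real (n + 3)" for n :: nat
  have "AE t in lborel. indicator {e n..T - e n} t * k t = 0" for n
  proof (rule AE_zero_if_integrals_zero)
    have ki: "integrable lborel (\<lambda>t. indicator {u..v} t * k t)" for u v
      using integrable_mult_indicator[OF _ kint, of "{u..v}"] by simp
    have ind: "indicator {a..b} t * (indicator {u..v} t * k t) = indicator {max a u..min b v} t * k t" for a b u v t :: real
      by (auto simp: indicator_def)
    show "integrable lborel (\<lambda>t. indicator {a..b} t * (indicator {e n..T - e n} t * k t))" for a b
      unfolding ind by (rule ki)
    show "(LINT t|lborel. indicator {a..b} t * (indicator {e n..T - e n} t * k t)) = 0" for a b
    proof -
      let ?s = "max a (e n)" and ?t = "min b (T - e n)"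
      have en: "0 < e n" using T by (simp add: e_def)
      consider "?s < ?t" | "?s = ?t" | "?t < ?s" by linarith
      then have "(LINT t|lborel. indicator {?s..?t} t * k t) = 0"
      proof cases
        case 1
        then show ?thesis using en by (intro zero') auto
      next
        case 2
        have "AE t in lborel. t \<noteq> ?s" by (rule AE_lborel_singleton)
        then have "AE t in lborel. indicator {?s..?t} t * k t = 0"
          unfolding 2[symmetric] by eventually_elim (simp add: indicator_def)
        then show ?thesis by (rule integral_eq_zero_AE)
      qed simp
      then show ?thesis unfolding ind .
    qed
  qed measurable
  then have "AE t in lborel. \<forall>n. indicator {e n..T - e n} t * k t = 0" unfolding AE_all_countable by blast
  then have "AE t in lborel. 0 < t \<and> t < T \<longrightarrow> h t = 0"
    using eq
  proof eventually_elim
    fix t assume all: "\<forall>n. indicator {e n..T - e n} t * k t = 0"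
      and kt: "k t = (if 0 < t \<and> t < T then h t else 0)"
    show "0 < t \<and> t < T \<longrightarrow> h t = 0"
    proof
      assume t: "0 < t \<and> t < T"
      define d where "d = min t (T - t)"
      have d: "0 < d" using t by (simp add: d_def)
      obtain n where n: "T / d < real n" using reals_Archimedean2 by blast
      have "e n \<le> d"
      proof -
        have "T < real n * d" using n d by (simp add: pos_divide_less_eq)
        also have "\<dots> \<le> real (n + 3) * d" using d by (intro mult_right_mono) auto
        finally show ?thesis by (simp add: e_def pos_divide_le_eq mult.commute)
      qed
      then have "t \<in> {e n..T - e n}" by (auto simp: d_def)
      then show "h t = 0" using all[rule_format, of n] kt t by simp
    qed
  qed
  then show ?thesis by (simp add: AE_time_measure)
qed

lemma bounded_linear_to_dual: "bounded_linear (to_dual emb)"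
  unfolding to_dual_def
  by (intro bounded_linear_compose[OF bounded_bilinear.bounded_linear_left[OF bounded_bilinear_blinfun_compose]]
      bounded_linear_compose[OF bounded_linear_blinfun_inner_right blinfun.bounded_linear_right])

section \<open>Partitions and spaces of piecewise polynomials\<close>

locale time_partition =
  fixes T :: real and N :: nat and \<tau> :: "nat \<Rightarrow> real"
  assumes part: "is_partition T N \<tau>" and T: "0 < T"
begin

lemma node_bounds: "\<tau> 0 = 0" "\<tau> N = T"
  using part by (auto simp: is_partition_def)

lemma node_less: "i < N \<Longrightarrow> \<tau> i < \<tau> (Suc i)"
  using part by (auto simp: is_partition_def)

lemma node_mono: "i \<le> j \<Longrightarrow> j \<le> N \<Longrightarrow> \<tau> i \<le> \<tau> j"
proof (induction j)
  case (Suc j)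
  then show ?case using node_less[of j] by (cases "i = Suc j") auto
qed simp

lemma interval_subset: "i < N \<Longrightarrow> {\<tau> i<..<\<tau> (Suc i)} \<subseteq> {0<..<T}" "i < N \<Longrightarrow> {\<tau> i..\<tau> (Suc i)} \<subseteq> {0..T}"
  using node_mono[of 0 i] node_mono[of "Suc i" N] node_bounds by auto

lemma interval_disjoint:
  assumes "i < N" "j < N" "t \<in> {\<tau> i<..<\<tau> (Suc i)}" "t \<in> {\<tau> j<..<\<tau> (Suc j)}"
  shows "i = j"
proof (rule ccontr)
  assume "i \<noteq> j"
  then consider "Suc i \<le> j" | "Suc j \<le> i" by linarith
  then show False using node_mono[of "Suc i" j] node_mono[of "Suc j" i] assms by cases auto
qed

lemma interval_cover:
  assumes "0 < t" "t < T" "t \<notin> \<tau> ` {..N}"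
  obtains i where "i < N" "t \<in> {\<tau> i<..<\<tau> (Suc i)}"
proof -
  define j where "j = (LEAST j. t \<le> \<tau> j)"
  have "t \<le> \<tau> N" using assms node_bounds by simp
  then have j: "t \<le> \<tau> j" "j \<le> N" unfolding j_def by (rule LeastI, rule Least_le)
  have "j \<noteq> 0" using j(1) assms(1) node_bounds by (cases j) auto
  then obtain i where i: "j = Suc i" by (cases j) auto
  have "\<not> t \<le> \<tau> i" using not_less_Least[of i "\<lambda>j. t \<le> \<tau> j"] i by (simp add: j_def)
  moreover have "t \<noteq> \<tau> (Suc i)" using assms(3) j(2) i by auto
  ultimately show ?thesis using that[of i] j i by auto
qed

lemma AE_interval: "AE t in time_measure T. t \<in> {0<..<T} \<and> t \<notin> \<tau> ` {..N}"
proof -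
  have "\<tau> ` {..N} \<in> null_sets lborel" by (rule finite_imp_null_set_lborel) simp
  then have "AE t in lborel. t \<notin> \<tau> ` {..N}" by (rule AE_not_in)
  then show ?thesis unfolding AE_time_measure by eventually_elim simp
qed

lemma pw_poly_pieces:
  assumes "\<phi> \<in> pw_poly N \<tau> q"
  obtains P where "\<And>i. i < N \<Longrightarrow> degree (P i) \<le> q"
    "\<And>i t. i < N \<Longrightarrow> t \<in> {\<tau> i<..<\<tau> (Suc i)} \<Longrightarrow> \<phi> t = poly (P i) t"
proof -
  have "\<forall>i. \<exists>P. i < N \<longrightarrow> degree P \<le> q \<and> (\<forall>t\<in>{\<tau> i<..<\<tau> (Suc i)}. \<phi> t = poly P t)"
    using assms by (auto simp: pw_poly_def)
  from choice[OF this] show ?thesis using that by blast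
qed

lemma sum_interval:
  fixes a :: "nat \<Rightarrow> 'b::comm_monoid_add"
  assumes "i < N" "t \<in> {\<tau> i<..<\<tau> (Suc i)}"
  shows "(\<Sum>j<N. if t \<in> {\<tau> j<..<\<tau> (Suc j)} then a j else 0) = a i"
proof -
  have "(\<Sum>j<N. if t \<in> {\<tau> j<..<\<tau> (Suc j)} then a j else 0) = (\<Sum>j<N. if j = i then a j else 0)"
  proof (rule sum.cong[OF refl])
    fix j assume "j \<in> {..<N}"
    then have "t \<in> {\<tau> j<..<\<tau> (Suc j)} \<longleftrightarrow> j = i"
      using interval_disjoint[OF assms(1) _ assms(2), of j] assms(2) by blast
    then show "(if t \<in> {\<tau> j<..<\<tau> (Suc j)} then a j else 0) = (if j = i then a j else 0)" by simp
  qed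
  then show ?thesis using assms(1) by simp
qed

text \<open>Values at the nodes are unrestricted. On (0,T) the function is a sum \<psi> of cut-off
  polynomials plus a correction \<eta> supported on the finitely many nodes.\<close>

lemma pw_poly_bounded_measurable:
  assumes "\<phi> \<in> pw_poly N \<tau> q"
  shows "\<phi> \<in> borel_measurable (time_measure T)" "\<exists>B. \<forall>t\<in>{0<..<T}. \<bar>\<phi> t\<bar> \<le> B"
proof -
  obtain P where P: "\<And>i. i < N \<Longrightarrow> degree (P i) \<le> q"
    "\<And>i t. i < N \<Longrightarrow> t \<in> {\<tau> i<..<\<tau> (Suc i)} \<Longrightarrow> \<phi> t = poly (P i) t"
    using pw_poly_pieces[OF assms] by blast
  define \<psi> where "\<psi> t = (\<Sum>j<N. if t \<in> {\<tau> j<..<\<tau> (Suc j)} then poly (P j) t else 0)" for t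
  define \<eta> where "\<eta> t = (\<Sum>s\<in>\<tau> ` {..N}. if t = s then \<phi> s - \<psi> s else 0)" for t
  have eq: "\<phi> t = \<psi> t + \<eta> t" if t: "t \<in> {0<..<T}" for t
  proof (cases "t \<in> \<tau> ` {..N}")
    case True
    then have "\<eta> t = \<phi> t - \<psi> t" unfolding \<eta>_def by (subst sum.delta') auto
    then show ?thesis by simp
  next
    case False
    obtain i where i: "i < N" "t \<in> {\<tau> i<..<\<tau> (Suc i)}" using interval_cover[OF _ _ False] t by auto
    have "\<eta> t = 0" unfolding \<eta>_def by (rule sum.neutral) (use False in auto)
    then show ?thesis using sum_interval[OF i, of "\<lambda>j. poly (P j) t"] P(2)[OF i] by (simp add: \<psi>_def)
  qed
  have "continuous_on UNIV (poly (P j))" for j by (intro continuous_intros)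
  then have [measurable]: "poly (P j) \<in> borel_measurable borel" for j by (rule borel_measurable_continuous_onI)
  have "(\<lambda>t. \<psi> t + \<eta> t) \<in> borel_measurable borel" unfolding \<psi>_def \<eta>_def by measurable
  then have "(\<lambda>t. \<psi> t + \<eta> t) \<in> borel_measurable (time_measure T)" by (rule borel_measurable_time)
  then show "\<phi> \<in> borel_measurable (time_measure T)"
    by (rule measurable_cong[THEN iffD1, rotated]) (use eq in simp)
  have "\<exists>B. 0 \<le> B \<and> (\<forall>t\<in>{0..T}. \<bar>poly (P j) t\<bar> \<le> B)" for j
  proof -
    have "bounded (poly (P j) ` {0..T})"
      by (intro compact_imp_bounded compact_continuous_image continuous_intros) simp
    then obtain B where "\<forall>x\<in>poly (P j) ` {0..T}. norm x \<le> B" unfolding bounded_iff by blast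
    then have "\<bar>poly (P j) t\<bar> \<le> \<bar>B\<bar>" if "t \<in> {0..T}" for t
      using that abs_ge_self[of B] by (auto intro: order_trans)
    then show ?thesis by (intro exI[of _ "\<bar>B\<bar>"]) auto
  qed
  then have "\<forall>j. \<exists>B. 0 \<le> B \<and> (\<forall>t\<in>{0..T}. \<bar>poly (P j) t\<bar> \<le> B)" by blast
  from choice[OF this] obtain B where B: "\<And>j. 0 \<le> B j" "\<And>j t. t \<in> {0..T} \<Longrightarrow> \<bar>poly (P j) t\<bar> \<le> B j" by blast
  have "\<bar>\<phi> t\<bar> \<le> (\<Sum>j<N. B j) + (\<Sum>s\<in>\<tau> ` {..N}. \<bar>\<phi> s - \<psi> s\<bar>)" if t: "t \<in> {0<..<T}" for t
  proof -
    have "\<bar>\<psi> t\<bar> \<le> (\<Sum>j<N. B j)"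
      unfolding \<psi>_def by (rule order_trans[OF sum_abs sum_mono]) (use B t in auto)
    moreover have "\<bar>\<eta> t\<bar> \<le> (\<Sum>s\<in>\<tau> ` {..N}. \<bar>\<phi> s - \<psi> s\<bar>)"
      unfolding \<eta>_def by (rule order_trans[OF sum_abs sum_mono]) auto
    ultimately show ?thesis unfolding eq[OF t] by linarith
  qed
  then show "\<exists>B. \<forall>t\<in>{0<..<T}. \<bar>\<phi> t\<bar> \<le> B" by blast
qed

lemma pw_poly_scaleR_L2:
  fixes w :: "'v::{real_inner,banach,second_countable_topology}"
  assumes "\<phi> \<in> pw_poly N \<tau> q" "w \<in> W" "subspace W"
  shows "(\<lambda>t. \<phi> t *\<^sub>R w) \<in> L2 T W"
proof -
  note [measurable] = pw_poly_bounded_measurable(1)[OF assms(1)]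
  obtain B where B: "\<And>t. t \<in> {0<..<T} \<Longrightarrow> \<bar>\<phi> t\<bar> \<le> B" using pw_poly_bounded_measurable(2)[OF assms(1)] by blast
  show ?thesis
  proof (rule L2_bounded)
    show "norm (\<phi> t *\<^sub>R w) \<le> B * norm w" if "t \<in> {0<..<T}" for t
      using B[OF that] by (simp add: mult_right_mono)
  qed (use assms subspace_mul in auto)
qed

lemma tensor_space_L2:
  fixes W :: "'v::{real_inner,banach,second_countable_topology} set"
  assumes "y \<in> tensor_space (pw_poly N \<tau> q) W" "subspace W"
  shows "y \<in> L2 T W"
proof -
  obtain m :: nat and \<phi> w where y: "y = (\<lambda>t. \<Sum>j<m. \<phi> j t *\<^sub>R w j)" "\<forall>j<m. \<phi> j \<in> pw_poly N \<tau> q \<and> w j \<in> W"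
    using assms(1) unfolding tensor_space_def by blast
  show ?thesis unfolding y(1) by (rule L2_sum) (use y(2) assms(2) in \<open>auto intro: pw_poly_scaleR_L2\<close>)
qed

lemma indicator_pw_poly:
  assumes "i < N" "degree P \<le> q"
  shows "(\<lambda>t. if t \<in> {\<tau> i<..<\<tau> (Suc i)} then poly P t else 0) \<in> pw_poly N \<tau> q"
  unfolding pw_poly_def
proof (intro CollectI allI impI)
  fix j assume j: "j < N"
  show "\<exists>P'. degree P' \<le> q \<and> (\<forall>t\<in>{\<tau> j<..<\<tau> (Suc j)}. (if t \<in> {\<tau> i<..<\<tau> (Suc i)} then poly P t else 0) = poly P' t)"
  proof (cases "j = i")
    case True
    then show ?thesis using assms by (intro exI[of _ P]) auto
  next
    case False
    have "t \<notin> {\<tau> i<..<\<tau> (Suc i)}" if "t \<in> {\<tau> j<..<\<tau> (Suc j)}" for t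
      using interval_disjoint[OF j assms(1) that] False by blast
    then show ?thesis by (intro exI[of _ 0]) (simp del: greaterThanLessThan_iff)
  qed
qed

text \<open>As a set of functions the tensor space has infinite dimension, since values outside
  (0,T) are arbitrary. Its classes are spanned by the monomials t^k on single intervals times basis
  vectors of the space in V.\<close>

lemma tensor_space_finite_dim:
  fixes B :: "'v::{real_inner,banach,second_countable_topology} set"
  assumes "finite B"
  obtains E where "finite E" "l2_of T ` tensor_space (pw_poly N \<tau> q) (span B) \<subseteq> span E"
proof -
  define e where "e i k w = (\<lambda>t. (if t \<in> {\<tau> i<..<\<tau> (Suc i)} then poly (monom 1 k) t else 0) *\<^sub>R w)" for i k and w :: 'v
  have e_L2: "e i k w \<in> L2 T UNIV" if "i < N" for i k w
    unfolding e_def by (rule pw_poly_scaleR_L2[OF indicator_pw_poly[OF that order_refl]]) auto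
  define E where "E = (\<lambda>(i, k, b). l2_of T (e i k b)) ` ({..<N} \<times> {..q} \<times> B)"
  have fin: "finite E" unfolding E_def using assms by (intro finite_imageI finite_cartesian_product) auto
  have e_span: "l2_of T (e i k w) \<in> span E" if i: "i < N" and k: "k \<le> q" and w: "w \<in> span B" for i k w
  proof -
    have "linear (\<lambda>w. l2_of T (e i k w))"
    proof
      show "l2_of T (e i k (v + w)) = l2_of T (e i k v) + l2_of T (e i k w)" for v w
        using l2_of_add[OF e_L2[OF i, of k v] e_L2[OF i, of k w]] by (simp add: e_def scaleR_add_right)
      show "l2_of T (e i k (c *\<^sub>R w)) = c *\<^sub>R l2_of T (e i k w)" for c w
        using l2_of_scaleR[OF e_L2[OF i, of k w], of c] by (simp add: e_def mult.commute)
    qed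
    then have "l2_of T (e i k w) \<in> span ((\<lambda>w. l2_of T (e i k w)) ` B)"
      using w by (subst linear_span_image) auto
    moreover have "(\<lambda>w. l2_of T (e i k w)) ` B \<subseteq> E"
    proof
      fix z assume "z \<in> (\<lambda>w. l2_of T (e i k w)) ` B"
      then obtain b where "b \<in> B" "z = l2_of T (e i k b)" by blast
      then show "z \<in> E" unfolding E_def using i k by (intro image_eqI[of _ _ "(i, k, b)"]) auto
    qed
    ultimately show ?thesis using span_mono by blast
  qed
  have single: "l2_of T (\<lambda>t. \<phi> t *\<^sub>R w) \<in> span E" if \<phi>: "\<phi> \<in> pw_poly N \<tau> q" and w: "w \<in> span B" for \<phi> w
  proof -
    obtain P where P: "\<And>i. i < N \<Longrightarrow> degree (P i) \<le> q"
      "\<And>i t. i < N \<Longrightarrow> t \<in> {\<tau> i<..<\<tau> (Suc i)} \<Longrightarrow> \<phi> t = poly (P i) t"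
      using pw_poly_pieces[OF \<phi>] by blast
    define y where "y t = (\<Sum>i<N. \<Sum>k\<le>q. coeff (P i) k *\<^sub>R e i k w t)" for t
    have eL: "(\<lambda>t. coeff (P i) k *\<^sub>R e i k w t) \<in> L2 T UNIV" if "i < N" for i k
      by (rule L2_scaleR[OF e_L2[OF that]]) simp
    have y_L2: "y \<in> L2 T UNIV" unfolding y_def
      by (intro L2_sum) (auto intro: eL)
    have "l2_of T y = (\<Sum>i<N. \<Sum>k\<le>q. coeff (P i) k *\<^sub>R l2_of T (e i k w))"
    proof -
      have "l2_of T y = (\<Sum>i<N. l2_of T (\<lambda>t. \<Sum>k\<le>q. coeff (P i) k *\<^sub>R e i k w t))"
        unfolding y_def by (rule l2_of_sum) (auto intro!: L2_sum eL)
      also have "\<dots> = (\<Sum>i<N. \<Sum>k\<le>q. coeff (P i) k *\<^sub>R l2_of T (e i k w))"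
      proof (rule sum.cong[OF refl])
        fix i assume "i \<in> {..<N}"
        then have i: "i < N" by simp
        have "l2_of T (\<lambda>t. \<Sum>k\<le>q. coeff (P i) k *\<^sub>R e i k w t) = (\<Sum>k\<le>q. l2_of T (\<lambda>t. coeff (P i) k *\<^sub>R e i k w t))"
          by (rule l2_of_sum) (auto intro: eL[OF i])
        then show "l2_of T (\<lambda>t. \<Sum>k\<le>q. coeff (P i) k *\<^sub>R e i k w t) = (\<Sum>k\<le>q. coeff (P i) k *\<^sub>R l2_of T (e i k w))"
          by (simp add: l2_of_scaleR[OF e_L2[OF i]])
      qed
      finally show ?thesis .
    qed
    also have "\<dots> \<in> span E" by (intro span_sum span_scale e_span w) auto
    finally have "l2_of T y \<in> span E" .
    moreover have "l2_of T (\<lambda>t. \<phi> t *\<^sub>R w) = l2_of T y"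
    proof (subst l2_of_eq_iff[OF pw_poly_scaleR_L2[OF \<phi> UNIV_I subspace_UNIV] y_L2])
      show "AE t in time_measure T. \<phi> t *\<^sub>R w = y t"
        using AE_interval
      proof eventually_elim
        fix t assume t: "t \<in> {0<..<T} \<and> t \<notin> \<tau> ` {..N}"
        then obtain i where i: "i < N" "t \<in> {\<tau> i<..<\<tau> (Suc i)}" using interval_cover[of t] by auto
        have "(\<Sum>k\<le>q. coeff (P j) k *\<^sub>R e j k w t)
            = (if t \<in> {\<tau> j<..<\<tau> (Suc j)} then poly (P j) t *\<^sub>R w else 0)" if "j < N" for j
        proof -
          have "poly (P j) t = (\<Sum>k\<le>q. coeff (P j) k * t ^ k)"
            unfolding poly_altdef
            by (rule sum.mono_neutral_left) (use P(1)[OF that] in \<open>auto simp: coeff_eq_0\<close>)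
          then show ?thesis
            by (cases "t \<in> {\<tau> j<..<\<tau> (Suc j)}")
              (simp_all add: e_def poly_monom scaleR_sum_left del: greaterThanLessThan_iff)
        qed
        then have "y t = (\<Sum>j<N. if t \<in> {\<tau> j<..<\<tau> (Suc j)} then poly (P j) t *\<^sub>R w else 0)"
          unfolding y_def by (intro sum.cong) auto
        also have "\<dots> = poly (P i) t *\<^sub>R w" by (rule sum_interval[OF i])
        finally show "\<phi> t *\<^sub>R w = y t" using P(2)[OF i] by simp
      qed
    qed
    ultimately show ?thesis by simp
  qed
  have "l2_of T ` tensor_space (pw_poly N \<tau> q) (span B) \<subseteq> span E"
  proof
    fix z assume "z \<in> l2_of T ` tensor_space (pw_poly N \<tau> q) (span B)"
    then obtain m :: nat and \<phi> w where z: "z = l2_of T (\<lambda>t. \<Sum>j<m. \<phi> j t *\<^sub>R w j)"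
      and \<phi>: "\<forall>j<m. \<phi> j \<in> pw_poly N \<tau> q \<and> w j \<in> span B"
      unfolding tensor_space_def by blast
    have "z = (\<Sum>j<m. l2_of T (\<lambda>t. \<phi> j t *\<^sub>R w j))"
      unfolding z by (rule l2_of_sum) (use \<phi> in \<open>auto intro!: pw_poly_scaleR_L2\<close>)
    also have "\<dots> \<in> span E" by (intro span_sum single) (use \<phi> in auto)
    finally show "z \<in> span E" .
  qed
  with fin show ?thesis by (rule that)
qed

end

lemma integrable_indicator_time:
  fixes h :: "real \<Rightarrow> real"
  assumes "integrable (time_measure T) h"
  shows "integrable (time_measure T) (\<lambda>r. indicator {s..t} r * h r)"
proof (rule Bochner_Integration.integrable_bound[OF assms])
  have "(indicator {s..t} :: real \<Rightarrow> real) \<in> borel_measurable (time_measure T)"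
    by (rule borel_measurable_time) measurable
  then show "(\<lambda>r. indicator {s..t} r * h r) \<in> borel_measurable (time_measure T)"
    using assms by (intro borel_measurable_times) auto
qed (auto simp: indicator_def)

lemma time_integral_interval:
  fixes h :: "real \<Rightarrow> real"
  assumes "integrable (time_measure T) h" "0 < s" "t < T"
  shows "(LINT r|time_measure T. indicator {s..t} r * h r) = integral {s..t} h"
proof -
  have "(LINT r|time_measure T. indicator {s..t} r * h r) = integral {0<..<T} (\<lambda>r. indicator {s..t} r * h r)"
    by (rule lebesgue_integral_eq_integral[OF integrable_indicator_time[OF assms(1)]]) simp
  also have "\<dots> = integral {0<..<T} (\<lambda>r. if r \<in> {s..t} then h r else 0)"
    by (rule Henstock_Kurzweil_Integration.integral_cong) auto
  also have "\<dots> = integral ({s..t} \<inter> {0<..<T}) h" by (rule integral_restrict_Int)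
  also have "{s..t} \<inter> {0<..<T} = {s..t}" using assms by auto
  finally show ?thesis .
qed

lemma L2_bounded_linear:
  fixes z :: "real \<Rightarrow> 'v::{real_inner,banach,second_countable_topology}"
    and f :: "'v \<Rightarrow> 'w::{real_inner,banach,second_countable_topology}"
  assumes f: "bounded_linear f" and z: "z \<in> L2 T UNIV"
  shows "(\<lambda>t. f (z t)) \<in> L2 T UNIV"
proof -
  obtain K where K: "0 < K" "\<And>x. norm (f x) \<le> norm x * K" using bounded_linear.pos_bounded[OF f] by blast
  have [measurable]: "(\<lambda>t. f (z t)) \<in> borel_measurable (time_measure T)"
    by (rule borel_measurable_continuous_on[OF linear_continuous_on[OF f] L2D(1)[OF z]])
  have "integrable (time_measure T) (\<lambda>t. (norm (f (z t)))\<^sup>2)"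
  proof (rule Bochner_Integration.integrable_bound)
    show "integrable (time_measure T) (\<lambda>t. (norm (z t))\<^sup>2 * K\<^sup>2)" using L2D(2)[OF z] by simp
    show "AE t in time_measure T. norm ((norm (f (z t)))\<^sup>2) \<le> norm ((norm (z t))\<^sup>2 * K\<^sup>2)"
      using power_mono[OF K(2) norm_ge_zero, of _ 2] by (intro AE_I2) (simp add: power_mult_distrib)
  qed measurable
  then show ?thesis by (simp add: L2_def)
qed

section \<open>Weak derivatives of discrete test functions and stability\<close>

context time_partition
begin

text \<open>Differentiation costs one degree, so derivatives of test functions of degree q + 1 have
  the degree q of the trial functions. What \<open>deriv\<close> returns at a node does not matter
  for \<open>pw_poly\<close>.\<close>

lemma pw_poly_deriv:
  assumes \<phi>: "\<phi> \<in> pw_poly N \<tau> (q + 1)"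
  shows "deriv \<phi> \<in> pw_poly N \<tau> q"
    and "\<And>i t. i < N \<Longrightarrow> t \<in> {\<tau> i<..<\<tau> (Suc i)} \<Longrightarrow> (\<phi> has_real_derivative deriv \<phi> t) (at t)"
proof -
  obtain P where P: "\<And>i. i < N \<Longrightarrow> degree (P i) \<le> q + 1"
    "\<And>i t. i < N \<Longrightarrow> t \<in> {\<tau> i<..<\<tau> (Suc i)} \<Longrightarrow> \<phi> t = poly (P i) t"
    using pw_poly_pieces[OF \<phi>] by blast
  have D: "(\<phi> has_real_derivative poly (pderiv (P i)) t) (at t)" if "i < N" "t \<in> {\<tau> i<..<\<tau> (Suc i)}" for i t
    by (rule has_field_derivative_transform_within_open[OF poly_DERIV, where S="{\<tau> i<..<\<tau> (Suc i)}"])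
      (use P(2)[OF that(1)] that in auto)
  then have D': "deriv \<phi> t = poly (pderiv (P i)) t" if "i < N" "t \<in> {\<tau> i<..<\<tau> (Suc i)}" for i t
    using DERIV_imp_deriv that by blast
  show "(\<phi> has_real_derivative deriv \<phi> t) (at t)" if "i < N" "t \<in> {\<tau> i<..<\<tau> (Suc i)}" for i t
    using D[OF that] D'[OF that] by simp
  show "deriv \<phi> \<in> pw_poly N \<tau> q"
    unfolding pw_poly_def
  proof (intro CollectI allI impI)
    fix i assume i: "i < N"
    have "degree (pderiv (P i)) \<le> q" using P(1)[OF i] by (simp add: degree_pderiv)
    then show "\<exists>P. degree P \<le> q \<and> (\<forall>t\<in>{\<tau> i<..<\<tau> (Suc i)}. deriv \<phi> t = poly P t)"
      using D'[OF i] by blast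
  qed
qed

text \<open>Cutting off at a node stays within the trial space; this permits the energy identity on
  [\<tau> i, T] and not merely on [0,T].\<close>

lemma pw_poly_restrict:
  assumes \<phi>: "\<phi> \<in> pw_poly N \<tau> q" and i: "i \<le> N"
  shows "(\<lambda>t. indicator {\<tau> i..T} t * \<phi> t) \<in> pw_poly N \<tau> q"
  unfolding pw_poly_def
proof (intro CollectI allI impI)
  fix j assume j: "j < N"
  show "\<exists>P. degree P \<le> q \<and> (\<forall>t\<in>{\<tau> j<..<\<tau> (Suc j)}. indicator {\<tau> i..T} t * \<phi> t = poly P t)"
  proof (cases "i \<le> j")
    case True
    obtain P where P: "degree P \<le> q" "\<forall>t\<in>{\<tau> j<..<\<tau> (Suc j)}. \<phi> t = poly P t"
      using \<phi> j by (auto simp: pw_poly_def)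
    have "indicator {\<tau> i..T} t * \<phi> t = poly P t" if "t \<in> {\<tau> j<..<\<tau> (Suc j)}" for t
    proof -
      have "t \<in> {\<tau> i..T}" using that interval_subset(1)[OF j] node_mono[OF True] j by force
      then show ?thesis using P(2) that by simp
    qed
    then show ?thesis using P(1) by blast
  next
    case False
    have "indicator {\<tau> i..T} t * \<phi> t = poly 0 t" if "t \<in> {\<tau> j<..<\<tau> (Suc j)}" for t
      using that node_mono[of "Suc j" i] False i by (simp add: indicator_def)
    then show ?thesis by (intro exI[of _ 0]) auto
  qed
qed

lemma cont_tensor_continuous:
  fixes W :: "'v::real_normed_vector set"
  assumes "x \<in> tensor_space (cont_pw_poly N \<tau> q) W"
  shows "continuous_on {0..T} x"
proof -
  obtain m :: nat and \<phi> w where x: "x = (\<lambda>t. \<Sum>j<m. \<phi> j t *\<^sub>R w j)" "\<forall>j<m. \<phi> j \<in> cont_pw_poly N \<tau> q \<and> w j \<in> W"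
    using assms unfolding tensor_space_def by blast
  show ?thesis unfolding x(1)
    by (intro continuous_on_sum continuous_on_scaleR continuous_on_const)
      (use x(2) in \<open>auto simp: cont_pw_poly_def node_bounds\<close>)
qed

text \<open>The representative xH agrees with emb (x t) almost everywhere only. For continuous x the
  two agree at every point, which gives access to values at the nodes.\<close>

lemma test_space_continuous_eq:
  fixes emb :: "'v::{real_inner,banach,second_countable_topology} \<Rightarrow>\<^sub>L 'h::{real_inner,banach,second_countable_topology}"
  assumes X: "(x, g, xH) \<in> test_space emb T W" and x: "continuous_on {0..T} x" and t: "t \<in> {0..T}"
  shows "xH t = emb (x t)"
proof -
  have "continuous_on {0..T} (\<lambda>t. xH t - emb (x t))"
    by (intro continuous_intros test_spaceD(4)[OF X] x)
  moreover have "AE t in time_measure T. xH t - emb (x t) = 0"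
    using test_spaceD(5)[OF X] by eventually_elim simp
  ultimately have "xH t - emb (x t) = 0" using t by (rule continuous_AE_zero[OF _ T])
  then show ?thesis by simp
qed

text \<open>Paired with a fixed u, both sides have the same integrals over interior intervals: one
  by the weak derivative, the other by the fundamental theorem of calculus with the nodes as
  exceptional points. A countable dense set of u then identifies the functionals.\<close>

lemma test_space_tensor_derivative:
  fixes emb :: "'v::{real_inner,banach,second_countable_topology} \<Rightarrow>\<^sub>L 'h::{real_inner,banach,second_countable_topology}"
  assumes X: "(x, g, xH) \<in> test_space emb T UNIV"
    and x: "x = (\<lambda>t. \<Sum>j<(m::nat). \<phi> j t *\<^sub>R w j)" "\<forall>j<m. \<phi> j \<in> cont_pw_poly N \<tau> (q + 1) \<and> w j \<in> W"
  shows "AE t in time_measure T. g t = to_dual emb (\<Sum>j<m. deriv (\<phi> j) t *\<^sub>R w j)"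
proof -
  define v where "v t = (\<Sum>j<m. deriv (\<phi> j) t *\<^sub>R w j)" for t
  have \<phi>: "\<phi> j \<in> pw_poly N \<tau> (q + 1)" if "j < m" for j using x(2) that by (simp add: cont_pw_poly_def)
  have xT: "x \<in> tensor_space (cont_pw_poly N \<tau> (q + 1)) W" unfolding tensor_space_def using x by blast
  note xcont = cont_tensor_continuous[OF xT]
  have "v \<in> tensor_space (pw_poly N \<tau> q) UNIV"
    unfolding tensor_space_def using pw_poly_deriv(1)[OF \<phi>] by (fastforce simp: v_def)
  then have v: "v \<in> L2 T UNIV" by (rule tensor_space_L2[OF _ subspace_UNIV])
  have vd: "(x has_vector_derivative v t) (at t)" if t: "t \<in> {0<..<T}" "t \<notin> \<tau> ` {..N}" for t
  proof -
    obtain i where i: "i < N" "t \<in> {\<tau> i<..<\<tau> (Suc i)}" using interval_cover[OF _ _ t(2)] t(1) by auto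
    have "((\<lambda>t. \<phi> j t *\<^sub>R w j) has_vector_derivative deriv (\<phi> j) t *\<^sub>R w j) (at t)" if "j < m" for j
      using has_vector_derivative_scaleR[OF pw_poly_deriv(2)[OF \<phi>[OF that] i] has_vector_derivative_const[of "w j"]] by simp
    then show ?thesis unfolding x(1) v_def by (intro has_vector_derivative_sum) auto
  qed
  have test: "AE t in time_measure T. (g t - to_dual emb (v t)) u = 0" for u
  proof (rule AE_zero_if_interior_integrals_zero[OF T])
    have ig: "integrable (time_measure T) (\<lambda>t. g t u)"
      by (rule integrable_apply_L2(1)[OF test_spaceD(2)[OF X] L2_const])
    have iv: "integrable (time_measure T) (\<lambda>t. to_dual emb (v t) u)" by (rule integrable_to_dual[OF v])
    show "integrable (time_measure T) (\<lambda>t. (g t - to_dual emb (v t)) u)"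
      using ig iv by (simp add: blinfun.diff_left)
    fix s t :: real assume st: "0 < s" "s < t" "t < T"
    have "(LINT r|time_measure T. indicator {s..t} r * to_dual emb (v r) u) = integral {s..t} (\<lambda>r. to_dual emb (v r) u)"
      by (rule time_integral_interval[OF iv]) (use st in auto)
    also have "\<dots> = emb (x t) \<bullet> emb u - emb (x s) \<bullet> emb u"
    proof (rule integral_unique, rule fundamental_theorem_of_calculus_interior_strong)
      show "finite (\<tau> ` {..N})" by simp
      show "continuous_on {s..t} (\<lambda>r. emb (x r) \<bullet> emb u)"
        by (intro continuous_intros continuous_on_subset[OF xcont]) (use st in auto)
      fix r assume "r \<in> {s<..<t} - \<tau> ` {..N}"
      then have "(x has_vector_derivative v r) (at r)" using st by (intro vd) auto
      then have "((\<lambda>r. x r \<bullet> riesz (to_dual emb u)) has_vector_derivative v r \<bullet> riesz (to_dual emb u)) (at r)"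
        by (rule bounded_linear.has_vector_derivative[OF bounded_linear_inner_left])
      then show "((\<lambda>r. emb (x r) \<bullet> emb u) has_vector_derivative to_dual emb (v r) u) (at r)"
        by (simp add: riesz to_dual_apply inner_commute)
    qed (use st in auto)
    also have "\<dots> = (xH t - xH s) \<bullet> emb u"
      using test_space_continuous_eq[OF X xcont] st by (simp add: inner_diff_left)
    also have "\<dots> = (LINT r|time_measure T. indicator {s..t} r * g r u)"
      by (rule weak_derivative_integral[OF X UNIV_I st])
    finally have "(LINT r|time_measure T. indicator {s..t} r * g r u)
        - (LINT r|time_measure T. indicator {s..t} r * to_dual emb (v r) u) = 0" by simp
    then show "(LINT r|time_measure T. indicator {s..t} r * (g r - to_dual emb (v r)) u) = 0"
      using integrable_indicator_time[OF ig, of s t] integrable_indicator_time[OF iv, of s t]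
      by (simp add: blinfun.diff_left right_diff_distrib)
  qed
  obtain D :: "'v set" where D: "countable D" "closure D = UNIV" by (rule countable_dense_UNIV)
  have "AE t in time_measure T. riesz (g t - to_dual emb (v t)) = 0"
  proof (rule AE_zero_if_weakly_zero[OF D])
    show "AE t in time_measure T. riesz (g t - to_dual emb (v t)) \<bullet> u = 0" for u
      using test[of u] by eventually_elim (simp add: inner_commute[of "riesz _"] riesz)
  qed
  then show ?thesis
  proof eventually_elim
    fix t assume "riesz (g t - to_dual emb (v t)) = 0"
    then have "norm (g t - to_dual emb (v t)) = 0" using riesz(2) by (metis norm_zero)
    then show "g t = to_dual emb (\<Sum>j<m. deriv (\<phi> j) t *\<^sub>R w j)" by (simp add: v_def)
  qed
qed

text \<open>L does not depend on time, so on W each L (w j) is represented by a fixed vector of W,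
  the projection of its Riesz vector. Thus L (v t) is represented by a trial function with the same
  time factors as v, and y is orthogonal to it.\<close>

lemma tensor_orthogonal_form:
  fixes W :: "'v::{real_inner,banach,second_countable_topology} set" and L :: "'v \<Rightarrow>\<^sub>L 'v \<Rightarrow>\<^sub>L real"
  assumes W: "subspace W" "closed W" and y: "y \<in> L2 T W"
    and orth: "\<And>v. v \<in> tensor_space (pw_poly N \<tau> q) W \<Longrightarrow> l2_of T v \<bullet> l2_of T y = 0"
    and v: "v \<in> tensor_space (pw_poly N \<tau> q) W"
  shows "(LINT t|time_measure T. L (v t) (y t)) = 0"
proof -
  obtain m :: nat and \<phi> w where v_eq: "v = (\<lambda>t. \<Sum>j<m. \<phi> j t *\<^sub>R w j)" "\<forall>j<m. \<phi> j \<in> pw_poly N \<tau> q \<and> w j \<in> W"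
    using v unfolding tensor_space_def by blast
  obtain P where P: "\<And>u. P u \<in> W" "\<And>u s. s \<in> W \<Longrightarrow> s \<bullet> P u = s \<bullet> u"
    using hilbert_projection_linear[OF W(2,1)] by metis
  define w' where "w' j = P (riesz (L (w j)))" for j
  have e: "(\<lambda>t. \<phi> j t *\<^sub>R w' j) \<in> tensor_space (pw_poly N \<tau> q) W" if "j < m" for j
    using v_eq(2) that P(1) by (intro tensor_space_single) (auto simp: w'_def)
  have yU: "y \<in> L2 T UNIV" by (rule L2_UNIV[OF y])
  have eU: "(\<lambda>t. \<phi> j t *\<^sub>R w' j) \<in> L2 T UNIV" if "j < m" for j
    by (rule L2_UNIV[OF tensor_space_L2[OF e[OF that] W(1)]])
  have L2s: "(\<lambda>t. \<Sum>j<m. \<phi> j t *\<^sub>R w' j) \<in> L2 T UNIV" by (rule L2_sum) (auto intro: eU)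
  have "AE t in time_measure T. L (v t) (y t) = (\<Sum>j<m. \<phi> j t *\<^sub>R w' j) \<bullet> y t"
    using L2D(3)[OF y]
  proof eventually_elim
    fix t assume "y t \<in> W"
    then have "y t \<bullet> w' j = L (w j) (y t)" for j using P(2) by (simp add: w'_def riesz)
    then show "L (v t) (y t) = (\<Sum>j<m. \<phi> j t *\<^sub>R w' j) \<bullet> y t"
      by (simp add: v_eq(1) blinfun.sum_right blinfun.scaleR_right blinfun.sum_left blinfun.scaleR_left
          inner_sum_left inner_commute[of "w' _"])
  qed
  moreover have "(\<lambda>t. L (v t) (y t)) \<in> borel_measurable (time_measure T)"
    by (rule borel_measurable_apply_L2[OF _ L2D(1)[OF y]])
      (rule borel_measurable_continuous_on[OF _ L2D(1)[OF tensor_space_L2[OF v W(1)]]], intro continuous_intros)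
  moreover have "(\<lambda>t. (\<Sum>j<m. \<phi> j t *\<^sub>R w' j) \<bullet> y t) \<in> borel_measurable (time_measure T)"
    using l2_of_inner(2)[OF L2s yU] by auto
  ultimately have "(LINT t|time_measure T. L (v t) (y t)) = (LINT t|time_measure T. (\<Sum>j<m. \<phi> j t *\<^sub>R w' j) \<bullet> y t)"
    by (intro integral_cong_AE)
  also have "\<dots> = l2_of T (\<lambda>t. \<Sum>j<m. \<phi> j t *\<^sub>R w' j) \<bullet> l2_of T y"
    by (rule l2_of_inner(1)[OF L2s yU, symmetric])
  also have "\<dots> = (\<Sum>j<m. l2_of T (\<lambda>t. \<phi> j t *\<^sub>R w' j) \<bullet> l2_of T y)"
    by (subst l2_of_sum) (auto intro: eU simp: inner_sum_left)
  also have "\<dots> = 0" by (rule sum.neutral) (use orth[OF e] in auto)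
  finally show ?thesis .
qed

text \<open>The derivative of x, cut off at a node, is a trial function, and g is its image under
  \<open>to_dual\<close>.\<close>

lemma test_derivative_orthogonal:
  fixes emb :: "'v::{real_inner,banach,second_countable_topology} \<Rightarrow>\<^sub>L 'h::{real_inner,banach,second_countable_topology}"
  assumes W: "subspace W" "closed W"
    and X: "(x, g, xH) \<in> test_space emb T UNIV" and xT: "x \<in> tensor_space (cont_pw_poly N \<tau> (q + 1)) W"
    and y: "y \<in> L2 T W"
    and orth: "\<And>v. v \<in> tensor_space (pw_poly N \<tau> q) W \<Longrightarrow> l2_of T v \<bullet> l2_of T y = 0"
    and i: "i \<le> N"
  shows "(LINT t|time_measure T. indicator {\<tau> i..T} t * g t (y t)) = 0"
proof -
  obtain m :: nat and \<phi> w where x: "x = (\<lambda>t. \<Sum>j<m. \<phi> j t *\<^sub>R w j)" "\<forall>j<m. \<phi> j \<in> cont_pw_poly N \<tau> (q + 1) \<and> w j \<in> W"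
    using xT unfolding tensor_space_def by blast
  define v where "v t = (\<Sum>j<m. (indicator {\<tau> i..T} t * deriv (\<phi> j) t) *\<^sub>R w j)" for t
  have "(\<lambda>t. indicator {\<tau> i..T} t * deriv (\<phi> j) t) \<in> pw_poly N \<tau> q" if "j < m" for j
    using x(2) that by (intro pw_poly_restrict[OF pw_poly_deriv(1) i]) (auto simp: cont_pw_poly_def)
  then have v: "v \<in> tensor_space (pw_poly N \<tau> q) W"
    unfolding tensor_space_def v_def[abs_def] using x(2)
    by (intro CollectI exI[of _ m] exI[of _ "\<lambda>j t. indicator {\<tau> i..T} t * deriv (\<phi> j) t"] exI[of _ w]) auto
  \<comment> \<open>The inner product of H as a bounded bilinear form on V, so that the time
    derivative is treated by the same lemma as the operator A.\<close>
  define L where "L = Blinfun (to_dual emb)"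
  have L: "L u = to_dual emb u" for u
    unfolding L_def by (simp add: bounded_linear_Blinfun_apply[OF bounded_linear_to_dual])
  have "(LINT t|time_measure T. indicator {\<tau> i..T} t * g t (y t)) = (LINT t|time_measure T. L (v t) (y t))"
  proof (rule integral_cong_AE)
    show "(\<lambda>t. indicator {\<tau> i..T} t * g t (y t)) \<in> borel_measurable (time_measure T)"
      using integrable_indicator_time[OF integrable_apply_L2(1)[OF test_spaceD(2)[OF X] L2_UNIV[OF y]]] by blast
    show "(\<lambda>t. L (v t) (y t)) \<in> borel_measurable (time_measure T)"
      by (rule borel_measurable_apply_L2[OF _ L2D(1)[OF y]])
        (rule borel_measurable_continuous_on[OF _ L2D(1)[OF tensor_space_L2[OF v W(1)]]], intro continuous_intros)
    show "AE t in time_measure T. indicator {\<tau> i..T} t * g t (y t) = L (v t) (y t)"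
      using test_space_tensor_derivative[OF X x]
    proof eventually_elim
      fix t assume g: "g t = to_dual emb (\<Sum>j<m. deriv (\<phi> j) t *\<^sub>R w j)"
      have "v t = indicator {\<tau> i..T} t *\<^sub>R (\<Sum>j<m. deriv (\<phi> j) t *\<^sub>R w j)"
        by (simp add: v_def scaleR_sum_right)
      then show "indicator {\<tau> i..T} t * g t (y t) = L (v t) (y t)"
        by (simp add: g L to_dual_apply blinfun.scaleR_right blinfun.scaleR_left)
    qed
  qed
  also have "\<dots> = 0" by (rule tensor_orthogonal_form[OF W y orth v])
  finally show ?thesis .
qed

text \<open>The energy on \<open>[\<tau> i, T]\<close> forces \<open>x\<close> to vanish at the nodes. Hence \<open>x t = (t - \<tau> i) R t\<close> on the
  \<open>i\<close>-th interval with a polynomial \<open>R\<close> of degree at most \<open>q\<close>, and \<open>x\<close> is orthogonal to \<open>R\<close>.\<close>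

lemma test_orthogonal_trivial:
  fixes emb :: "'v::{real_inner,banach,second_countable_topology} \<Rightarrow>\<^sub>L 'h::{real_inner,banach,second_countable_topology}"
  assumes W: "subspace W" "closed W" and emb: "inj emb"
    and X: "(x, g, xH) \<in> test_space emb T UNIV" and xT: "x \<in> tensor_space (cont_pw_poly N \<tau> (q + 1)) W"
    and orth: "\<And>v. v \<in> tensor_space (pw_poly N \<tau> q) W \<Longrightarrow> l2_of T v \<bullet> l2_of T x = 0"
  shows "l2_of T x = 0"
proof -
  obtain m :: nat and \<phi> w where x: "x = (\<lambda>t. \<Sum>j<m. \<phi> j t *\<^sub>R w j)" "\<forall>j<m. \<phi> j \<in> cont_pw_poly N \<tau> (q + 1) \<and> w j \<in> W"
    using xT unfolding tensor_space_def by blast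
  have \<phi>: "\<phi> j \<in> pw_poly N \<tau> (q + 1)" "continuous_on {0..T} (\<phi> j)" if "j < m" for j
    using x(2) that by (auto simp: cont_pw_poly_def node_bounds)
  have "cont_pw_poly N \<tau> (q + 1) \<subseteq> pw_poly N \<tau> (q + 1)" by (auto simp: cont_pw_poly_def)
  from tensor_space_mono[OF this] have xW: "x \<in> L2 T W" using tensor_space_L2[OF _ W(1)] xT by blast
  note xU = L2_UNIV[OF xW]
  have node0: "x (\<tau> i) = 0" if i: "i \<le> N" for i
  proof -
    have ti: "0 \<le> \<tau> i" "\<tau> i \<le> T" using node_mono[of 0 i] node_mono[of i N] i node_bounds by auto
    have "(norm (xH T))\<^sup>2 - (norm (xH (\<tau> i)))\<^sup>2 = 0"
      using energy_identity[OF X subspace_UNIV T ti(1,2) order_refl]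
        test_derivative_orthogonal[OF W X xT xW orth i] by simp
    then have "xH (\<tau> i) = 0" using test_spaceD(6)[OF X] by simp
    then have "emb (x (\<tau> i)) = emb 0"
      using test_space_continuous_eq[OF X cont_tensor_continuous[OF xT], of "\<tau> i"] ti by simp
    then show ?thesis using emb by (rule injD[rotated])
  qed
  have piece: "AE t in time_measure T. t \<in> {\<tau> i<..<\<tau> (Suc i)} \<longrightarrow> x t = 0" if i: "i < N" for i
  proof -
    let ?I = "{\<tau> i<..<\<tau> (Suc i)}"
    have "\<forall>j. \<exists>P. j < m \<longrightarrow> degree P \<le> q + 1 \<and> (\<forall>t\<in>?I. \<phi> j t = poly P t)"
      using \<phi>(1) i by (auto simp: pw_poly_def)
    from choice[OF this] obtain P where P: "\<And>j. j < m \<Longrightarrow> degree (P j) \<le> q + 1"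
      "\<And>j t. j < m \<Longrightarrow> t \<in> ?I \<Longrightarrow> \<phi> j t = poly (P j) t" by blast
    define R where "R j = synthetic_div (P j) (\<tau> i)" for j
    have div: "poly (P j) t = poly (P j) (\<tau> i) + (t - \<tau> i) * poly (R j) t" for j t
      using arg_cong[OF synthetic_div_correct[of "P j" "\<tau> i"], of "\<lambda>p. poly p t"]
      by (simp add: R_def algebra_simps)
    have degR: "degree (R j) \<le> q" if "j < m" for j
      using P(1)[OF that] by (simp add: R_def degree_synthetic_div)
    \<comment> \<open>The polynomial is prescribed on the open interval only; continuity of the test
      functions carries the identity to the left node.\<close>
    have left: "\<phi> j (\<tau> i) = poly (P j) (\<tau> i)" if j: "j < m" for j
    proof -
      have cl: "closure ?I = {\<tau> i..\<tau> (Suc i)}" using node_less[OF i] by simp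
      have "continuous_on (closure ?I) (\<lambda>t. \<phi> j t - poly (P j) t)"
        unfolding cl by (intro continuous_intros continuous_on_subset[OF \<phi>(2)[OF j] interval_subset(2)[OF i]])
      then have "\<phi> j (\<tau> i) - poly (P j) (\<tau> i) = 0"
        by (rule continuous_constant_on_closure) (use P(2)[OF j] node_less[OF i] in \<open>auto simp: cl\<close>)
      then show ?thesis by simp
    qed
    define v where "v t = (\<Sum>j<m. (if t \<in> ?I then poly (R j) t else 0) *\<^sub>R w j)" for t
    have v: "v \<in> tensor_space (pw_poly N \<tau> q) W"
      unfolding tensor_space_def v_def[abs_def] using x(2) indicator_pw_poly[OF i degR]
      by (intro CollectI exI[of _ m] exI[of _ "\<lambda>j t. if t \<in> ?I then poly (R j) t else 0"] exI[of _ w]) auto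
    note vU = L2_UNIV[OF tensor_space_L2[OF v W(1)]]
    have xv: "x t = (t - \<tau> i) *\<^sub>R v t" if t: "t \<in> ?I" for t
    proof -
      have "x t = (\<Sum>j<m. (poly (P j) (\<tau> i) + (t - \<tau> i) * poly (R j) t) *\<^sub>R w j)"
        unfolding x(1) by (rule sum.cong[OF refl]) (simp only: P(2)[OF _ t] div[symmetric] lessThan_iff)
      also have "\<dots> = (\<Sum>j<m. poly (P j) (\<tau> i) *\<^sub>R w j) + (t - \<tau> i) *\<^sub>R v t"
        using t by (simp add: v_def scaleR_add_left sum.distrib scaleR_sum_right)
      also have "(\<Sum>j<m. poly (P j) (\<tau> i) *\<^sub>R w j) = x (\<tau> i)" unfolding x(1) by (simp add: left)
      finally show ?thesis using node0[of i] i by simp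
    qed
    have v0: "v t = 0" if "t \<notin> ?I" for t using that by (simp add: v_def del: greaterThanLessThan_iff)
    \<comment> \<open>On the interval v t \<bullet> x t = (t - \<tau> i) |v t|^2, so a zero integral
      makes v, and with it x, vanish there almost everywhere.\<close>
    have nonneg: "0 \<le> v t \<bullet> x t" for t
    proof (cases "t \<in> ?I")
      case True
      then have "0 \<le> t - \<tau> i" by simp
      then show ?thesis unfolding xv[OF True] by simp
    qed (simp add: v0)
    have "(LINT t|time_measure T. v t \<bullet> x t) = 0" using orth[OF v] l2_of_inner(1)[OF vU xU] by simp
    then have "AE t in time_measure T. v t \<bullet> x t = 0"
      using integral_nonneg_eq_0_iff_AE[OF l2_of_inner(2)[OF vU xU]] nonneg by simp
    then show ?thesis
    proof eventually_elim
      fix t assume "v t \<bullet> x t = 0"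
      then show "t \<in> ?I \<longrightarrow> x t = 0" using xv[of t] by auto
    qed
  qed
  have "AE t in time_measure T. \<forall>i\<in>{..<N}. t \<in> {\<tau> i<..<\<tau> (Suc i)} \<longrightarrow> x t = 0"
    using piece by (intro AE_finite_allI) auto
  then have "AE t in time_measure T. x t = 0"
    using AE_interval
  proof eventually_elim
    fix t assume all: "\<forall>i\<in>{..<N}. t \<in> {\<tau> i<..<\<tau> (Suc i)} \<longrightarrow> x t = 0"
      and t: "t \<in> {0<..<T} \<and> t \<notin> \<tau> ` {..N}"
    obtain i where "i < N" "t \<in> {\<tau> i<..<\<tau> (Suc i)}" using interval_cover[of t] t by auto
    then show "x t = 0" using all by blast
  qed
  then have "l2_of T x = l2_of T (\<lambda>_. 0)" by (subst l2_of_eq_iff[OF xU L2_zero[OF subspace_UNIV]])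
  then show ?thesis using l2_of_sum[of "{}"] by simp
qed

text \<open>For the projection z of x, the remainder x - z is annihilated by the derivative of x and
  by L (z t) for every fixed form L. So the two parts of B(z, x) become the pairing of g with x and
  the diagonal term L(z, z). C is the constant of injectivity of the projection on the classes of
  test functions. Quantifying over L inside makes z and C independent of \<omega>.\<close>

lemma full_discretization_stable:
  fixes emb :: "'v::{real_inner,banach,second_countable_topology} \<Rightarrow>\<^sub>L 'h::{real_inner,banach,second_countable_topology}"
    and B :: "'v set" and q :: nat
  assumes B: "finite B" and emb: "inj emb"
  defines "Test \<equiv> {(x, g, xH) \<in> test_space emb T UNIV. x \<in> tensor_space (cont_pw_poly N \<tau> (q + 1)) (span B)}"
  obtains C where "0 \<le> C"
    "\<And>x g xH. (x, g, xH) \<in> Test \<Longrightarrow> \<exists>z\<in>tensor_space (pw_poly N \<tau> q) (span B).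
      L2_norm T x \<le> C * L2_norm T z \<and>
      (LINT t|time_measure T. g t (z t)) = (LINT t|time_measure T. g t (x t)) \<and>
      (\<forall>L :: 'v \<Rightarrow>\<^sub>L 'v \<Rightarrow>\<^sub>L real. (LINT t|time_measure T. L (z t) (x t)) = (LINT t|time_measure T. L (z t) (z t)))"
proof -
  let ?W = "span B" and ?Y = "tensor_space (pw_poly N \<tau> q) (span B)"
  have W: "subspace ?W" "closed ?W" using B by (auto intro: closed_span_finite)
  define S where "S = l2_of T ` ?Y"
  have zero: "(\<lambda>t. 0) \<in> tensor_space Q ?W" for Q :: "(real \<Rightarrow> real) set"
    unfolding tensor_space_def by (intro CollectI exI[of _ 0]) auto
  have S: "subspace S" unfolding S_def
  proof (rule subspace_l2_of)
    show "?Y \<subseteq> L2 T UNIV" using tensor_space_L2[OF _ W(1)] L2_UNIV by blast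
    show "?Y \<noteq> {}" using zero by blast
  qed (fact tensor_space_add, fact tensor_space_scaleR[OF _ W(1)])
  have S_closed: "closed S"
    using tensor_space_finite_dim[OF B, of q] closed_finite_dim_subspace[OF S] unfolding S_def by metis
  define V where "V = l2_of T ` {x. \<exists>g xH. (x, g, xH) \<in> Test}"
  have mono: "tensor_space (cont_pw_poly N \<tau> (q + 1)) ?W \<subseteq> tensor_space (pw_poly N \<tau> (q + 1)) ?W"
    by (rule tensor_space_mono) (auto simp: cont_pw_poly_def)
  have TestD: "x \<in> L2 T ?W" "(x, g, xH) \<in> test_space emb T UNIV" "x \<in> tensor_space (cont_pw_poly N \<tau> (q + 1)) ?W"
    if "(x, g, xH) \<in> Test" for x g xH
    using that mono tensor_space_L2[OF _ W(1)] unfolding Test_def by blast+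
  have V: "subspace V" unfolding V_def
  proof (rule subspace_l2_of)
    show "{x. \<exists>g xH. (x, g, xH) \<in> Test} \<subseteq> L2 T UNIV" using TestD(1) L2_UNIV by blast
    show "{x. \<exists>g xH. (x, g, xH) \<in> Test} \<noteq> {}"
      using test_space_zero[OF subspace_UNIV, of emb T] zero unfolding Test_def by blast
    show "(\<lambda>t. y t + z t) \<in> {x. \<exists>g xH. (x, g, xH) \<in> Test}"
      if "y \<in> {x. \<exists>g xH. (x, g, xH) \<in> Test}" "z \<in> {x. \<exists>g xH. (x, g, xH) \<in> Test}" for y z
      using that test_space_add[OF _ _ subspace_UNIV] tensor_space_add unfolding Test_def by blast
    show "(\<lambda>t. c *\<^sub>R y t) \<in> {x. \<exists>g xH. (x, g, xH) \<in> Test}" if "y \<in> {x. \<exists>g xH. (x, g, xH) \<in> Test}" for c y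
      using that test_space_scaleR[OF _ subspace_UNIV] tensor_space_scaleR[OF _ W(1)] unfolding Test_def by blast
  qed
  obtain E where E: "finite E" "l2_of T ` tensor_space (pw_poly N \<tau> (q + 1)) ?W \<subseteq> span E"
    using tensor_space_finite_dim[OF B] .
  have VE: "V \<subseteq> span E" using E(2) mono TestD(3) unfolding V_def by blast
  obtain P where P: "linear P" "\<And>x. P x \<in> S" "\<And>s x. s \<in> S \<Longrightarrow> s \<bullet> P x = s \<bullet> x"
    using hilbert_projection_linear[OF S_closed S] by metis
  have inj: "a = 0" if a: "a \<in> V" "P a = 0" for a
  proof -
    obtain x g xH where x: "(x, g, xH) \<in> Test" "a = l2_of T x" using a(1) by (auto simp: V_def)
    have "l2_of T x = 0"
    proof (rule test_orthogonal_trivial[OF W emb TestD(2,3)[OF x(1)]])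
      fix v assume "v \<in> ?Y"
      then have "l2_of T v \<in> S" by (simp add: S_def)
      from P(3)[OF this, of a] show "l2_of T v \<bullet> l2_of T x = 0" using a(2) x(2) by simp
    qed
    then show ?thesis using x(2) by simp
  qed
  obtain C where C: "0 \<le> C" "\<And>a. a \<in> V \<Longrightarrow> norm a \<le> C * norm (P a)"
    using linear_injective_bound[OF P(1) V VE E(1) inj] by metis
  have "\<exists>z\<in>?Y. L2_norm T x \<le> C * L2_norm T z \<and>
      (LINT t|time_measure T. g t (z t)) = (LINT t|time_measure T. g t (x t)) \<and>
      (\<forall>L :: 'v \<Rightarrow>\<^sub>L 'v \<Rightarrow>\<^sub>L real. (LINT t|time_measure T. L (z t) (x t)) = (LINT t|time_measure T. L (z t) (z t)))"
    if X: "(x, g, xH) \<in> Test" for x g xH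
  proof -
    obtain z where z: "z \<in> ?Y" "P (l2_of T x) = l2_of T z" using P(2)[of "l2_of T x"] by (auto simp: S_def)
    have zW: "z \<in> L2 T ?W" by (rule tensor_space_L2[OF z(1) W(1)])
    note xW = TestD(1)[OF X]
    note zU = L2_UNIV[OF zW] and xU = L2_UNIV[OF xW]
    define y where "y t = x t - z t" for t
    have yW: "y \<in> L2 T ?W" unfolding y_def by (rule L2_diff[OF xW zW W(1)])
    have orth: "l2_of T v \<bullet> l2_of T y = 0" if "v \<in> ?Y" for v
    proof -
      have "l2_of T v \<in> S" using that by (simp add: S_def)
      from P(3)[OF this, of "l2_of T x"] show ?thesis
        unfolding y_def l2_of_diff[OF xU zU] by (simp add: z(2) inner_diff_right)
    qed
    have "norm (l2_of T x) \<le> C * norm (l2_of T z)" using C(2)[of "l2_of T x"] X z(2) by (auto simp: V_def)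
    then have 1: "L2_norm T x \<le> C * L2_norm T z" by (simp add: norm_l2_of xU zU)
    note gL = test_spaceD(2)[OF TestD(2)[OF X]]
    have "(LINT t|time_measure T. g t (y t)) = (LINT t|time_measure T. indicator {\<tau> 0..T} t * g t (y t))"
      by (rule Bochner_Integration.integral_cong) (auto simp: node_bounds)
    also have "\<dots> = 0" by (rule test_derivative_orthogonal[OF W TestD(2,3)[OF X] yW orth]) auto
    finally have "(LINT t|time_measure T. g t (x t) - g t (z t)) = 0" by (simp add: y_def blinfun.diff_right)
    then have 2: "(LINT t|time_measure T. g t (z t)) = (LINT t|time_measure T. g t (x t))"
      using integrable_apply_L2(1)[OF gL xU] integrable_apply_L2(1)[OF gL zU] by simp
    have 3: "(LINT t|time_measure T. L (z t) (x t)) = (LINT t|time_measure T. L (z t) (z t))" for L :: "'v \<Rightarrow>\<^sub>L 'v \<Rightarrow>\<^sub>L real"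
    proof -
      have Lz: "(\<lambda>t. riesz (L (z t))) \<in> L2 T UNIV"
        by (rule L2_bounded_linear[OF bounded_linear_compose[OF bounded_linear_riesz blinfun.bounded_linear_right] zU])
      have "(LINT t|time_measure T. L (z t) (y t)) = 0" by (rule tensor_orthogonal_form[OF W yW orth z(1)])
      then have "(LINT t|time_measure T. L (z t) (x t) - L (z t) (z t)) = 0" by (simp add: y_def blinfun.diff_right)
      then show ?thesis
        using l2_of_inner(2)[OF xU Lz] l2_of_inner(2)[OF zU Lz] by (simp add: riesz)
    qed
    show ?thesis using z(1) 1 2 3 by blast
  qed
  then show ?thesis using that C(1) by blast
qed

end

text \<open>Time-independence replaces A by the single form A 0 \<omega>, so the stability lemma
  applies. Then B(z, x) is half of |x(0)|^2, by the energy identity for x, plus the integral of A(z,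
  z), which coercivity bounds below.\<close>

lemma (in parabolic_problem) full_discretization_in_Lp:
  assumes B: "finite B" and emb: "inj emb" and part: "is_partition T N \<tau>"
    and A_const: "AE \<omega> in M. \<forall>s\<in>{0..T}. \<forall>t\<in>{0..T}. A s \<omega> = A t \<omega>"
    and U: "AE \<omega> in M. unique_solution T (\<lambda>t. A t \<omega>) (\<lambda>t. f t \<omega>) (u0 \<omega>)
      (tensor_space (pw_poly N \<tau> q) (span B))
      {(x, g, xH) \<in> test_space emb T UNIV. x \<in> tensor_space (cont_pw_poly N \<tau> (q + 1)) (span B)} (U \<omega>)"
  shows "in_Lp M p (L2 T UNIV) (L2_norm T) U"
proof -
  interpret time_partition T N \<tau> by unfold_locales (fact part T)+
  let ?Y = "tensor_space (pw_poly N \<tau> q) (span B)"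
  let ?X = "{(x, g, xH) \<in> test_space emb T UNIV. x \<in> tensor_space (cont_pw_poly N \<tau> (q + 1)) (span B)}"
  have W: "subspace (span B)" by (rule subspace_span)
  have zero: "(\<lambda>t. 0) \<in> tensor_space Q (span B)" for Q :: "(real \<Rightarrow> real) set"
    unfolding tensor_space_def by (intro CollectI exI[of _ 0]) auto
  obtain C where C: "0 \<le> C" and stab:
    "\<And>x g xH. (x, g, xH) \<in> ?X \<Longrightarrow> \<exists>z\<in>?Y. L2_norm T x \<le> C * L2_norm T z \<and>
      (LINT t|time_measure T. g t (z t)) = (LINT t|time_measure T. g t (x t)) \<and>
      (\<forall>L :: 'v \<Rightarrow>\<^sub>L 'v \<Rightarrow>\<^sub>L real. (LINT t|time_measure T. L (z t) (x t)) = (LINT t|time_measure T. L (z t) (z t)))"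
    by (rule full_discretization_stable[OF B emb, of q]) blast
  have Y_L2: "?Y \<subseteq> L2 T UNIV" using tensor_space_L2[OF _ W] L2_UNIV by blast
  have Y_ne: "?Y \<noteq> {}" using zero by blast
  have subspace_Y: "subspace (l2_of T ` ?Y)"
    by (rule subspace_l2_of[OF Y_L2 Y_ne]) (fact tensor_space_add, fact tensor_space_scaleR[OF _ W])
  have "tensor_space (cont_pw_poly N \<tau> (q + 1)) (span B) \<subseteq> tensor_space (pw_poly N \<tau> (q + 1)) (span B)"
    by (rule tensor_space_mono) (auto simp: cont_pw_poly_def)
  then have X_L2: "x \<in> L2 T UNIV \<and> g \<in> L2 T UNIV" if "(x, g, xH) \<in> ?X" for x g xH
    using that tensor_space_L2[OF _ W] L2_UNIV test_spaceD(2) by blast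
  show ?thesis
  proof (rule solution_in_Lp[OF Y_L2 Y_ne _ _ _ X_L2 _ _ _ C _ U])
    show "(\<lambda>t. y t + z t) \<in> ?Y" if "y \<in> ?Y" "z \<in> ?Y" for y z using that by (rule tensor_space_add)
    show "(\<lambda>t. c *\<^sub>R y t) \<in> ?Y" if "y \<in> ?Y" for c y using that W by (rule tensor_space_scaleR)
    show "closed (l2_of T ` ?Y)"
      using tensor_space_finite_dim[OF B, of q] closed_finite_dim_subspace[OF subspace_Y] by metis
    show "?X \<noteq> {}" using test_space_zero[OF subspace_UNIV, of emb T] zero by blast
    show "(\<lambda>t. x t + x' t, \<lambda>t. g t + g' t, \<lambda>t. xH t + xH' t) \<in> ?X"
      if "(x, g, xH) \<in> ?X" "(x', g', xH') \<in> ?X" for x g xH x' g' xH'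
      using that by (simp add: test_space_add[OF _ _ subspace_UNIV] tensor_space_add)
    show "(\<lambda>t. c *\<^sub>R x t, \<lambda>t. c *\<^sub>R g t, \<lambda>t. c *\<^sub>R xH t) \<in> ?X" if "(x, g, xH) \<in> ?X" for c x g xH
      using that by (simp add: test_space_scaleR[OF _ subspace_UNIV] tensor_space_scaleR[OF _ W])
    show "AE \<omega> in M. \<forall>(x, g, xH)\<in>?X. \<exists>z\<in>?Y. (norm (xH 0))\<^sup>2 / 2 + Amin \<omega> * (L2_norm T z)\<^sup>2
        \<le> B_star T (\<lambda>t. A t \<omega>) z x g \<and> L2_norm T x \<le> C * L2_norm T z"
      using AE_good A_coercive A_const
    proof eventually_elim
      fix \<omega> assume \<omega>: "good \<omega>" and c: "\<forall>t\<in>{0..T}. \<forall>v. Amin \<omega> * (norm v)\<^sup>2 \<le> A t \<omega> v v"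
        and const: "\<forall>s\<in>{0..T}. \<forall>t\<in>{0..T}. A s \<omega> = A t \<omega>"
      have A0: "A t \<omega> = A 0 \<omega>" if "t \<in> space (time_measure T)" for t
        by (rule const[rule_format, OF time_mem[OF that]]) (use T in simp)
      have A_int: "(LINT t|time_measure T. A t \<omega> (y t) (z t)) = (LINT t|time_measure T. A 0 \<omega> (y t) (z t))" for y z
        by (rule Bochner_Integration.integral_cong) (simp_all only: A0)
      have "\<exists>z\<in>?Y. (norm (xH 0))\<^sup>2 / 2 + Amin \<omega> * (L2_norm T z)\<^sup>2
        \<le> B_star T (\<lambda>t. A t \<omega>) z x g \<and> L2_norm T x \<le> C * L2_norm T z" if X: "(x, g, xH) \<in> ?X" for x g xH
      proof -
        obtain z where z: "z \<in> ?Y" "L2_norm T x \<le> C * L2_norm T z"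
          "(LINT t|time_measure T. g t (z t)) = (LINT t|time_measure T. g t (x t))"
          "\<And>L :: 'v \<Rightarrow>\<^sub>L 'v \<Rightarrow>\<^sub>L real. (LINT t|time_measure T. L (z t) (x t)) = (LINT t|time_measure T. L (z t) (z t))"
          using stab[OF X] by blast
        have L2: "x \<in> L2 T UNIV" "g \<in> L2 T UNIV" "z \<in> L2 T UNIV" using X_L2[OF X] Y_L2 z(1) by auto
        have "(x, g, xH) \<in> test_space emb T UNIV" using X by simp
        from test_space_energy[OF this subspace_UNIV T]
        have "(norm (xH 0))\<^sup>2 / 2 + Amin \<omega> * (L2_norm T z)\<^sup>2 \<le> B_star T (\<lambda>t. A t \<omega>) z x g"
          using B_star_split[OF \<omega> L2(3,1,2)] A_coercive_integral[OF \<omega> c L2(3)]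
          by (simp add: A_int z(3) z(4)[of "A 0 \<omega>"])
        then show ?thesis using z(1,2) by blast
      qed
      then show "\<forall>(x, g, xH)\<in>?X. \<exists>z\<in>?Y. (norm (xH 0))\<^sup>2 / 2 + Amin \<omega> * (L2_norm T z)\<^sup>2
        \<le> B_star T (\<lambda>t. A t \<omega>) z x g \<and> L2_norm T x \<le> C * L2_norm T z" by blast
    qed
  qed
qed

theorem theorem12:
  fixes M :: "'w measure"
    and F :: "real \<Rightarrow> 'w measure"
    and T :: real
    and emb :: "'v::{real_inner, banach, second_countable_topology} \<Rightarrow>\<^sub>L
                'h::{real_inner, banach, second_countable_topology}"
    and A :: "real \<Rightarrow> 'w \<Rightarrow> 'v \<Rightarrow>\<^sub>L 'v \<Rightarrow>\<^sub>L real"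
    and Amin Amax :: "'w \<Rightarrow> real"
    and f :: "real \<Rightarrow> 'w \<Rightarrow> 'v \<Rightarrow>\<^sub>L real"
    and u0 :: "'w \<Rightarrow> 'h"
    and \<alpha> \<beta> \<gamma> p :: ennreal
    and u :: "'w \<Rightarrow> real \<Rightarrow> 'v"
    and I :: "'i set" and Vh :: "'i \<Rightarrow> 'v set"
    and uh :: "'i \<Rightarrow> 'w \<Rightarrow> real \<Rightarrow> 'v"
    and D :: "('i \<times> 'j) set" and N :: "'j \<Rightarrow> nat" and \<tau> :: "'j \<Rightarrow> nat \<Rightarrow> real"
    and q :: nat
    and U :: "'i \<Rightarrow> 'j \<Rightarrow> 'w \<Rightarrow> real \<Rightarrow> 'v"
  assumes "0 < T" and "prob_space M" and "complete_measure M" and "normal_filtration M T F"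
    and "gelfand_triple emb"
    and "progressively_measurable_op T F A"
    and "Amin \<in> borel_measurable M" and "Amax \<in> borel_measurable M"
    and "AE \<omega> in M. 0 < Amin \<omega> \<and> 0 < Amax \<omega>"
    and "AE \<omega> in M. \<forall>t\<in>{0..T}. \<forall>v w. \<bar>A t \<omega> v w\<bar> \<le> Amax \<omega> * norm v * norm w"
    and "AE \<omega> in M. \<forall>t\<in>{0..T}. \<forall>v. Amin \<omega> * (norm v)\<^sup>2 \<le> A t \<omega> v v"
    and "progressively_measurable T F f"
    and "AE \<omega> in M. (\<lambda>t. f t \<omega>) \<in> L2 T UNIV"
    and "u0 \<in> borel_measurable M"
    and self_adjoint: "AE \<omega> in M. \<forall>t\<in>{0..T}. \<forall>v w. A t \<omega> v w = A t \<omega> w v"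
    and "1 \<le> \<alpha>" and "1 \<le> \<beta>" and "1 \<le> \<gamma>"
    and "in_Lp M \<alpha> (L2 T UNIV) (L2_norm T) (\<lambda>\<omega> t. f t \<omega>)"
    and "in_Lp M \<beta> UNIV norm u0"
    and "in_Lp M \<gamma> UNIV norm (\<lambda>\<omega>. inverse (Amin \<omega>))"
    and "p = min (harmonic_exponent \<alpha> \<gamma>) (harmonic_exponent \<beta> (2 * \<gamma>))"
    and "1 \<le> p"
    and u: "AE \<omega> in M. unique_solution T (\<lambda>t. A t \<omega>) (\<lambda>t. f t \<omega>) (u0 \<omega>)
              (L2 T UNIV) (test_space emb T UNIV) (u \<omega>)"
    and "\<forall>h\<in>I. nonzero_fin_dim_subspace (Vh h)"
    and projection_stable:
      "\<exists>C. \<forall>h\<in>I. \<forall>v. norm (H_projection emb (Vh h) (emb v)) \<le> C * norm v"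
    and uh: "\<forall>h\<in>I. AE \<omega> in M. unique_solution T (\<lambda>t. A t \<omega>) (\<lambda>t. f t \<omega>) (u0 \<omega>)
              (L2 T (Vh h)) (test_space emb T (Vh h)) (uh h \<omega>)"
  shows "in_Lp M p (L2 T UNIV) (L2_norm T) u \<and>
    (\<forall>h\<in>I. in_Lp M p (L2 T UNIV) (L2_norm T) (uh h)) \<and>
    ((AE \<omega> in M. \<forall>s\<in>{0..T}. \<forall>t\<in>{0..T}. A s \<omega> = A t \<omega>) \<longrightarrow>
     (\<forall>(h, k)\<in>D. h \<in> I \<and> is_partition T (N k) (\<tau> k)) \<longrightarrow>
     bdd_above ((\<lambda>(h, k). cfl_constant emb (Vh h) (mesh (N k) (\<tau> k))) ` D) \<longrightarrow>
     (\<forall>(h, k)\<in>D. AE \<omega> in M. unique_solution T (\<lambda>t. A t \<omega>) (\<lambda>t. f t \<omega>) (u0 \<omega>)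
        (tensor_space (pw_poly (N k) (\<tau> k) q) (Vh h))
        {(x, g, xH) \<in> test_space emb T UNIV.
           x \<in> tensor_space (cont_pw_poly (N k) (\<tau> k) (q + 1)) (Vh h)}
        (U h k \<omega>)) \<longrightarrow>
     bdd_above ((\<lambda>\<omega>. \<bar>Amax \<omega> / Amin \<omega>\<bar>) ` space M) \<longrightarrow>
     (\<forall>(h, k)\<in>D. in_Lp M p (L2 T UNIV) (L2_norm T) (U h k)))"
proof -
  have rng: "Lp_bounded M \<alpha> (\<lambda>\<omega>. L2_norm T (\<lambda>t. f t \<omega>))" "Lp_bounded M \<beta> (\<lambda>\<omega>. norm (u0 \<omega>))"
    "Lp_bounded M \<gamma> (\<lambda>\<omega>. norm (inverse (Amin \<omega>)))"
    using assms(19-21) unfolding in_Lp_def Lp_bounded_def by blast+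
  have p: "p \<le> harmonic_exponent \<alpha> \<gamma>" "p \<le> harmonic_exponent \<beta> (2 * \<gamma>)" using assms(22) by simp_all
  interpret prob_space M by fact
  interpret complete_measure M by fact
  interpret parabolic_problem M F T emb A Amin Amax f u0 \<alpha> \<beta> \<gamma> p
    by unfold_locales (fact assms rng p)+
  have emb: "inj emb" using assms(5) by (simp add: gelfand_triple_def)
  have Vh: "\<exists>B. finite B \<and> Vh h = span B" if "h \<in> I" for h
    using assms(25) that by (auto simp: nonzero_fin_dim_subspace_def)
  have "in_Lp M p (L2 T UNIV) (L2_norm T) u"
    by (rule semidiscrete_in_Lp[OF subspace_UNIV closed_UNIV u])
  moreover have "in_Lp M p (L2 T UNIV) (L2_norm T) (uh h)" if h: "h \<in> I" for h
  proof -
    obtain B where "finite B" "Vh h = span B" using Vh[OF h] by blast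
    then have "subspace (Vh h)" "closed (Vh h)" by (auto intro: closed_span_finite)
    then show ?thesis by (rule semidiscrete_in_Lp) (use uh h in blast)
  qed
  moreover have "in_Lp M p (L2 T UNIV) (L2_norm T) (U h k)"
    if "AE \<omega> in M. \<forall>s\<in>{0..T}. \<forall>t\<in>{0..T}. A s \<omega> = A t \<omega>" "h \<in> I" "is_partition T (N k) (\<tau> k)"
      "AE \<omega> in M. unique_solution T (\<lambda>t. A t \<omega>) (\<lambda>t. f t \<omega>) (u0 \<omega>)
        (tensor_space (pw_poly (N k) (\<tau> k) q) (Vh h))
        {(x, g, xH) \<in> test_space emb T UNIV. x \<in> tensor_space (cont_pw_poly (N k) (\<tau> k) (q + 1)) (Vh h)}
        (U h k \<omega>)" for h k
  proof -
    obtain B where B: "finite B" "Vh h = span B" using Vh[OF \<open>h \<in> I\<close>] by blast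
    show ?thesis by (rule full_discretization_in_Lp[OF B(1) emb that(3,1) that(4)[unfolded B(2)]])
  qed
  ultimately show ?thesis by fast
qed

end
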